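(* For any finitely generated nilpotent group $G$, there is an algorithm that solves the word problem in $G$ and whose worst-case time complexity is $O(n \cdot \log^{(k)} n)$ for every integer $k\ge 1$, where $n$ is the length of the input word.
   Context: Algorithms run on multitape Turing machines. The group $G$ is given with a fixed finite generating set $X$; input words are arbitrary (not necessarily freely reduced) words in the letters $X\cup X^{-1}$. The word problem: given a word $w$, decide whether $w=1$ in $G$. For an algorithm, $T(w)$ is its running time on $w$; the worst-case time complexity is $O(f(n))$ if there is a constant $C$ with $T(w)\le C f(n)$ for all words $w$ of length $n$ (here $C$ may depend on $G$, $X$ and $k$; the algorithm is the same for all $k$). Logarithms are to base 2. $\log^{(k)} n$ denotes the $k$-fold iterated logarithm $\log\log\cdots\log n$ (with $k$ logarithms), with the convention that $\log^{(k)} n=1$ if there is $j\le k$ such that $\log^{(j)} n<1$. *)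

theory Defs
  imports Complex_Main "HOL-Algebra.Generated_Groups"
begin

section \<open>Nilpotent groups\<close>

definition commutator_subgroup ::
  "('a, 'b) monoid_scheme \<Rightarrow> 'a set \<Rightarrow> 'a set \<Rightarrow> 'a set"
  where "commutator_subgroup G H K =
    generate G (\<Union>h \<in> H. \<Union>k \<in> K.
      {h \<otimes>\<^bsub>G\<^esub> k \<otimes>\<^bsub>G\<^esub> inv\<^bsub>G\<^esub> h \<otimes>\<^bsub>G\<^esub> inv\<^bsub>G\<^esub> k})"

text \<open>Indexing starts at 0, so the term with index \<open>c\<close> is the subgroup usually
  called \<open>\<gamma>\<^sub>c\<^sub>+\<^sub>1\<close>.\<close>

fun lower_central_series :: "('a, 'b) monoid_scheme \<Rightarrow> nat \<Rightarrow> 'a set"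
  where
    "lower_central_series G 0 = carrier G"
  | "lower_central_series G (Suc c) =
       commutator_subgroup G (lower_central_series G c) (carrier G)"

definition nilpotent_group :: "('a, 'b) monoid_scheme \<Rightarrow> bool"
  where "nilpotent_group G \<longleftrightarrow>
    group G \<and> (\<exists>c. lower_central_series G c = {\<one>\<^bsub>G\<^esub>})"


section \<open>Words in group generators\<close>

text \<open>A letter is a formal symbol: \<open>(x, True)\<close> stands for the generator \<open>x\<close> and
  \<open>(x, False)\<close> for its formal inverse. Words are arbitrary lists of letters, not
  necessarily freely reduced.\<close>

definition group_letters :: "'a set \<Rightarrow> ('a \<times> bool) set"
  where "group_letters X = X \<times> UNIV"

fun letter_value :: "('a, 'b) monoid_scheme \<Rightarrow> 'a \<times> bool \<Rightarrow> 'a"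
  where "letter_value G (x, e) = (if e then x else inv\<^bsub>G\<^esub> x)"

definition word_value :: "('a, 'b) monoid_scheme \<Rightarrow> ('a \<times> bool) list \<Rightarrow> 'a"
  where "word_value G w = foldr (\<lambda>l g. letter_value G l \<otimes>\<^bsub>G\<^esub> g) w \<one>\<^bsub>G\<^esub>"

definition word_problem ::
  "('a, 'b) monoid_scheme \<Rightarrow> 'a set \<Rightarrow> ('a \<times> bool) list set"
  where "word_problem G X = {w \<in> lists (group_letters X). word_value G w = \<one>\<^bsub>G\<^esub>}"


section \<open>Deterministic multitape Turing machines\<close>

text \<open>Tapes are infinite in both directions. Initially the word is written on tape 0,
  in cells \<open>0, 1, \<dots>\<close>; every other cell of every tape is blank and all heads are on
  cell 0.\<close>

datatype 'i tape_symbol = Blank | Input 'i | Work nat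

datatype head_move = Move_Left | Move_Stay | Move_Right

record 'i turing_machine =
  tm_tapes :: nat
  tm_states :: "nat set"
  tm_alphabet :: "'i tape_symbol set"
  tm_start :: nat
  tm_accept :: nat
  tm_reject :: nat
  tm_delta :: "nat \<Rightarrow> 'i tape_symbol list \<Rightarrow> nat \<times> ('i tape_symbol \<times> head_move) list"

definition is_turing_machine :: "'i set \<Rightarrow> 'i turing_machine \<Rightarrow> bool"
  where "is_turing_machine \<Sigma> M \<longleftrightarrow>
    1 \<le> tm_tapes M \<and>
    finite (tm_states M) \<and>
    {tm_start M, tm_accept M, tm_reject M} \<subseteq> tm_states M \<and>
    tm_accept M \<noteq> tm_reject M \<and>
    finite (tm_alphabet M) \<and>
    insert Blank (Input ` \<Sigma>) \<subseteq> tm_alphabet M \<and>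
    (\<forall>q \<in> tm_states M. \<forall>ss \<in> lists (tm_alphabet M). length ss = tm_tapes M \<longrightarrow>
      (case tm_delta M q ss of (q', acts) \<Rightarrow>
        q' \<in> tm_states M \<and> length acts = tm_tapes M \<and>
        acts \<in> lists (tm_alphabet M \<times> UNIV)))"

type_synonym 'i tape = "int \<times> (int \<Rightarrow> 'i tape_symbol)"

type_synonym 'i config = "nat \<times> 'i tape list"

fun tape_read :: "'i tape \<Rightarrow> 'i tape_symbol"
  where "tape_read (h, t) = t h"

fun move_offset :: "head_move \<Rightarrow> int"
  where
    "move_offset Move_Left = - 1"
  | "move_offset Move_Stay = 0"
  | "move_offset Move_Right = 1"

fun tape_act :: "'i tape_symbol \<times> head_move \<Rightarrow> 'i tape \<Rightarrow> 'i tape"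
  where "tape_act (s, m) (h, t) = (h + move_offset m, t(h := s))"

definition blank_tape :: "'i tape"
  where "blank_tape = (0, \<lambda>_. Blank)"

definition input_tape :: "'i list \<Rightarrow> 'i tape"
  where "input_tape w =
    (0, \<lambda>i. if 0 \<le> i \<and> i < int (length w) then Input (w ! nat i) else Blank)"

definition initial_config :: "'i turing_machine \<Rightarrow> 'i list \<Rightarrow> 'i config"
  where "initial_config M w =
    (tm_start M, input_tape w # replicate (tm_tapes M - 1) blank_tape)"

definition halted :: "'i turing_machine \<Rightarrow> 'i config \<Rightarrow> bool"
  where "halted M c \<longleftrightarrow> fst c \<in> {tm_accept M, tm_reject M}"

definition tm_step :: "'i turing_machine \<Rightarrow> 'i config \<Rightarrow> 'i config"
  where "tm_step M c =
    (if halted M c then c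
     else case c of (q, tapes) \<Rightarrow>
       (case tm_delta M q (map tape_read tapes) of (q', acts) \<Rightarrow>
         (q', map2 tape_act acts tapes)))"

definition tm_run :: "'i turing_machine \<Rightarrow> 'i list \<Rightarrow> nat \<Rightarrow> 'i config"
  where "tm_run M w t = (tm_step M ^^ t) (initial_config M w)"

definition tm_halts :: "'i turing_machine \<Rightarrow> 'i list \<Rightarrow> bool"
  where "tm_halts M w \<longleftrightarrow> (\<exists>t. halted M (tm_run M w t))"

definition tm_accepts :: "'i turing_machine \<Rightarrow> 'i list \<Rightarrow> bool"
  where "tm_accepts M w \<longleftrightarrow> (\<exists>t. fst (tm_run M w t) = tm_accept M)"

text \<open>The running time is meaningful only for words on which the machine halts.\<close>

definition running_time :: "'i turing_machine \<Rightarrow> 'i list \<Rightarrow> nat"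
  where "running_time M w = (LEAST t. halted M (tm_run M w t))"

definition tm_decides :: "'i set \<Rightarrow> 'i turing_machine \<Rightarrow> 'i list set \<Rightarrow> bool"
  where "tm_decides \<Sigma> M L \<longleftrightarrow>
    (\<forall>w \<in> lists \<Sigma>. tm_halts M w \<and> (tm_accepts M w \<longleftrightarrow> w \<in> L))"


section \<open>Worst-case time complexity\<close>

text \<open>The empty word is left out because the bounds of interest vanish at length 0,
  while a machine in general needs at least one step on every input.\<close>

definition worst_case_time :: "'i set \<Rightarrow> 'i turing_machine \<Rightarrow> (nat \<Rightarrow> real) \<Rightarrow> bool"
  where "worst_case_time \<Sigma> M f \<longleftrightarrow>
    (\<exists>C::real. \<forall>w \<in> lists \<Sigma>. w \<noteq> [] \<longrightarrow> real (running_time M w) \<le> C * f (length w))"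

text \<open>Once some iterate drops below 1 the value is 1 by convention, so for \<open>x > 0\<close> values of
  \<^const>\<open>log\<close> outside its natural domain never matter.\<close>

definition iterated_log :: "nat \<Rightarrow> real \<Rightarrow> real"
  where "iterated_log k x =
    (if \<exists>j \<in> {1..k}. (log 2 ^^ j) x < 1 then 1 else (log 2 ^^ k) x)"

end

theory Submission
  imports Defs "HOL-Library.Countable_Set"
begin

text \<open>The word problem is even solvable in linear time. Some subgroup \<open>M\<close> of finite index embeds
  into a group of integer unitriangular matrices, because polynomial functions separate the
  elements of \<open>M\<close> from \<open>1\<close>. On unitriangular matrices the dilation that multiplies the entry
  \<open>(i, j)\<close> by \<open>3 ^ (i - j)\<close> is an injective endomorphism, and there are a finite set \<open>B\<close> of matrices
  and a finite set \<open>D\<close> of digits with \<open>D B B \<subseteq> dilate(B) D\<close>. Hence a finite-state transducer that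
  reads two letters of \<open>B\<close> at a time and keeps a digit as its state rewrites a word over \<open>B\<close> to a
  word \<open>v\<close> of half the length and a final digit \<open>d\<close> such that the value of the original word is
  \<open>dilate(value v) \<cdot> d\<close>, which is \<open>1\<close> iff \<open>d = 1\<close> and \<open>v\<close> has value \<open>1\<close>. Iterating takes time
  \<open>O(n + n/2 + n/4 + \<dots>)\<close>. The first pass in addition keeps track of the coset of \<open>M\<close>.\<close>

section \<open>A linear-time machine that halves words\<close>

text \<open>Linear time meets all the bounds at once, because the convention for iterated logarithms
  keeps \<open>iterated_log k\<close> at least 1 for \<open>k \<ge> 1\<close>. Passing to a subgroup
  of finite index is forced: a polynomial function with rational values is constant on every finite
  cyclic subgroup, so it cannot tell a torsion element from 1. A suitable subgroup is assembled by
  adjoining one generator at a time along the lower central series. The obstacle is to extend a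
  polynomial function from \<open>N\<close> to the group generated by \<open>N\<close> and
  \<open>b\<close>: translating by \<open>b\<close> conjugates the argument, and conjugation need
  not lower the degree. Nilpotency helps, since the discrepancy between \<open>n\<close> and its
  conjugate lies deeper in the lower central series; degrees are therefore counted with weights. The
  base 3 of the dilation leaves room: multiplying two letters can double the bound on an entry, so
  base 2 would merely reproduce it, with nothing to spare for the digits and for products of entries
  nearer the diagonal. Base 3 leaves one third for them.\<close>

definition fill :: "int \<Rightarrow> 'i tape_symbol list \<Rightarrow> int \<Rightarrow> 'i tape_symbol"
  where "fill h w = (\<lambda>i. if h \<le> i \<and> i < h + int (length w) then w ! nat (i - h) else Blank)"

lemma fill_Nil [simp]: "fill h [] = (\<lambda>_. Blank)"
  by (auto simp: fill_def fun_eq_iff)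

lemma fill_Cons_head [simp]: "fill h (s # w) h = s"
  by (auto simp: fill_def)

lemma fill_erase_head: "(fill h (s # w))(h := Blank) = fill (h + 1) w"
proof
  fix i
  have "nat (i - h) = Suc (nat (i - (h + 1)))" if "h + 1 \<le> i" using that by simp
  then show "((fill h (s # w))(h := Blank)) i = fill (h + 1) w i"
    by (auto simp: fill_def)
qed

lemma fill_write_head: "(fill (h + 1) w)(h := s) = fill h (s # w)"
proof
  fix i
  have "nat (i - h) = Suc (nat (i - (h + 1)))" if "h + 1 \<le> i" using that by simp
  then show "((fill (h + 1) w)(h := s)) i = fill h (s # w) i"
    by (auto simp: fill_def)
qed

lemma fill_write_end: "i = h + int (length w) \<Longrightarrow> (fill h w)(i := s) = fill h (w @ [s])"
  by (rule ext) (auto simp: fill_def nth_append)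

lemma fill_read_end: "i = h + int (length w) \<Longrightarrow> fill h (w @ [s]) i = s"
  by (auto simp: fill_def nth_append)

lemma fill_erase_end: "i = h + int (length w) \<Longrightarrow> (fill h (w @ [s]))(i := Blank) = fill h w"
  by (rule ext) (auto simp: fill_def nth_append)

text \<open>One step sees only one cell of tape 0, so a pair is read in two steps:
  \<open>Scan\<close> reads its first letter and \<open>Pair\<close> keeps that letter in the finite
  control while the second is read. \<open>Back\<close> returns the output from tape 1 to tape 0
  between passes.\<close>

datatype ('q, 'i) phase = Halt bool | Scan 'q nat | Pair 'q nat "'i tape_symbol" | Back

text \<open>The abstract transducer: \<open>\<tau> q s s'\<close> consumes two letters and emits the
  number of a \<open>Work\<close> letter. The second letter may be \<open>Blank\<close>, which pads
  words of odd length. \<open>fin\<close> tells whether the state at the end of a pass is compatible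
  with acceptance, and \<open>triv\<close> settles words of one letter, which no further pass could
  shorten.\<close>

locale halving =
  fixes \<Sigma> :: "'i set" and Q :: "'q set" and q0 :: 'q and K :: "nat set"
    and \<tau> :: "'q \<Rightarrow> 'i tape_symbol \<Rightarrow> 'i tape_symbol \<Rightarrow> nat \<times> 'q"
    and fin :: "'q \<Rightarrow> bool" and triv :: "nat \<Rightarrow> bool"
  assumes fin_\<Sigma>: "finite \<Sigma>" and fin_Q: "finite Q" and fin_K: "finite K" and q0: "q0 \<in> Q"
    and \<tau>_closed: "\<lbrakk>q \<in> Q; s \<in> Input ` \<Sigma> \<union> Work ` K; s' \<in> insert Blank (Input ` \<Sigma> \<union> Work ` K)\<rbrakk>
          \<Longrightarrow> \<tau> q s s' \<in> K \<times> Q"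
begin

definition syms :: "'i tape_symbol set" where "syms = Input ` \<Sigma> \<union> Work ` K"

text \<open>The counter distinguishes no output so far (0), a single trivial letter (1),
  a single nontrivial letter (2) and several letters (3).\<close>

definition bump :: "nat \<Rightarrow> nat \<Rightarrow> nat"
  where "bump c k = (if c = 0 then if triv k then 1 else 2 else 3)"

text \<open>Each tape is erased as it is read, so every pass starts with a single word between
  blanks. \<open>Back\<close> reads tape 1 and writes tape 0 both from right to left, hence
  preserves the order of the letters; it overshoots by one cell, which the final
  \<open>Move_Right\<close> corrects.\<close>

fun trans :: "('q, 'i) phase \<Rightarrow> 'i tape_symbol \<Rightarrow> 'i tape_symbol \<Rightarrow>
    ('q, 'i) phase \<times> ('i tape_symbol \<times> head_move) \<times> ('i tape_symbol \<times> head_move)"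
  where
    "trans (Halt b) s t = (Halt b, (s, Move_Stay), (t, Move_Stay))"
  | "trans (Scan q c) s t =
      (if s \<noteq> Blank then (Pair q c s, (Blank, Move_Right), (t, Move_Stay))
       else if fin q \<and> c = 3 then (Back, (Blank, Move_Stay), (t, Move_Left))
       else (Halt (fin q \<and> c < 2), (s, Move_Stay), (t, Move_Stay)))"
  | "trans (Pair q c s') s t = (case \<tau> q s' s of (k, q') \<Rightarrow>
      (Scan q' (bump c k), (Blank, if s = Blank then Move_Stay else Move_Right),
       (Work k, Move_Right)))"
  | "trans Back s t =
      (if t = Blank then (Scan q0 0, (s, Move_Right), (t, Move_Stay))
       else (Back, (t, Move_Left), (Blank, Move_Left)))"

definition phases :: "('q, 'i) phase set"
  where "phases = range Halt \<union> (\<lambda>(q, c). Scan q c) ` (Q \<times> {..3}) \<union>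
    (\<lambda>(q, c, s). Pair q c s) ` (Q \<times> {..3} \<times> syms) \<union> {Back}"

definition enc :: "('q, 'i) phase \<Rightarrow> nat" where "enc = to_nat_on phases"

definition dec :: "nat \<Rightarrow> ('q, 'i) phase" where "dec = from_nat_into phases"

definition machine :: "'i turing_machine"
  where "machine = \<lparr>tm_tapes = 2, tm_states = enc ` phases, tm_alphabet = insert Blank syms,
    tm_start = enc (Scan q0 0), tm_accept = enc (Halt True), tm_reject = enc (Halt False),
    tm_delta = (\<lambda>q ss. case trans (dec q) (ss ! 0) (ss ! 1) of (p, a, b) \<Rightarrow> (enc p, [a, b]))\<rparr>"

lemma phases_simps [simp]:
  "Halt b \<in> phases" "Back \<in> phases"
  "Scan q c \<in> phases \<longleftrightarrow> q \<in> Q \<and> c \<le> 3"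
  "Pair q c s \<in> phases \<longleftrightarrow> q \<in> Q \<and> c \<le> 3 \<and> s \<in> syms"
  by (auto simp: phases_def image_iff)

lemma finite_syms: "finite syms"
  using fin_\<Sigma> fin_K by (simp add: syms_def)

lemma finite_phases: "finite phases"
  using fin_Q finite_syms by (simp add: phases_def)

lemma enc_eq_iff: "p \<in> phases \<Longrightarrow> p' \<in> phases \<Longrightarrow> enc p = enc p' \<longleftrightarrow> p = p'"
  by (simp add: enc_def finite_phases countable_finite)

lemma dec_enc: "p \<in> phases \<Longrightarrow> dec (enc p) = p"
  by (simp add: enc_def dec_def finite_phases countable_finite)

lemma Blank_notin_syms: "Blank \<notin> syms"
  by (auto simp: syms_def)

lemma bump_le: "bump c k \<le> 3"
  by (auto simp: bump_def)

lemma \<tau>_closed':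
  "q \<in> Q \<Longrightarrow> s \<in> syms \<Longrightarrow> s' \<in> insert Blank syms \<Longrightarrow> \<tau> q s s' = (k, q') \<Longrightarrow> k \<in> K \<and> q' \<in> Q"
  using \<tau>_closed[of q s s'] by (auto simp: syms_def)

lemma trans_closed:
  assumes "p \<in> phases" "s \<in> insert Blank syms" "t \<in> insert Blank syms" "trans p s t = (p', a, b)"
  shows "p' \<in> phases \<and> a \<in> insert Blank syms \<times> UNIV \<and> b \<in> insert Blank syms \<times> UNIV"
proof (cases p)
  case (Pair q c s')
  obtain k q' where k: "\<tau> q s' s = (k, q')" by fastforce
  with \<tau>_closed'[of q s' s k q'] Pair assms have "k \<in> K" "q' \<in> Q" by auto
  with Pair k assms show ?thesis by (auto simp: bump_le syms_def)
qed (use assms q0 in \<open>auto split: if_splits simp: syms_def\<close>)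

lemma machine_is_tm: "is_turing_machine \<Sigma> machine"
proof -
  have "case tm_delta machine q ss of (q', acts) \<Rightarrow>
      q' \<in> enc ` phases \<and> length acts = 2 \<and> acts \<in> lists (insert Blank syms \<times> UNIV)"
    if "q \<in> enc ` phases" "ss \<in> lists (insert Blank syms)" "length ss = 2" for q ss
  proof -
    obtain p where p: "p \<in> phases" "q = enc p" using \<open>q \<in> enc ` phases\<close> by auto
    obtain p' a b where t: "trans p (ss ! 0) (ss ! 1) = (p', a, b)" by (metis prod_cases3)
    have "ss ! 0 \<in> insert Blank syms" "ss ! 1 \<in> insert Blank syms"
      using that by (auto simp: in_lists_conv_set)
    from trans_closed[OF p(1) this t] show ?thesis
      using t p by (auto simp: machine_def dec_enc)
  qed
  then show ?thesis
    using finite_phases finite_syms q0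
    by (auto simp: is_turing_machine_def machine_def syms_def enc_eq_iff)
qed

lemma step_machine:
  assumes "p \<in> phases" "\<forall>b. p \<noteq> Halt b"
  shows "tm_step machine (enc p, [(h, t), (g, u)]) =
    (case trans p (t h) (u g) of (p', a, b) \<Rightarrow> (enc p', [tape_act a (h, t), tape_act b (g, u)]))"
  using assms by (simp add: tm_step_def halted_def machine_def dec_enc enc_eq_iff split: prod.splits)

section \<open>Runs of the machine on a whole word\<close>

lemma step_Scan:
  assumes "q \<in> Q" "c \<le> 3"
  shows "t h \<noteq> Blank \<Longrightarrow> tm_step machine (enc (Scan q c), [(h, t), (g, u)]) =
      (enc (Pair q c (t h)), [(h + 1, t(h := Blank)), (g, u)])"
    and "t h = Blank \<Longrightarrow> fin q \<and> c = 3 \<Longrightarrow> tm_step machine (enc (Scan q c), [(h, t), (g, u)]) =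
      (enc Back, [(h, t), (g - 1, u)])"
    and "t h = Blank \<Longrightarrow> \<not> (fin q \<and> c = 3) \<Longrightarrow> tm_step machine (enc (Scan q c), [(h, t), (g, u)]) =
      (enc (Halt (fin q \<and> c < 2)), [(h, t), (g, u)])"
  using assms by (auto simp: step_machine)

lemma step_Pair:
  assumes "q \<in> Q" "c \<le> 3" "s \<in> syms" "\<tau> q s (t h) = (k, q')"
  shows "tm_step machine (enc (Pair q c s), [(h, t), (g, u)]) =
      (enc (Scan q' (bump c k)), [(if t h = Blank then h else h + 1, t(h := Blank)), (g + 1, u(g := Work k))])"
  using assms by (simp add: step_machine)

lemma step_Back:
  "u g = Blank \<Longrightarrow> tm_step machine (enc Back, [(h, t), (g, u)]) = (enc (Scan q0 0), [(h + 1, t), (g, u)])"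
  "u g \<noteq> Blank \<Longrightarrow> tm_step machine (enc Back, [(h, t), (g, u)]) =
     (enc Back, [(h - 1, t(h := u g)), (g - 1, u(g := Blank))])"
  by (auto simp: step_machine)

text \<open>The effect of one left-to-right pass on words alone, detached from tapes and heads; the
  later reasoning about groups and matrices concerns only this function.\<close>

fun pass :: "'q \<Rightarrow> 'i tape_symbol list \<Rightarrow> nat list \<times> 'q"
  where
    "pass q [] = ([], q)"
  | "pass q [s] = (case \<tau> q s Blank of (k, q') \<Rightarrow> ([k], q'))"
  | "pass q (s # s' # w) = (case \<tau> q s s' of (k, q') \<Rightarrow> case pass q' w of (ks, r) \<Rightarrow> (k # ks, r))"

lemma pass_closed:
  "q \<in> Q \<Longrightarrow> w \<in> lists syms \<Longrightarrow> pass q w = (ks, r) \<Longrightarrow>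
    ks \<in> lists K \<and> r \<in> Q \<and> length ks = (length w + 1) div 2"
proof (induction q w arbitrary: ks rule: pass.induct)
  case (2 q s)
  obtain k q' where "\<tau> q s Blank = (k, q')" by fastforce
  with \<tau>_closed'[OF _ _ _ this] 2 show ?case by auto
next
  case (3 q s s' w)
  obtain k q' where k: "\<tau> q s s' = (k, q')" by fastforce
  obtain ls r' where ls: "pass q' w = (ls, r')" by fastforce
  have kq: "k \<in> K" "q' \<in> Q" using \<tau>_closed'[OF _ _ _ k] 3 by auto
  from 3(1)[OF k[symmetric] kq(2)] 3(3,4) ls k kq show ?case by auto
qed auto

text \<open>Two steps per output letter; a final unpaired letter also costs two, because a blank is
  then read as its partner. The output \<open>out\<close> already on tape 1 and the counter
  \<open>c\<close> are arbitrary so that the induction can pass over one pair.\<close>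

lemma scan_phase:
  assumes "q \<in> Q" "c \<le> 3" "w \<in> lists syms" "pass q w = (ks, r)"
  shows "\<exists>h'. (tm_step machine ^^ (2 * length ks))
      (enc (Scan q c), [(h, fill h w), (g, fill (g - int (length out)) out)]) =
      (enc (Scan r (foldl bump c ks)), [(h', \<lambda>_. Blank),
        (g + int (length ks), fill (g - int (length out)) (out @ map Work ks))])"
  using assms
proof (induction q w arbitrary: ks c h g out rule: pass.induct)
  case (2 q s)
  obtain k q' where k: "\<tau> q s Blank = (k, q')" by fastforce
  have "s \<noteq> Blank" using 2 Blank_notin_syms by auto
  with 2 k show ?case
    by (auto simp: step_Scan step_Pair eval_nat_numeral fill_erase_head fill_write_end)
next
  case (3 q s s' w)
  obtain k q' where k: "\<tau> q s s' = (k, q')" by fastforce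
  obtain ls r' where ls: "pass q' w = (ls, r')" by fastforce
  have kq: "k \<in> K" "q' \<in> Q" using \<tau>_closed'[OF _ _ _ k] 3 by auto
  have nb: "s \<noteq> Blank" "s' \<noteq> Blank" using 3 Blank_notin_syms by auto
  have ks: "ks = k # ls" "r' = r" using 3(5) k ls by auto
  have ls': "pass q' w = (ls, r)" using ls ks by simp
  let ?c0 = "(enc (Scan q c), [(h, fill h (s # s' # w)), (g, fill (g - int (length out)) out)])"
  let ?c2 = "(enc (Scan q' (bump c k)), [(h + 1 + 1, fill (h + 1 + 1) w),
    (g + 1, fill ((g + 1) - int (length (out @ [Work k]))) (out @ [Work k]))])"
  have "tm_step machine (tm_step machine ?c0) = ?c2"
    using 3(2-4) nb k
    by (simp add: step_Scan step_Pair fill_erase_head fill_write_end)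
  moreover from 3(1)[OF k[symmetric] kq(2) bump_le _ ls', of c k "h + 1 + 1" "g + 1" "out @ [Work k]"] 3(4)
  obtain h' where "(tm_step machine ^^ (2 * length ls)) ?c2 =
      (enc (Scan r (foldl bump (bump c k) ls)), [(h', \<lambda>_. Blank),
        (g + 1 + int (length ls), fill ((g + 1) - int (length (out @ [Work k]))) ((out @ [Work k]) @ map Work ls))])"
    by auto
  ultimately show ?case
    by (simp add: ks funpow_swap1 algebra_simps)
qed auto

text \<open>Letters leave tape 1 from its right end, hence the induction from the right, with
  \<open>w\<close> the part already on tape 0. The extra step is the one that finds the blank left
  of the output.\<close>

lemma back_phase:
  assumes "out \<in> lists syms"
  shows "\<exists>h' g'. (tm_step machine ^^ (length out + 1))
      (enc Back, [(h, fill (h + 1) w), (g, fill (g + 1 - int (length out)) out)]) =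
      (enc (Scan q0 0), [(h', fill h' (out @ w)), (g', \<lambda>_. Blank)])"
  using assms
proof (induction out arbitrary: h g w rule: rev_induct)
  case Nil
  then show ?case by (auto simp: step_Back)
next
  case (snoc s out)
  have nb: "s \<noteq> Blank" using snoc Blank_notin_syms by auto
  let ?c0 = "(enc Back, [(h, fill (h + 1) w), (g, fill (g + 1 - int (length (out @ [s]))) (out @ [s]))])"
  let ?c1 = "(enc Back, [(h - 1, fill (h - 1 + 1) (s # w)), (g - 1, fill (g - 1 + 1 - int (length out)) out)])"
  have rd: "fill (g + 1 - int (length (out @ [s]))) (out @ [s]) g = s"
    by (rule fill_read_end) simp
  have er: "(fill (g + 1 - int (length (out @ [s]))) (out @ [s]))(g := Blank) = fill (g - 1 + 1 - int (length out)) out"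
    by (subst fill_erase_end) (auto simp: algebra_simps)
  have "tm_step machine ?c0 = ?c1"
    by (subst step_Back(2)) (simp_all only: rd er nb fill_write_head not_False_eq_True, simp)
  moreover obtain h' g' where "(tm_step machine ^^ (length out + 1)) ?c1 =
      (enc (Scan q0 0), [(h', fill h' (out @ s # w)), (g', \<lambda>_. Blank)])"
    using snoc by (metis (no_types, lifting) append_in_lists_conv)
  ultimately show ?case
    by (auto simp: funpow_swap1)
qed

lemma foldl_bump: "foldl bump 0 ks = (case ks of [] \<Rightarrow> 0 | [k] \<Rightarrow> if triv k then 1 else 2 | _ \<Rightarrow> 3)"
proof -
  have pos: "c > 0 \<Longrightarrow> foldl bump c ls > 0" for c ls
    by (induction ls arbitrary: c) (auto simp: bump_def)
  have "foldl bump c ls = 3" if "c > 0" "ls \<noteq> []" for c ls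
    using that pos[of c "butlast ls"] by (cases ls rule: rev_cases) (auto simp: bump_def)
  from this[of "bump 0 (hd ks)" "tl ks"] show ?thesis
    by (auto split: list.splits simp: bump_def)
qed

text \<open>A pass over \<open>n\<close> letters with \<open>m\<close> output letters takes
  \<open>2 m\<close> steps to scan, one to turn round and \<open>m + 1\<close> to return. With
  \<open>8 m + 1\<close> for the remaining passes the total is \<open>11 m + 3\<close>; for
  \<open>m = (n + 1) div 2\<close> this is at most \<open>8 n + 1\<close> once \<open>n\<close> is
  at least 3, that is, once \<open>m\<close> is at least 2. Equality at \<open>n = 3\<close>
  explains the factor 8.\<close>

lemma machine_run:
  assumes "w \<in> D" and D: "D \<subseteq> lists syms"
    and P: "\<And>w ks r. w \<in> D \<Longrightarrow> pass q0 w = (ks, r) \<Longrightarrow>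
      P w \<longleftrightarrow> fin r \<and> (case ks of [] \<Rightarrow> True | [k] \<Rightarrow> triv k | _ \<Rightarrow> P (map Work ks))"
    and D': "\<And>w ks r. w \<in> D \<Longrightarrow> pass q0 w = (ks, r) \<Longrightarrow> fin r \<Longrightarrow> 2 \<le> length ks \<Longrightarrow> map Work ks \<in> D"
  shows "\<exists>n ts. n \<le> 8 * length w + 1 \<and>
    (tm_step machine ^^ n) (enc (Scan q0 0), [(h, fill h w), (g, \<lambda>_. Blank)]) = (enc (Halt (P w)), ts)"
  using assms(1)
proof (induction "length w" arbitrary: w h g rule: less_induct)
  case less
  have w: "w \<in> lists syms" using less D by auto
  obtain ks r where ks: "pass q0 w = (ks, r)" by fastforce
  from pass_closed[OF q0 w ks] have ksK: "ks \<in> lists K" "r \<in> Q" "length ks = (length w + 1) div 2" by auto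
  let ?c0 = "(enc (Scan q0 0), [(h, fill h w), (g, \<lambda>_. Blank)])"
  from scan_phase[OF q0 _ w ks, of 0 h g "[]"] obtain h' where s1:
    "(tm_step machine ^^ (2 * length ks)) ?c0 = (enc (Scan r (foldl bump 0 ks)), [(h', \<lambda>_. Blank),
        (g + int (length ks), fill g (map Work ks))])"
    by auto
  show ?case
  proof (cases "fin r \<and> 2 \<le> length ks")
    case False
    then have "\<not> (fin r \<and> foldl bump 0 ks = 3)"
      "P w \<longleftrightarrow> fin r \<and> foldl bump 0 ks < 2" "foldl bump 0 ks \<le> 3"
      using P[OF less(2) ks] by (auto simp: foldl_bump split: list.splits)
    then have "tm_step machine ((tm_step machine ^^ (2 * length ks)) ?c0) =
      (enc (Halt (P w)), [(h', \<lambda>_. Blank), (g + int (length ks), fill g (map Work ks))])"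
      unfolding s1 by (subst step_Scan(3)) (simp_all add: ksK)
    moreover have "Suc (2 * length ks) \<le> 8 * length w + 1" using ksK by auto
    ultimately show ?thesis
      by (intro exI[of _ "Suc (2 * length ks)"] exI conjI) (simp_all only: funpow.simps o_apply)
  next
    case True
    then have c3: "foldl bump 0 ks = 3" by (auto simp: foldl_bump split: list.splits)
    have Pw: "P w = P (map Work ks)" using P[OF less(2) ks] True by (auto split: list.splits)
    have s2: "tm_step machine ((tm_step machine ^^ (2 * length ks)) ?c0) =
      (enc Back, [(h', fill (h' + 1) []), (g + int (length ks) - 1,
        fill (g + int (length ks) - 1 + 1 - int (length (map Work ks :: 'i tape_symbol list))) (map Work ks))])"
      unfolding s1 c3 by (subst step_Scan(2)) (simp_all add: ksK True)
    have "map Work ks \<in> lists syms" using ksK by (auto simp: syms_def)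
    from back_phase[OF this, of h' "[]" "g + int (length ks) - 1"] obtain h'' g'' where s3:
      "(tm_step machine ^^ (length ks + 1)) (tm_step machine ((tm_step machine ^^ (2 * length ks)) ?c0)) =
      (enc (Scan q0 0), [(h'', fill h'' (map Work ks)), (g'', \<lambda>_. Blank)])"
      unfolding s2 by auto
    have lt: "length (map Work ks :: 'i tape_symbol list) < length w" using True ksK by auto
    from less(1)[OF lt, of h'' g''] D'[OF less(2) ks] True obtain n ts where n:
      "n \<le> 8 * length ks + 1"
      "(tm_step machine ^^ n) (enc (Scan q0 0), [(h'', fill h'' (map Work ks)), (g'', \<lambda>_. Blank)])
        = (enc (Halt (P w)), ts)" unfolding Pw by auto
    have "(tm_step machine ^^ (n + (length ks + 1) + Suc (2 * length ks))) ?c0 =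
      (tm_step machine ^^ n) ((tm_step machine ^^ (length ks + 1))
        (tm_step machine ((tm_step machine ^^ (2 * length ks)) ?c0)))"
      by (simp only: funpow_add funpow.simps o_apply)
    also have "\<dots> = (enc (Halt (P w)), ts)"
      by (simp only: s3 n(2))
    finally have "(tm_step machine ^^ (n + (length ks + 1) + Suc (2 * length ks))) ?c0 = (enc (Halt (P w)), ts)" .
    moreover have "n + (length ks + 1) + Suc (2 * length ks) \<le> 8 * length w + 1"
      using n(1) ksK True by auto
    ultimately show ?thesis by blast
  qed
qed

lemma halted_stays: "halted M c \<Longrightarrow> (tm_step M ^^ n) c = c"
  by (induction n) (auto simp: tm_step_def)

lemma machine_decides:
  assumes D: "D \<subseteq> lists syms" and in_D: "\<And>v::'i list. v \<in> lists \<Sigma> \<Longrightarrow> map Input v \<in> D"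
    and P: "\<And>w ks r. w \<in> D \<Longrightarrow> pass q0 w = (ks, r) \<Longrightarrow>
      P w \<longleftrightarrow> fin r \<and> (case ks of [] \<Rightarrow> True | [k] \<Rightarrow> triv k | _ \<Rightarrow> P (map Work ks))"
    and D': "\<And>w ks r. w \<in> D \<Longrightarrow> pass q0 w = (ks, r) \<Longrightarrow> fin r \<Longrightarrow> 2 \<le> length ks \<Longrightarrow> map Work ks \<in> D"
  shows "tm_decides \<Sigma> machine {v \<in> lists \<Sigma>. P (map Input v)}"
    and "v \<in> lists \<Sigma> \<Longrightarrow> running_time machine v \<le> 8 * length v + 1"
proof -
  have run: "\<exists>n ts. n \<le> 8 * length v + 1 \<and> tm_run machine v n = (enc (Halt (P (map Input v))), ts)"
    if "v \<in> lists \<Sigma>" for v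
  proof -
    have "initial_config machine v = (enc (Scan q0 0), [(0, fill 0 (map Input v)), (0, \<lambda>_. Blank)])"
      by (auto simp: initial_config_def machine_def blank_tape_def input_tape_def fill_def fun_eq_iff)
    then show ?thesis
      using machine_run[where h = 0 and g = 0, OF in_D[OF that] D P D'] unfolding tm_run_def by simp
  qed
  have halt: "halted machine (enc (Halt b), ts)" for b ts
    by (cases b) (auto simp: halted_def machine_def)
  show "running_time machine v \<le> 8 * length v + 1" if v: "v \<in> lists \<Sigma>"
  proof -
    obtain n ts where "n \<le> 8 * length v + 1" "tm_run machine v n = (enc (Halt (P (map Input v))), ts)"
      using run[OF v] by blast
    then show ?thesis
      unfolding running_time_def using halt[of "P (map Input v)" ts]
      by (intro order_trans[OF Least_le[of _ n]]) simp_all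
  qed
  have "tm_halts machine v \<and> (tm_accepts machine v \<longleftrightarrow> P (map Input v))" if v: "v \<in> lists \<Sigma>" for v
  proof -
    obtain n ts where n: "tm_run machine v n = (enc (Halt (P (map Input v))), ts)"
      using run[OF v] by blast
    have "P (map Input v)" if m: "fst (tm_run machine v m) = tm_accept machine" for m
    proof -
      have hm: "halted machine (tm_run machine v m)" using m by (simp add: halted_def)
      have hn: "halted machine (tm_run machine v n)" using n halt by simp
      \<comment> \<open>Two halted configurations of one run coincide, since both persist until time
        \<open>n + m\<close>.\<close>
      have "tm_run machine v (n + m) = tm_run machine v m"
        using halted_stays[OF hm, of n] by (simp add: tm_run_def funpow_add)
      moreover have "tm_run machine v (m + n) = tm_run machine v n"
        using halted_stays[OF hn, of m] by (simp add: tm_run_def funpow_add)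
      ultimately have "tm_run machine v m = tm_run machine v n" by (simp add: add.commute)
      then have "enc (Halt (P (map Input v))) = enc (Halt True)"
        using m n by (simp add: machine_def)
      then show ?thesis by (simp add: enc_eq_iff)
    qed
    then show ?thesis
      using n halt[of "P (map Input v)" ts] unfolding tm_halts_def tm_accepts_def
      by (auto intro!: exI[of _ n] simp: machine_def)
  qed
  then show "tm_decides \<Sigma> machine {v \<in> lists \<Sigma>. P (map Input v)}"
    by (auto simp: tm_decides_def)
qed

end

section \<open>Contraction on integer unitriangular matrices\<close>

text \<open>Matrices are total functions on pairs of indices; fixing the entries outside the strict
  lower triangle of size \<open>r\<close> to those of the identity makes equality of matrices
  equality of functions.\<close>

definition UT :: "nat \<Rightarrow> (nat \<Rightarrow> nat \<Rightarrow> int) set"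
  where "UT r = {M. \<forall>i j. \<not> (j < i \<and> i < r) \<longrightarrow> M i j = (if i = j then 1 else 0)}"

definition ut_one :: "nat \<Rightarrow> nat \<Rightarrow> int"
  where "ut_one i j = (if i = j then 1 else 0)"

text \<open>The range \<open>{j..i}\<close> contains all nonzero terms of the usual product of lower
  triangular matrices, and it makes associativity and compatibility with \<open>dilate\<close> hold
  for arbitrary functions.\<close>

definition ut_mul :: "(nat \<Rightarrow> nat \<Rightarrow> int) \<Rightarrow> (nat \<Rightarrow> nat \<Rightarrow> int) \<Rightarrow> nat \<Rightarrow> nat \<Rightarrow> int"
  where "ut_mul M N i j = (\<Sum>k\<in>{j..i}. M i k * N k j)"

definition ut_prod :: "(nat \<Rightarrow> nat \<Rightarrow> int) list \<Rightarrow> nat \<Rightarrow> nat \<Rightarrow> int"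
  where "ut_prod Ms = foldr ut_mul Ms ut_one"

text \<open>On lower triangular matrices this is conjugation by the diagonal matrix with entries
  \<open>3 ^ i\<close>, which is why it is multiplicative.\<close>

definition dilate :: "(nat \<Rightarrow> nat \<Rightarrow> int) \<Rightarrow> nat \<Rightarrow> nat \<Rightarrow> int"
  where "dilate M i j = 3 ^ (i - j) * M i j"

text \<open>The matrix analogue of digits in a positional system: each entry is a possible remainder
  modulo the factor that \<open>dilate\<close> puts in the same position.\<close>

definition digits :: "nat \<Rightarrow> (nat \<Rightarrow> nat \<Rightarrow> int) set"
  where "digits r = {d \<in> UT r. \<forall>i j. j < i \<longrightarrow> 0 \<le> d i j \<and> d i j < 3 ^ (i - j)}"

lemma UT_simps:
  assumes "M \<in> UT r"
  shows "M i i = 1" "i < j \<Longrightarrow> M i j = 0" "r \<le> i \<Longrightarrow> i \<noteq> j \<Longrightarrow> M i j = 0"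
  using assms by (auto simp: UT_def)

lemma ut_one_in_UT [simp]: "ut_one \<in> UT r"
  by (auto simp: UT_def ut_one_def)

lemma ut_mul_diag: "M \<in> UT r \<Longrightarrow> N \<in> UT r \<Longrightarrow> ut_mul M N i i = 1"
  by (simp add: ut_mul_def UT_simps)

lemma ut_mul_split:
  assumes "M \<in> UT r" "N \<in> UT r" "j < i"
  shows "ut_mul M N i j = N i j + (\<Sum>k\<in>{j<..<i}. M i k * N k j) + M i j"
proof -
  have "{j..i} = insert i (insert j {j<..<i})" using assms by auto
  then show ?thesis using assms by (simp add: ut_mul_def UT_simps)
qed

lemma ut_mul_in_UT: assumes "M \<in> UT r" "N \<in> UT r" shows "ut_mul M N \<in> UT r"
proof -
  have "ut_mul M N i j = (if i = j then 1 else 0)" if "\<not> (j < i \<and> i < r)" for i j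
  proof (cases "j < i")
    case True
    with that have "r \<le> i" by auto
    with True show ?thesis by (simp add: ut_mul_split[OF assms True] UT_simps[OF assms(1)] UT_simps[OF assms(2)])
  next
    case False
    then show ?thesis using ut_mul_diag[OF assms] by (cases "i = j") (auto simp: ut_mul_def)
  qed
  then show ?thesis by (auto simp: UT_def)
qed

section \<open>Monoid laws and the dilation endomorphism\<close>

lemma ut_mul_one_left: "M \<in> UT r \<Longrightarrow> ut_mul ut_one M = M"
proof (intro ext)
  fix i j assume M: "M \<in> UT r"
  have "ut_mul ut_one M i j = (\<Sum>k\<in>{j..i}. if i = k then M k j else 0)"
    unfolding ut_mul_def ut_one_def by (intro sum.cong) auto
  then show "ut_mul ut_one M i j = M i j"
    using UT_simps[OF M] by auto
qed

lemma ut_mul_one_right: "M \<in> UT r \<Longrightarrow> ut_mul M ut_one = M"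
proof (intro ext)
  fix i j assume M: "M \<in> UT r"
  have "ut_mul M ut_one i j = (\<Sum>k\<in>{j..i}. if k = j then M i k else 0)"
    unfolding ut_mul_def ut_one_def by (intro sum.cong) auto
  then show "ut_mul M ut_one i j = M i j"
    using UT_simps[OF M] by auto
qed

lemma ut_mul_assoc: "ut_mul (ut_mul L M) N = ut_mul L (ut_mul M N)"
proof (intro ext)
  fix i j
  have "ut_mul (ut_mul L M) N i j = (\<Sum>k\<in>{j..i}. \<Sum>l\<in>{k..i}. L i l * M l k * N k j)"
    by (simp add: ut_mul_def sum_distrib_right)
  also have "\<dots> = (\<Sum>(k, l)\<in>(SIGMA k:{j..i}. {k..i}). L i l * M l k * N k j)"
    by (simp add: sum.Sigma)
  also have "\<dots> = (\<Sum>(l, k)\<in>(SIGMA l:{j..i}. {j..l}). L i l * M l k * N k j)"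
    by (rule sum.reindex_bij_witness[of _ "\<lambda>(l, k). (k, l)" "\<lambda>(k, l). (l, k)"]) auto
  also have "\<dots> = (\<Sum>l\<in>{j..i}. \<Sum>k\<in>{j..l}. L i l * M l k * N k j)"
    by (simp add: sum.Sigma)
  also have "\<dots> = ut_mul L (ut_mul M N) i j"
    by (simp add: ut_mul_def sum_distrib_left mult.assoc)
  finally show "ut_mul (ut_mul L M) N i j = ut_mul L (ut_mul M N) i j" .
qed

lemma ut_prod_simps [simp]: "ut_prod [] = ut_one" "ut_prod (M # Ms) = ut_mul M (ut_prod Ms)"
  by (simp_all add: ut_prod_def)

lemma ut_prod_in_UT: "set Ms \<subseteq> UT r \<Longrightarrow> ut_prod Ms \<in> UT r"
  by (induction Ms) (auto simp: ut_mul_in_UT)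

lemma dilate_ut_mul: "dilate (ut_mul M N) = ut_mul (dilate M) (dilate N)"
proof (intro ext)
  fix i j
  have "3 ^ (i - j) * (M i k * N k j) = (3 ^ (i - k) * M i k) * (3 ^ (k - j) * N k j :: int)"
    if "k \<in> {j..i}" for k
  proof -
    have "i - j = (i - k) + (k - j)" using that by auto
    then show ?thesis by (simp add: power_add)
  qed
  then show "dilate (ut_mul M N) i j = ut_mul (dilate M) (dilate N) i j"
    unfolding dilate_def ut_mul_def sum_distrib_left by (intro sum.cong) auto
qed

lemma dilate_ut_one: "dilate ut_one = ut_one"
  by (auto simp: fun_eq_iff dilate_def ut_one_def)

lemma dilate_in_UT: "M \<in> UT r \<Longrightarrow> dilate M \<in> UT r"
  by (auto simp: UT_def dilate_def)

lemma digits_subset: "digits r \<subseteq> UT r"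
  by (auto simp: digits_def)

lemma ut_one_in_digits: "ut_one \<in> digits r"
  by (auto simp: digits_def ut_one_def)

lemma finite_bounded_UT: "finite {M \<in> UT r. \<forall>i j. j < i \<longrightarrow> \<bar>M i j\<bar> \<le> f (i - j)}" (is "finite ?A")
proof -
  let ?I = "{(i, j). j < i \<and> i < r}"
  let ?g = "\<lambda>h i j. if j < i \<and> i < r then h (i, j) else ut_one i j"
  have "finite ?I" by (rule finite_subset[of _ "{..<r} \<times> {..<r}"]) auto
  then have "finite (?g ` (PiE ?I (\<lambda>(i, j). {- f (i - j)..f (i - j)})))"
    by (intro finite_imageI finite_PiE) auto
  moreover have "M \<in> ?g ` (PiE ?I (\<lambda>(i, j). {- f (i - j)..f (i - j)}))" if M: "M \<in> ?A" for M
  proof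
    show "M = ?g (restrict (\<lambda>(i, j). M i j) ?I)"
    proof (intro ext)
      fix i j
      have "\<not> (j < i \<and> i < r) \<Longrightarrow> M i j = ut_one i j" using M by (simp add: UT_def ut_one_def)
      then show "M i j = ?g (restrict (\<lambda>(i, j). M i j) ?I) i j" by simp
    qed
    show "restrict (\<lambda>(i, j). M i j) ?I \<in> PiE ?I (\<lambda>(i, j). {- f (i - j)..f (i - j)})"
    proof (rule PiE_I)
      fix x assume x: "x \<in> ?I"
      obtain i j where [simp]: "x = (i, j)" by fastforce
      have "j < i" using x by simp
      then have "\<bar>M i j\<bar> \<le> f (i - j)" using M by simp
      then show "restrict (\<lambda>(i, j). M i j) ?I x \<in> (case x of (i, j) \<Rightarrow> {- f (i - j)..f (i - j)})"
        using x by (simp add: abs_le_iff)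
    qed (simp add: restrict_def)
  qed
  ultimately show ?thesis by (meson finite_subset subsetI)
qed

lemma abs_sum_le: "(\<And>k. k \<in> A \<Longrightarrow> \<bar>f k\<bar> \<le> (c::int)) \<Longrightarrow> \<bar>sum f A\<bar> \<le> int (card A) * c"
  by (rule order_trans[OF sum_abs]) (use sum_bounded_above[of A "\<lambda>k. \<bar>f k\<bar>" c] in auto)

section \<open>Division with remainder by the dilation\<close>

text \<open>The entry \<open>rest M i j\<close> is what remains of \<open>M i j\<close> after subtracting the contributions of
  the entries closer to the diagonal; its quotient and remainder by \<open>3 ^ (i - j)\<close> are the entries
  of \<open>Q\<close> and \<open>d\<close> in \<open>M = dilate Q \<cdot> d\<close>.\<close>

function rest :: "(nat \<Rightarrow> nat \<Rightarrow> int) \<Rightarrow> nat \<Rightarrow> nat \<Rightarrow> int"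
  where "rest M i j = M i j - (\<Sum>k\<in>{j<..<i}.
    3 ^ (i - k) * (rest M i k div 3 ^ (i - k)) * (rest M k j mod 3 ^ (k - j)))"
  by auto
termination by (relation "measure (\<lambda>(M, i, j). i - j)") auto

declare rest.simps [simp del]

definition quot :: "nat \<Rightarrow> (nat \<Rightarrow> nat \<Rightarrow> int) \<Rightarrow> nat \<Rightarrow> nat \<Rightarrow> int"
  where "quot r M i j = (if j < i \<and> i < r then rest M i j div 3 ^ (i - j) else ut_one i j)"

definition digit :: "nat \<Rightarrow> (nat \<Rightarrow> nat \<Rightarrow> int) \<Rightarrow> nat \<Rightarrow> nat \<Rightarrow> int"
  where "digit r M i j = (if j < i \<and> i < r then rest M i j mod 3 ^ (i - j) else ut_one i j)"

lemma quot_in_UT: "quot r M \<in> UT r"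
  by (auto simp: UT_def quot_def ut_one_def)

lemma digit_in_digits: "digit r M \<in> digits r"
  by (auto simp: UT_def digits_def digit_def ut_one_def)

lemma rest_eq: "j < i \<Longrightarrow> i < r \<Longrightarrow>
    rest M i j = M i j - (\<Sum>k\<in>{j<..<i}. dilate (quot r M) i k * digit r M k j)"
  by (subst rest.simps) (auto simp: dilate_def quot_def digit_def intro!: sum.cong)

lemma quot_digit:
  assumes "M \<in> UT r" shows "ut_mul (dilate (quot r M)) (digit r M) = M"
proof (intro ext)
  fix i j
  note in_UT = dilate_in_UT[OF quot_in_UT] subsetD[OF digits_subset digit_in_digits]
  show "ut_mul (dilate (quot r M)) (digit r M) i j = M i j"
  proof (cases "j < i \<and> i < r")
    case True
    have "digit r M i j + dilate (quot r M) i j = rest M i j"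
      using True by (simp add: digit_def dilate_def quot_def)
    then show ?thesis
      using True by (simp add: ut_mul_split[OF in_UT] rest_eq[where r = r])
  next
    case False
    then show ?thesis
      using ut_mul_in_UT[OF in_UT, of r M M] assms by (auto simp: UT_def)
  qed
qed

text \<open>Induction on the distance from the diagonal: once the closer entries of \<open>Q\<close>
  vanish, the equation for the entry is \<open>d i j + 3 ^ (i - j) * Q i j = 0\<close>, and a
  remainder divisible by its modulus is 0. So the test for 1 splits into a test of the final state
  and a test of the shorter word.\<close>

lemma dilate_digit_eq_one:
  assumes Q: "Q \<in> UT r" and d: "d \<in> digits r" and eq: "ut_mul (dilate Q) d = ut_one"
  shows "Q = ut_one \<and> d = ut_one"
proof -
  have dU: "d \<in> UT r" using d digits_subset by auto
  have "Q i j = 0 \<and> d i j = 0" if "j < i" for i j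
    using that
  proof (induction "i - j" arbitrary: i j rule: less_induct)
    case less
    have "dilate Q i k * d k j = 0" if "k \<in> {j<..<i}" for k
    proof -
      have "i - k < i - j" "k < i" using that by auto
      then show ?thesis using less(1)[of i k] by (simp add: dilate_def)
    qed
    then have "(\<Sum>k\<in>{j<..<i}. dilate Q i k * d k j) = 0" by (intro sum.neutral) auto
    then have "d i j + 3 ^ (i - j) * Q i j = 0"
      using ut_mul_split[OF dilate_in_UT[OF Q] dU less(2)] eq less(2)
      by (simp add: ut_one_def dilate_def[of Q i j])
    then have "(d i j + 3 ^ (i - j) * Q i j) mod 3 ^ (i - j) = 0"
      by simp
    then have "d i j mod 3 ^ (i - j) = 0" by simp
    moreover have "d i j mod 3 ^ (i - j) = d i j"
      using d less(2) by (simp add: digits_def)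
    ultimately show ?case using \<open>d i j + 3 ^ (i - j) * Q i j = 0\<close> by simp
  qed
  then show ?thesis
    using UT_simps[OF Q] UT_simps[OF dU] by (auto simp: fun_eq_iff ut_one_def) (metis nat_neq_iff)+
qed


section \<open>A finite ball that is stable under contraction\<close>

text \<open>The bound on the \<open>a\<close>-th subdiagonal dominates every term of the contraction estimate that
  only involves subdiagonals closer to the main diagonal.\<close>

fun radius :: "int \<Rightarrow> nat \<Rightarrow> int"
  where
    "radius s 0 = 1"
  | "radius s (Suc a) = \<bar>s\<bar> + radius s a + int a * (radius s a)\<^sup>2 +
      int a * (3 ^ Suc a * (int (Suc a) * (radius s a)\<^sup>2)) +
      int a * (3 ^ Suc a * radius s a * 3 ^ Suc a) + 2 * 3 ^ Suc a"

declare radius.simps(2) [simp del]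

definition ut_ball :: "nat \<Rightarrow> int \<Rightarrow> (nat \<Rightarrow> nat \<Rightarrow> int) set"
  where "ut_ball r s = {M \<in> UT r. \<forall>i j. j < i \<longrightarrow> \<bar>M i j\<bar> \<le> radius s (i - j)}"

lemma radius_Suc_ge: "1 \<le> radius s a \<Longrightarrow> radius s a + \<bar>s\<bar> \<le> radius s (Suc a)"
proof -
  assume "1 \<le> radius s a"
  then have "0 \<le> int a * (radius s a)\<^sup>2"
    "0 \<le> int a * (3 ^ Suc a * (int (Suc a) * (radius s a)\<^sup>2))"
    "0 \<le> int a * (3 ^ Suc a * radius s a * 3 ^ Suc a)" "(0::int) \<le> 2 * 3 ^ Suc a"
    by simp_all
  then show ?thesis unfolding radius.simps by linarith
qed

lemma radius_pos: "1 \<le> radius s a"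
proof (induction a)
  case (Suc a)
  show ?case using radius_Suc_ge[OF Suc] Suc by linarith
qed simp

lemma radius_Suc: "radius s a \<le> radius s (Suc a)"
  using radius_Suc_ge[OF radius_pos, of s a] by linarith

lemma radius_mono: "a \<le> b \<Longrightarrow> radius s a \<le> radius s b"
  using radius_Suc lift_Suc_mono_le by blast

lemma radius_ge: "s \<le> radius s (Suc a)"
  using radius_Suc_ge[OF radius_pos, of s a] radius_pos[of s a] by linarith

lemma finite_ut_ball: "finite (ut_ball r s)"
  unfolding ut_ball_def by (rule finite_bounded_UT)

lemma ut_one_in_ut_ball: "ut_one \<in> ut_ball r s"
  using radius_pos[of s] by (auto simp: ut_ball_def ut_one_def intro: order_trans[of 0 1])

lemma finite_digits: "finite (digits r)"
  by (rule finite_subset[OF _ finite_bounded_UT[of r "\<lambda>a. 3 ^ a"]]) (force simp: digits_def)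

text \<open>Any common bound of the entries serves as \<open>s\<close>. This lets the ball contain
  the images of all letters that the first pass may emit.\<close>

lemma subset_ut_ball:
  assumes "finite S" "S \<subseteq> UT r" shows "\<exists>s. S \<subseteq> ut_ball r s"
proof
  define s where "s = (\<Sum>M\<in>S. \<Sum>(i, j)\<in>{..<r} \<times> {..<r}. \<bar>M i j\<bar>)"
  have "\<bar>M i j\<bar> \<le> radius s (i - j)" if "M \<in> S" "j < i" for M i j
  proof (cases "i < r")
    case True
    have "\<bar>M i j\<bar> \<le> (\<Sum>(i, j)\<in>{..<r} \<times> {..<r}. \<bar>M i j\<bar>)"
      using True \<open>j < i\<close> member_le_sum[of "(i, j)" "{..<r} \<times> {..<r}" "\<lambda>(i, j). \<bar>M i j\<bar>"] by auto
    also have "\<dots> \<le> s"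
      unfolding s_def using assms that
      by (intro member_le_sum[of M S "\<lambda>M. \<Sum>(i, j)\<in>{..<r} \<times> {..<r}. \<bar>M i j\<bar>"]) (auto intro!: sum_nonneg)
    also have "\<dots> \<le> radius s (i - j)"
      using radius_ge[of s "i - Suc j"] \<open>j < i\<close> by (simp only: Suc_diff_Suc)
    finally show ?thesis .
  next
    case False
    then show ?thesis using that assms(2) UT_simps(3)[of M r i j] radius_pos[of s "i - j"] by auto
  qed
  then show "S \<subseteq> ut_ball r s"
    using assms by (auto simp: ut_ball_def)
qed

lemma ut_ball_le: "M \<in> ut_ball r s \<Longrightarrow> i - j \<le> a \<Longrightarrow> \<bar>M i j\<bar> \<le> radius s a"
proof -
  assume M: "M \<in> ut_ball r s" and a: "i - j \<le> a"
  have "M \<in> UT r" using M by (simp add: ut_ball_def)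
  note UT_simps[OF this]
  moreover have "j < i \<Longrightarrow> \<bar>M i j\<bar> \<le> radius s a"
    using M radius_mono[OF a, of s] by (force simp: ut_ball_def intro: order_trans)
  moreover have "1 \<le> radius s a" by (rule radius_pos)
  ultimately show ?thesis by (cases i j rule: linorder_cases) auto
qed

lemma digits_le: "d \<in> digits r \<Longrightarrow> i - j \<le> a \<Longrightarrow> \<bar>d i j\<bar> \<le> 3 ^ a"
proof -
  assume d: "d \<in> digits r" and a: "i - j \<le> a"
  have "d \<in> UT r" using d by (simp add: digits_def)
  note UT_simps[OF this]
  moreover have "\<bar>d i j\<bar> \<le> 3 ^ a" if "j < i"
  proof -
    have "0 \<le> d i j" "d i j < 3 ^ (i - j)" using d that by (auto simp: digits_def)
    moreover have "(3::int) ^ (i - j) \<le> 3 ^ a" using a by (intro power_increasing) auto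
    ultimately show ?thesis by linarith
  qed
  ultimately show ?thesis by (cases i j rule: linorder_cases) auto
qed

text \<open>Induction on the distance from the diagonal. The entries of \<open>b\<close> and
  \<open>b'\<close> at the current distance contribute at most twice the radius; everything else
  comes from closer entries, digits and the remainder, and \<open>radius\<close> is defined so that
  this fits into a third copy. Dividing by at least 3 gives back one radius.\<close>

lemma quot_in_ut_ball:
  assumes d: "d \<in> digits r" and b: "b \<in> ut_ball r s" and b': "b' \<in> ut_ball r s"
  shows "quot r (ut_mul d (ut_mul b b')) \<in> ut_ball r s"
proof -
  define P where "P = ut_mul b b'"
  define M where "M = ut_mul d P"
  have U: "d \<in> UT r" "b \<in> UT r" "b' \<in> UT r" using assms digits_subset by (auto simp: ut_ball_def)
  then have PU: "P \<in> UT r" by (simp add: P_def ut_mul_in_UT)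
  have "\<bar>quot r M i j\<bar> \<le> radius s (i - j)" if "j < i" for i j
    using that
  proof (induction "i - j" arbitrary: i j rule: less_induct)
    case less
    show ?case
    proof (cases "i < r")
      case False
      then show ?thesis using radius_pos[of s "i - j"] less by (auto simp: quot_def ut_one_def)
    next
      case True
      obtain a where a: "i - j = Suc a" using \<open>j < i\<close> by (metis Suc_diff_Suc)
      define p where "p = radius s a"
      define t :: int where "t = 3 ^ Suc a"
      \<comment> \<open>Bounds for three sums over the indices strictly between \<open>j\<close> and
        \<open>i\<close>: \<open>A\<close> for the product of \<open>b\<close> and
        \<open>b'\<close>, \<open>B\<close> for the product of \<open>d\<close> with it,
        \<open>C\<close> for what \<open>rest\<close> subtracts. They are summands of
        \<open>radius s (Suc a)\<close>.\<close>
      define A where "A = int a * p\<^sup>2"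
      define B where "B = int a * (t * (int (Suc a) * p\<^sup>2))"
      define C where "C = int a * (t * p * t)"
      have radius_eq: "radius s (Suc a) = \<bar>s\<bar> + p + A + B + C + 2 * t"
        unfolding radius.simps A_def B_def C_def p_def t_def by (rule refl)
      have p: "p \<ge> 1" by (simp add: p_def radius_pos)
      have t: "t \<ge> 3" by (simp add: t_def)
      have A_nonneg: "0 \<le> A" "0 \<le> B" "0 \<le> C" using p t by (auto simp: A_def B_def C_def)
      have small: "k - j \<le> a" "i - k \<le> a" "k - j \<le> Suc a" "i - k \<le> Suc a" if "k \<in> {j<..<i}" for k
        using that a by auto
      have card: "int (card {j<..<i}) = int a" using a by simp
      have P_small: "\<bar>P k l\<bar> \<le> int (Suc a) * p\<^sup>2" if kl: "k - l \<le> a" for k l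
      proof -
        have "\<bar>b k m * b' m l\<bar> \<le> p\<^sup>2" if "m \<in> {l..k}" for m
          unfolding abs_mult power2_eq_square using that kl b b' p
          by (intro mult_mono ut_ball_le[where s = s and a = a, folded p_def]) auto
        then have "\<bar>P k l\<bar> \<le> int (card {l..k}) * p\<^sup>2"
          unfolding P_def ut_mul_def by (rule abs_sum_le)
        also have "\<dots> \<le> int (Suc a) * p\<^sup>2" using kl by (intro mult_right_mono) auto
        finally show ?thesis .
      qed
      have "\<bar>\<Sum>k\<in>{j<..<i}. b i k * b' k j\<bar> \<le> A"
        unfolding A_def card[symmetric] power2_eq_square using small b b' p
        by (intro abs_sum_le)
          (auto simp: abs_mult intro!: mult_mono ut_ball_le[where s = s and a = a, folded p_def])
      moreover have "\<bar>b i j\<bar> \<le> radius s (Suc a)" "\<bar>b' i j\<bar> \<le> radius s (Suc a)"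
        using b b' a by (auto intro: ut_ball_le)
      ultimately have P_ij: "\<bar>P i j\<bar> \<le> 2 * radius s (Suc a) + A"
        unfolding P_def ut_mul_split[OF U(2,3) less(2)] by linarith
      have "\<bar>\<Sum>k\<in>{j<..<i}. d i k * P k j\<bar> \<le> B"
      proof -
        have "\<bar>d i k * P k j\<bar> \<le> t * (int (Suc a) * p\<^sup>2)" if k: "k \<in> {j<..<i}" for k
          unfolding abs_mult t_def using small[OF k] by (intro mult_mono digits_le[OF d] P_small) auto
        then show ?thesis unfolding B_def card[symmetric] by (intro abs_sum_le)
      qed
      moreover have "\<bar>d i j\<bar> \<le> t" unfolding t_def using d a by (intro digits_le) auto
      ultimately have M_ij: "\<bar>M i j\<bar> \<le> \<bar>P i j\<bar> + B + t"
        unfolding M_def ut_mul_split[OF U(1) PU less(2)] by linarith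
      have "\<bar>dilate (quot r M) i k * digit r M k j\<bar> \<le> t * p * t" if k: "k \<in> {j<..<i}" for k
      proof -
        have "i - k < i - j" "k < i" using k by auto
        then have "\<bar>quot r M i k\<bar> \<le> p"
          using less(1)[of i k] small[OF k] radius_mono[of "i - k" a s] by (simp add: p_def)
        moreover have "(3::int) ^ (i - k) \<le> t"
          unfolding t_def using small[OF k] by (intro power_increasing) auto
        ultimately have "\<bar>dilate (quot r M) i k\<bar> \<le> t * p"
          unfolding dilate_def abs_mult using t by (intro mult_mono) auto
        moreover have "\<bar>digit r M k j\<bar> \<le> t"
          unfolding t_def using small[OF k] by (intro digits_le[OF digit_in_digits])
        ultimately show ?thesis
          unfolding abs_mult using t p by (intro mult_mono) auto
      qed
      then have "\<bar>\<Sum>k\<in>{j<..<i}. dilate (quot r M) i k * digit r M k j\<bar> \<le> C"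
        unfolding C_def card[symmetric] by (intro abs_sum_le)
      then have "\<bar>rest M i j\<bar> \<le> \<bar>M i j\<bar> + C"
        unfolding rest_eq[OF less(2) True] by linarith
      moreover have "t * \<bar>quot r M i j\<bar> \<le> \<bar>rest M i j\<bar> + t"
      proof -
        have "rest M i j = t * quot r M i j + rest M i j mod t"
          using less(2) True by (simp add: quot_def a t_def)
        moreover have "0 \<le> rest M i j mod t" "rest M i j mod t < t" using t by auto
        moreover have "\<bar>t * quot r M i j\<bar> = t * \<bar>quot r M i j\<bar>" using t by (simp add: abs_mult)
        ultimately show ?thesis by linarith
      qed
      \<comment> \<open>Chaining the bounds gives at most \<open>2 R + A + B + C + 2 t\<close> with
        \<open>R\<close> the radius, and \<open>R\<close> itself dominates
        \<open>A + B + C + 2 t\<close>. Fresh variables stand for the products so that the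
        arithmetic is linear.\<close>
      moreover have "y \<le> 3 * (z + p + A + B + C + 2 * t)"
        if "x \<le> m + C" "y \<le> x + t" "q \<le> 2 * (z + p + A + B + C + 2 * t) + A" "m \<le> q + B + t" "0 \<le> z"
        for x y z m q
        using that p by simp
      ultimately have "t * \<bar>quot r M i j\<bar> \<le> 3 * radius s (Suc a)"
        using P_ij M_ij abs_ge_zero[of s] unfolding radius_eq by blast
      moreover have "3 * \<bar>quot r M i j\<bar> \<le> t * \<bar>quot r M i j\<bar>"
        using t by (rule mult_right_mono) (rule abs_ge_zero)
      ultimately have "3 * \<bar>quot r M i j\<bar> \<le> 3 * radius s (Suc a)" by (rule order_trans[rotated])
      then show ?thesis unfolding a by simp
    qed
  qed
  then show ?thesis
    using quot_in_UT[of r M] by (simp add: ut_ball_def M_def P_def)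
qed

section \<open>Polynomial functions on nilpotent groups\<close>

context group
begin

lemma inv_cancel_left:
  "x \<in> carrier G \<Longrightarrow> y \<in> carrier G \<Longrightarrow> inv x \<otimes> (x \<otimes> y) = y"
  "x \<in> carrier G \<Longrightarrow> y \<in> carrier G \<Longrightarrow> x \<otimes> (inv x \<otimes> y) = y"
  by (simp_all add: m_assoc[symmetric])

lemmas group_word_simps = m_assoc inv_mult_group inv_cancel_left

section \<open>Commutators in the lower central series\<close>

abbreviation lcs :: "nat \<Rightarrow> 'a set" where "lcs \<equiv> lower_central_series G"

lemma lcs_Suc: "lcs (Suc i) = generate G {h \<otimes> k \<otimes> inv h \<otimes> inv k | h k. h \<in> lcs i \<and> k \<in> carrier G}"
  by (auto simp: commutator_subgroup_def intro!: arg_cong[of _ _ "generate G"])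

lemma lcs_subset: "lcs i \<subseteq> carrier G"
proof (induction i)
  case (Suc i)
  then show ?case unfolding lcs_Suc by (intro generate_incl) auto
qed simp

lemma lcs_subgroup: "subgroup (lcs i) G"
proof (cases i)
  case (Suc j)
  then show ?thesis unfolding Suc lcs_Suc using lcs_subset[of j] by (intro generate_is_subgroup) auto
qed (simp add: subgroup_self)

lemma lcs_conj: "g \<in> carrier G \<Longrightarrow> h \<in> lcs i \<Longrightarrow> g \<otimes> h \<otimes> inv g \<in> lcs i"
proof (induction i arbitrary: g h)
  case (Suc i)
  let ?C = "{h \<otimes> k \<otimes> inv h \<otimes> inv k | h k. h \<in> lcs i \<and> k \<in> carrier G}"
  have "generate G ?C \<lhd> G"
  proof (rule normal_generateI)
    show "?C \<subseteq> carrier G" using lcs_subset[of i] by auto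
    fix x g assume "x \<in> ?C" and g: "g \<in> carrier G"
    then obtain h k where x: "x = h \<otimes> k \<otimes> inv h \<otimes> inv k" and h: "h \<in> lcs i" and k: "k \<in> carrier G"
      by auto
    have hG: "h \<in> carrier G" using h lcs_subset by auto
    have "g \<otimes> x \<otimes> inv g = (g \<otimes> h \<otimes> inv g) \<otimes> (g \<otimes> k \<otimes> inv g) \<otimes> inv (g \<otimes> h \<otimes> inv g) \<otimes> inv (g \<otimes> k \<otimes> inv g)"
      using g hG k by (simp add: x group_word_simps)
    then show "g \<otimes> x \<otimes> inv g \<in> ?C"
      using Suc.IH[OF g h] g k by blast
  qed
  then show ?case using Suc.prems unfolding lcs_Suc by (simp add: normal.inv_op_closed2)
qed simp

lemma lcs_commutator: "h \<in> lcs i \<Longrightarrow> k \<in> carrier G \<Longrightarrow> h \<otimes> k \<otimes> inv h \<otimes> inv k \<in> lcs (Suc i)"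
  unfolding lcs_Suc by (intro generate.incl) auto

lemma lcs_commutator':
  assumes "h \<in> lcs i" "k \<in> carrier G" shows "k \<otimes> h \<otimes> inv k \<otimes> inv h \<in> lcs (Suc i)"
proof -
  have "h \<in> carrier G" using assms lcs_subset by auto
  then have "k \<otimes> h \<otimes> inv k \<otimes> inv h = inv (h \<otimes> k \<otimes> inv h \<otimes> inv k)"
    using assms by (simp add: group_word_simps)
  then show ?thesis
    using subgroup.m_inv_closed[OF lcs_subgroup lcs_commutator[OF assms]] by simp
qed

lemma lcs_decreasing: "lcs (Suc i) \<subseteq> lcs i"
  unfolding lcs_Suc
proof (rule generate_subgroup_incl[OF _ lcs_subgroup], safe)
  fix h k assume h: "h \<in> lcs i" and k: "k \<in> carrier G"
  have "h \<in> carrier G" using h lcs_subset by auto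
  then have "h \<otimes> k \<otimes> inv h \<otimes> inv k = h \<otimes> (k \<otimes> inv h \<otimes> inv k)"
    using k by (simp add: group_word_simps)
  then show "h \<otimes> k \<otimes> inv h \<otimes> inv k \<in> lcs i"
    using h k lcs_conj[of k "inv h" i] lcs_subgroup[of i]
    by (simp add: subgroup.m_closed subgroup.m_inv_closed)
qed

lemma lcs_antimono: "i \<le> j \<Longrightarrow> lcs j \<subseteq> lcs i"
  using lcs_decreasing by (rule lift_Suc_antimono_le)

text \<open>\<open>pol N e\<close> means degree less than \<open>e\<close>: all
  \<open>e\<close>-fold left differences vanish. On a submonoid \<open>e = 0\<close> leaves only 0,
  \<open>e = 1\<close> the constants, and \<open>e = 2\<close> admits homomorphisms to the
  rationals.\<close>

fun pol :: "'a set \<Rightarrow> nat \<Rightarrow> ('a \<Rightarrow> rat) \<Rightarrow> bool"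
  where
    "pol N 0 f \<longleftrightarrow> (\<forall>x\<in>N. f x = 0)"
  | "pol N (Suc e) f \<longleftrightarrow> (\<forall>n\<in>N. pol N e (\<lambda>x. f (n \<otimes> x) - f x))"

text \<open>Left differences make sense on submonoids, and the later representation is built on
  products of letters without inverses.\<close>

definition mult_closed :: "'a set \<Rightarrow> bool"
  where "mult_closed N \<longleftrightarrow> \<one> \<in> N \<and> (\<forall>x\<in>N. \<forall>y\<in>N. x \<otimes> y \<in> N)"

lemma mult_closedD: "mult_closed N \<Longrightarrow> x \<in> N \<Longrightarrow> y \<in> N \<Longrightarrow> x \<otimes> y \<in> N"
  by (simp add: mult_closed_def)

lemma subgroup_mult_closed: "subgroup N G \<Longrightarrow> mult_closed N"
  by (simp add: mult_closed_def subgroup.one_closed subgroup.m_closed)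

lemma pol_cong:
  "mult_closed N \<Longrightarrow> (\<And>x. x \<in> N \<Longrightarrow> f x = g x) \<Longrightarrow> pol N e f \<longleftrightarrow> pol N e g"
proof (induction e arbitrary: f g)
  case (Suc e)
  have "pol N e (\<lambda>x. f (n \<otimes> x) - f x) = pol N e (\<lambda>x. g (n \<otimes> x) - g x)" if "n \<in> N" for n
    using Suc that by (intro Suc.IH) (simp_all add: mult_closedD)
  then show ?case by simp
qed auto

lemma pol_zero: "pol N 0 f \<Longrightarrow> mult_closed N \<Longrightarrow> pol N e f"
  by (induction e arbitrary: f) (auto simp: mult_closedD)

lemma pol_add: "pol N e f \<Longrightarrow> pol N e g \<Longrightarrow> pol N e (\<lambda>x. f x + g x)"
proof (induction e arbitrary: f g)
  case (Suc e)
  have "pol N e (\<lambda>x. (f (n \<otimes> x) + g (n \<otimes> x)) - (f x + g x))" if "n \<in> N" for n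
    using Suc.IH[of "\<lambda>x. f (n \<otimes> x) - f x" "\<lambda>x. g (n \<otimes> x) - g x"] Suc.prems that
    by (simp add: algebra_simps)
  then show ?case by simp
qed auto

lemma pol_scale: "pol N e f \<Longrightarrow> pol N e (\<lambda>x. c * f x)"
proof (induction e arbitrary: f)
  case (Suc e)
  have "pol N e (\<lambda>x. c * f (n \<otimes> x) - c * f x)" if "n \<in> N" for n
    using Suc.IH[of "\<lambda>x. f (n \<otimes> x) - f x"] Suc.prems that
    by (simp add: algebra_simps)
  then show ?case by simp
qed auto

lemma pol_diff: "pol N e f \<Longrightarrow> pol N e g \<Longrightarrow> pol N e (\<lambda>x. f x - g x)"
  using pol_add[of N e f "\<lambda>x. - 1 * g x"] pol_scale[of N e g "- 1"] by simp

lemma pol_sum: "mult_closed N \<Longrightarrow> (\<And>i. i \<in> I \<Longrightarrow> pol N e (f i)) \<Longrightarrow> pol N e (\<lambda>x. \<Sum>i\<in>I. f i x)"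
  by (induction I rule: infinite_finite_induct) (auto intro: pol_add pol_zero)

lemma pol_Suc: "pol N e f \<Longrightarrow> mult_closed N \<Longrightarrow> pol N (Suc e) f"
  by (induction e arbitrary: f) (auto simp: mult_closedD)

lemma pol_mono:
  assumes "pol N e f" "mult_closed N" "e \<le> e'" shows "pol N e' f"
  using assms(3) by (induction e' rule: dec_induct) (use assms pol_Suc in blast)+

lemma pol_subset: "pol N e f \<Longrightarrow> N' \<subseteq> N \<Longrightarrow> pol N' e f"
  by (induction e arbitrary: f) auto

section \<open>Degrees weighted by the lower central series\<close>

text \<open>An element of the \<open>i\<close>-th term of the (0-indexed) lower central series has weight \<open>i + 1\<close>.\<close>

fun wpol :: "'a set \<Rightarrow> nat \<Rightarrow> ('a \<Rightarrow> rat) \<Rightarrow> bool"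
  where
    "wpol N 0 f \<longleftrightarrow> (\<forall>x\<in>N. f x = 0)"
  | "wpol N (Suc e) f \<longleftrightarrow> (\<forall>i. \<forall>n\<in>N \<inter> lcs i. wpol N (e - i) (\<lambda>x. f (n \<otimes> x) - f x))"

lemma wpol_cong:
  "mult_closed N \<Longrightarrow> (\<And>x. x \<in> N \<Longrightarrow> f x = g x) \<Longrightarrow> wpol N e f \<longleftrightarrow> wpol N e g"
proof (induction e arbitrary: f g rule: less_induct)
  case (less e)
  show ?case
  proof (cases e)
    case (Suc e')
    have "wpol N (e' - i) (\<lambda>x. f (n \<otimes> x) - f x) = wpol N (e' - i) (\<lambda>x. g (n \<otimes> x) - g x)" if "n \<in> N" for n i
      using less.prems that by (intro less.IH) (simp_all add: mult_closedD Suc)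
    then show ?thesis by (simp add: Suc)
  qed (use less in auto)
qed

lemma wpol_zero: "wpol N 0 f \<Longrightarrow> mult_closed N \<Longrightarrow> wpol N e f"
proof (induction e arbitrary: f rule: less_induct)
  case (less e)
  then show ?case by (cases e) (auto simp: mult_closedD intro!: less.IH)
qed

lemma wpol_add: "wpol N e f \<Longrightarrow> wpol N e g \<Longrightarrow> wpol N e (\<lambda>x. f x + g x)"
proof (induction e arbitrary: f g rule: less_induct)
  case (less e)
  show ?case
  proof (cases e)
    case (Suc e')
    have "wpol N (e' - i) (\<lambda>x. (f (n \<otimes> x) + g (n \<otimes> x)) - (f x + g x))" if "n \<in> N \<inter> lcs i" for n i
      using less.IH[of "e' - i" "\<lambda>x. f (n \<otimes> x) - f x" "\<lambda>x. g (n \<otimes> x) - g x"] less.prems that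
      by (simp add: algebra_simps Suc)
    then show ?thesis by (simp add: Suc)
  qed (use less in auto)
qed

lemma wpol_Suc: "wpol N e f \<Longrightarrow> mult_closed N \<Longrightarrow> wpol N (Suc e) f"
proof (induction e arbitrary: f rule: less_induct)
  case (less e)
  show ?case
  proof (cases e)
    case 0
    then show ?thesis using wpol_zero less by blast
  next
    case (Suc e')
    have "wpol N (Suc e' - i) (\<lambda>x. f (n \<otimes> x) - f x)" if "n \<in> N \<inter> lcs i" for n i
    proof (cases "i \<le> e'")
      case True
      have "wpol N (e' - i) (\<lambda>x. f (n \<otimes> x) - f x)"
        using less.prems that unfolding Suc wpol.simps by blast
      then have "wpol N (Suc (e' - i)) (\<lambda>x. f (n \<otimes> x) - f x)"
        by (intro less.IH) (simp_all add: Suc less.prems)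
      then show ?thesis using True by (simp only: Suc_diff_le)
    next
      case False
      then have "Suc e' - i = e' - i" by simp
      then show ?thesis using less.prems that unfolding Suc wpol.simps by metis
    qed
    then show ?thesis by (simp add: Suc)
  qed
qed

lemma wpol_mono:
  assumes "wpol N e f" "mult_closed N" "e \<le> e'" shows "wpol N e' f"
  using assms(3) by (induction e' rule: dec_induct) (use assms wpol_Suc in blast)+

lemma wpol_shift:
  assumes "wpol N e f" "mult_closed N" "n \<in> N" "n \<in> carrier G"
  shows "wpol N (e - 1) (\<lambda>x. f (n \<otimes> x) - f x)" and "wpol N e (\<lambda>x. f (n \<otimes> x))"
proof -
  show *: "wpol N (e - 1) (\<lambda>x. f (n \<otimes> x) - f x)"
  proof (cases e)
    case 0
    then show ?thesis using assms by (simp add: mult_closedD)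
  next
    case (Suc e')
    have "n \<in> N \<inter> lcs 0" using assms by simp
    then have "wpol N (e' - 0) (\<lambda>x. f (n \<otimes> x) - f x)"
      using assms(1) unfolding Suc wpol.simps by blast
    then show ?thesis by (simp add: Suc)
  qed
  have "wpol N e (\<lambda>x. (f (n \<otimes> x) - f x) + f x)"
    by (intro wpol_add wpol_mono[OF *]) (use assms in auto)
  then show "wpol N e (\<lambda>x. f (n \<otimes> x))" by simp
qed

text \<open>In general, conjugation by \<open>g\<close> may map \<open>N\<close> properly into
  itself; demanding both directions makes this set a subgroup.\<close>

definition normalizing :: "'a set \<Rightarrow> 'a set"
  where "normalizing N = {g \<in> carrier G. \<forall>n\<in>N. g \<otimes> n \<otimes> inv g \<in> N \<and> inv g \<otimes> n \<otimes> g \<in> N}"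

lemma normalizing_conj:
  "g \<in> normalizing N \<Longrightarrow> n \<in> N \<Longrightarrow> g \<otimes> n \<otimes> inv g \<in> N"
  "g \<in> normalizing N \<Longrightarrow> n \<in> N \<Longrightarrow> inv g \<otimes> n \<otimes> g \<in> N"
  by (auto simp: normalizing_def)

lemma normalizing_subgroup:
  assumes "N \<subseteq> carrier G" shows "subgroup (normalizing N) G"
proof
  fix g h assume gh: "g \<in> normalizing N" "h \<in> normalizing N"
  then have G: "g \<in> carrier G" "h \<in> carrier G" by (auto simp: normalizing_def)
  have "(g \<otimes> h) \<otimes> n \<otimes> inv (g \<otimes> h) \<in> N \<and> inv (g \<otimes> h) \<otimes> n \<otimes> (g \<otimes> h) \<in> N" if n: "n \<in> N" for n
  proof -
    have nG: "n \<in> carrier G" using n assms by auto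
    have "(g \<otimes> h) \<otimes> n \<otimes> inv (g \<otimes> h) = g \<otimes> (h \<otimes> n \<otimes> inv h) \<otimes> inv g"
      "inv (g \<otimes> h) \<otimes> n \<otimes> (g \<otimes> h) = inv h \<otimes> (inv g \<otimes> n \<otimes> g) \<otimes> h"
      using G nG by (simp_all add: group_word_simps)
    then show ?thesis using gh n by (simp add: normalizing_conj)
  qed
  then show "g \<otimes> h \<in> normalizing N" using G by (simp add: normalizing_def)
qed (use assms in \<open>auto simp: normalizing_def\<close>)

text \<open>Since \<open>g (n x) g^-1 = (g n g^-1) (g x g^-1)\<close>, differences along
  \<open>n\<close> turn into differences along a conjugate of \<open>n\<close>, which lies in the
  same term of the lower central series.\<close>

lemma wpol_conj:
  assumes "subgroup N G" "g \<in> normalizing N"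
  shows "wpol N e f \<Longrightarrow> wpol N e (\<lambda>x. f (g \<otimes> x \<otimes> inv g))"
proof (induction e arbitrary: f rule: less_induct)
  case (less e)
  have gG: "g \<in> carrier G" using assms(2) by (simp add: normalizing_def)
  have NG: "N \<subseteq> carrier G" using assms(1) by (rule subgroup.subset)
  show ?case
  proof (cases e)
    case 0
    then show ?thesis using less.prems assms by (auto simp: normalizing_conj)
  next
    case (Suc e')
    have "wpol N (e' - i) (\<lambda>x. f (g \<otimes> (n \<otimes> x) \<otimes> inv g) - f (g \<otimes> x \<otimes> inv g))" if n: "n \<in> N \<inter> lcs i" for n i
    proof -
      have nG: "n \<in> carrier G" using n NG by auto
      let ?m = "g \<otimes> n \<otimes> inv g"
      have "?m \<in> N \<inter> lcs i" using n gG assms(2) by (auto intro: normalizing_conj lcs_conj)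
      then have "wpol N (e' - i) (\<lambda>x. f (?m \<otimes> x) - f x)"
        using less.prems unfolding Suc wpol.simps by blast
      from less.IH[OF _ this]
      have "wpol N (e' - i) (\<lambda>x. f (?m \<otimes> (g \<otimes> x \<otimes> inv g)) - f (g \<otimes> x \<otimes> inv g))"
        by (simp add: Suc)
      moreover have "?m \<otimes> (g \<otimes> x \<otimes> inv g) = g \<otimes> (n \<otimes> x) \<otimes> inv g" if "x \<in> N" for x
        using that NG nG gG by (auto simp: group_word_simps)
      ultimately show ?thesis
        by (subst wpol_cong[OF subgroup_mult_closed[OF assms(1)],
              of _ "\<lambda>x. f (?m \<otimes> (g \<otimes> x \<otimes> inv g)) - f (g \<otimes> x \<otimes> inv g)"]) auto
    qed
    then show ?thesis by (simp add: Suc)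
  qed
qed

text \<open>Conjugation acts unipotently on polynomial functions, because passing from \<open>n\<close> to
  \<open>g n g\<inverse> = [g, n] n\<close> only adds a factor of higher weight.\<close>

lemma wpol_conj_diff:
  assumes N: "subgroup N G" and g: "g \<in> normalizing N"
  shows "wpol N e f \<Longrightarrow> wpol N (e - 1) (\<lambda>x. f (g \<otimes> x \<otimes> inv g) - f x)"
proof (induction e arbitrary: f rule: less_induct)
  case (less e)
  have gG: "g \<in> carrier G" using g by (simp add: normalizing_def)
  have NG: "N \<subseteq> carrier G" using N by (rule subgroup.subset)
  have N': "mult_closed N" using N by (rule subgroup_mult_closed)
  let ?c = "\<lambda>x. g \<otimes> x \<otimes> inv g"
  show ?case
  proof (cases "e \<le> 1")
    case True
    show ?thesis
    proof (cases e)
      case 0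
      then show ?thesis using less.prems g by (auto simp: normalizing_conj)
    next
      case (Suc e')
      then have "e = 1" using True by simp
      have "f x = f \<one>" if x: "x \<in> N" for x
      proof -
        have "wpol N (0 - 0) (\<lambda>y. f (x \<otimes> y) - f y)"
          using less.prems x NG unfolding \<open>e = 1\<close> One_nat_def wpol.simps(2)[of N 0 f]
          by (metis IntI lower_central_series.simps(1) subsetD)
        then have "f (x \<otimes> \<one>) = f \<one>"
          using subgroup.one_closed[OF N] by simp
        then show ?thesis using x NG by auto
      qed
      then show ?thesis using g by (simp add: \<open>e = 1\<close> normalizing_conj(1))
    qed
  next
    case False
    then obtain e' where e: "e = Suc (Suc e')"
      by (metis One_nat_def Suc_le_mono not0_implies_Suc not_less_eq_eq zero_le)
    have "wpol N (e' - i) (\<lambda>x. (f (?c (n \<otimes> x)) - f (n \<otimes> x)) - (f (?c x) - f x))"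
      if n: "n \<in> N \<inter> lcs i" for n i
    proof -
      have nG: "n \<in> carrier G" using n NG by auto
      \<comment> \<open>With \<open>m = [g, n]\<close> one has
        \<open>g (n x) g^-1 = m n (g x g^-1)\<close>. The expression splits into a difference along
        \<open>m\<close>, which lies one term deeper than \<open>n\<close>, and the conjugation
        difference of \<open>f (n x) - f x\<close>, which the induction hypothesis covers.\<close>
      let ?m = "g \<otimes> n \<otimes> inv g \<otimes> inv n"
      have gn: "?c n \<in> N" using n g by (simp add: normalizing_conj)
      then have mN: "?m \<in> N"
        using n by (intro subgroup.m_closed[OF N gn] subgroup.m_inv_closed[OF N]) auto
      moreover have "?m \<in> lcs (Suc i)" using n gG lcs_commutator' by auto
      ultimately have "wpol N (Suc e' - Suc i) (\<lambda>x. f (?m \<otimes> x) - f x)"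
        using less.prems unfolding e wpol.simps(2)[of N "Suc e'"] by blast
      then have "wpol N (e' - i) (\<lambda>x. f (?m \<otimes> x) - f x)" by simp
      from wpol_shift(2)[OF this N' _ nG] n
      have "wpol N (e' - i) (\<lambda>x. f (?m \<otimes> (n \<otimes> x)) - f (n \<otimes> x))" by simp
      from wpol_conj[OF N g this]
      have 1: "wpol N (e' - i) (\<lambda>x. f (?m \<otimes> (n \<otimes> ?c x)) - f (n \<otimes> ?c x))" .
      have "wpol N (Suc e' - i) (\<lambda>x. f (n \<otimes> x) - f x)"
        using less.prems n unfolding e wpol.simps(2)[of N "Suc e'"] by blast
      from less.IH[OF _ this]
      have 2: "wpol N (Suc e' - i - 1) (\<lambda>x. (f (n \<otimes> ?c x) - f (?c x)) - (f (n \<otimes> x) - f x))"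
        by (simp add: e)
      have "Suc e' - i - 1 = e' - i" by simp
      note wpol_add[OF 1 2[unfolded this]]
      moreover have "?c (n \<otimes> x) = ?m \<otimes> (n \<otimes> ?c x)" if "x \<in> N" for x
        using that NG nG gG by (auto simp: group_word_simps)
      ultimately show ?thesis
        by (subst wpol_cong[OF N', of _ "\<lambda>x. (f (?m \<otimes> (n \<otimes> ?c x)) - f (n \<otimes> ?c x)) +
              ((f (n \<otimes> ?c x) - f (?c x)) - (f (n \<otimes> x) - f x))"]) auto
    qed
    then show ?thesis by (simp add: e)
  qed
qed

text \<open>Elements of \<open>lcs i\<close> with \<open>i \<ge> c\<close> are trivial, so a
  difference that matters lowers the weighted bound by at most \<open>c\<close>.\<close>

lemma pol_imp_wpol:
  assumes N: "subgroup N G" and c: "lcs c = {\<one>}" "c > 0"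
  shows "pol N e f \<Longrightarrow> wpol N (e * c) f"
proof (induction e arbitrary: f)
  case (Suc e)
  have N': "mult_closed N" using N by (rule subgroup_mult_closed)
  obtain c' where c': "c = Suc c'" using c(2) gr0_implies_Suc by auto
  have "wpol N (c' + e * c - i) (\<lambda>x. f (n \<otimes> x) - f x)" if n: "n \<in> N \<inter> lcs i" for n i
  proof (cases "i \<le> c'")
    case True
    have "wpol N (e * c) (\<lambda>x. f (n \<otimes> x) - f x)" using Suc n by auto
    then show ?thesis by (rule wpol_mono[OF _ N']) (use True in simp)
  next
    case False
    then have "lcs i \<subseteq> {\<one>}" using lcs_antimono[of c i] c c' by auto
    then have "n = \<one>" using n by auto
    then have "wpol N 0 (\<lambda>x. f (n \<otimes> x) - f x)" using subgroup.subset[OF N] by auto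
    then show ?thesis using N' by (rule wpol_zero)
  qed
  then have "wpol N (Suc (c' + e * c)) f" by simp
  moreover have "Suc e * c = Suc (c' + e * c)" by (simp add: c')
  ultimately show ?case by (simp only:)
qed simp

text \<open>One degree bound has to serve all elements: the functions below it will form the
  finite-dimensional space on which the matrices act.\<close>

definition sep :: "'a set \<Rightarrow> bool"
  where "sep N \<longleftrightarrow> (\<exists>e. \<forall>g\<in>N. (\<forall>f. pol N e f \<longrightarrow> f g = f \<one>) \<longrightarrow> g = \<one>)"

lemma sep_trivial: "sep {\<one>}"
  by (auto simp: sep_def)

text \<open>Every element is uniquely \<open>n b^k\<close>. The exponent is a homomorphism and
  detects \<open>k\<close>; a polynomial function on \<open>N\<close> is extended by ignoring
  \<open>b^k\<close>. Translating the extension by \<open>n b^k\<close> amounts on \<open>N\<close>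
  to evaluating at \<open>n (b^k x b^-k)\<close>, and the difference drops in weighted degree by
  \<open>wpol_conj_diff\<close>.\<close>

lemma sep_extend:
  assumes nil: "lcs c = {\<one>}" "c > 0"
    and N: "subgroup N G" and b: "b \<in> normalizing N" and free: "\<And>k::int. k \<noteq> 0 \<Longrightarrow> b [^] k \<notin> N"
    and sepN: "sep N"
  shows "sep {n \<otimes> b [^] (k::int) | n k. n \<in> N}" (is "sep ?N'")
proof -
  have NG: "N \<subseteq> carrier G" using N by (rule subgroup.subset)
  have N': "mult_closed N" using N by (rule subgroup_mult_closed)
  have bG [simp]: "b \<in> carrier G" using b by (simp add: normalizing_def)
  have bk: "b [^] k \<in> normalizing N" for k :: int
    by (rule subgroup_int_pow_closed[OF normalizing_subgroup[OF NG] b])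
  have uniq: "n \<otimes> b [^] k \<otimes> b [^] (- j) \<in> N \<longleftrightarrow> j = k" if n: "n \<in> N" for n and j k :: int
  proof
    have nG: "n \<in> carrier G" using n NG by auto
    have eq: "n \<otimes> b [^] k \<otimes> b [^] (- j) = n \<otimes> b [^] (k - j)"
      using nG by (simp add: m_assoc int_pow_mult[symmetric])
    assume "n \<otimes> b [^] k \<otimes> b [^] (- j) \<in> N"
    then have "inv n \<otimes> (n \<otimes> b [^] (k - j)) \<in> N"
      unfolding eq using n N by (auto intro: subgroup.m_closed subgroup.m_inv_closed)
    then have "b [^] (k - j) \<in> N" using nG by (simp add: inv_cancel_left)
    then show "j = k" using free[of "k - j"] by auto
  next
    assume "j = k"
    then show "n \<otimes> b [^] k \<otimes> b [^] (- j) \<in> N"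
      using n NG by (auto simp: m_assoc int_pow_mult[symmetric])
  qed
  define ex where "ex x = (THE k::int. x \<otimes> b [^] (- k) \<in> N)" for x
  have ex: "ex (n \<otimes> b [^] k) = k" if "n \<in> N" for n k
    unfolding ex_def using uniq[OF that] by simp
  define lift where "lift f x = f (x \<otimes> b [^] (- ex x))" for f :: "'a \<Rightarrow> rat" and x
  have lift: "lift f (n \<otimes> b [^] k) = f n" if "n \<in> N" for f n and k :: int
    using that NG by (auto simp: lift_def ex m_assoc int_pow_mult[symmetric])
  have mul: "(n \<otimes> b [^] k) \<otimes> (m \<otimes> b [^] j) = (n \<otimes> (b [^] k \<otimes> m \<otimes> inv (b [^] k))) \<otimes> b [^] (k + j)"
    and conj: "b [^] k \<otimes> m \<otimes> inv (b [^] k) \<in> N"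
    if "n \<in> N" "m \<in> N" for n m and k j :: int
  proof -
    have "n \<in> carrier G" "m \<in> carrier G" using that NG by auto
    then show "(n \<otimes> b [^] k) \<otimes> (m \<otimes> b [^] j) = (n \<otimes> (b [^] k \<otimes> m \<otimes> inv (b [^] k))) \<otimes> b [^] (k + j)"
      by (simp add: int_pow_mult group_word_simps)
    show "b [^] k \<otimes> m \<otimes> inv (b [^] k) \<in> N" using normalizing_conj(1)[OF bk \<open>m \<in> N\<close>] .
  qed
  have N'_closed: "mult_closed ?N'"
  proof -
    have "\<one> = \<one> \<otimes> b [^] (0::int)" by simp
    moreover have "x \<otimes> y \<in> ?N'" if "x \<in> ?N'" "y \<in> ?N'" for x y
      using that mul conj subgroup.m_closed[OF N] by blast
    ultimately show ?thesis
      using subgroup.one_closed[OF N] unfolding mult_closed_def by blast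
  qed
  \<comment> \<open>The hypothesis is weighted and the conclusion is not: conjugation by
    \<open>b^k\<close> need not lower the ordinary degree, but it lowers the weighted one.\<close>
  have pol_lift: "wpol N e f \<Longrightarrow> pol ?N' e (lift f)" for e f
  proof (induction e arbitrary: f)
    case 0
    then show ?case by (auto simp: lift)
  next
    case (Suc e)
    have "pol ?N' e (\<lambda>x. lift f (g \<otimes> x) - lift f x)" if g': "g \<in> ?N'" for g
    proof -
      obtain n k where g: "g = n \<otimes> b [^] (k::int)" and n: "n \<in> N" using g' by blast
      have nG: "n \<in> carrier G" using n NG by auto
      let ?c = "\<lambda>x. b [^] k \<otimes> x \<otimes> inv (b [^] k)"
      have "wpol N (Suc e - 1) (\<lambda>x. f (n \<otimes> x) - f x)"
        by (rule wpol_shift(1)[OF Suc.prems N' n nG])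
      moreover have "wpol N (Suc e - 1) (\<lambda>x. f (n \<otimes> ?c x) - f (n \<otimes> x))"
        by (rule wpol_conj_diff[OF N bk wpol_shift(2)[OF Suc.prems N' n nG]])
      ultimately have "wpol N e (\<lambda>x. (f (n \<otimes> ?c x) - f (n \<otimes> x)) + (f (n \<otimes> x) - f x))"
        by (intro wpol_add) simp_all
      then have "wpol N e (\<lambda>x. f (n \<otimes> ?c x) - f x)" by simp
      from Suc.IH[OF this] have "pol ?N' e (lift (\<lambda>x. f (n \<otimes> ?c x) - f x))" .
      moreover have "lift f (g \<otimes> x) - lift f x = lift (\<lambda>x. f (n \<otimes> ?c x) - f x) x" if "x \<in> ?N'" for x
      proof -
        obtain m j where x: "x = m \<otimes> b [^] (j::int)" and m: "m \<in> N" using \<open>x \<in> ?N'\<close> by blast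
        show ?thesis
          unfolding x g mul[OF n m] lift[OF m]
          by (subst lift) (use n m conj[OF n m] in \<open>auto simp: mult_closedD[OF N']\<close>)
      qed
      ultimately show ?thesis
        by (subst pol_cong[OF N'_closed, of _ "lift (\<lambda>x. f (n \<otimes> ?c x) - f x)"]) auto
    qed
    then show ?case by simp
  qed
  have pol_ex: "pol ?N' 2 (\<lambda>x. of_int (ex x))"
  proof -
    have hom: "ex (g \<otimes> x) = ex g + ex x" if gx: "g \<in> ?N'" "x \<in> ?N'" for g x
    proof -
      obtain n k where g: "g = n \<otimes> b [^] (k::int)" and n: "n \<in> N" using gx by blast
      obtain m j where x: "x = m \<otimes> b [^] (j::int)" and m: "m \<in> N" using gx by blast
      show ?thesis
        unfolding x g mul[OF n m] ex[OF n] ex[OF m]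
        by (intro ex mult_closedD[OF N' n] conj[OF n m])
    qed
    have "(of_int (ex (g \<otimes> (h \<otimes> x))) - of_int (ex (h \<otimes> x))) - (of_int (ex (g \<otimes> x)) - of_int (ex x)) = (0 :: rat)"
      if "g \<in> ?N'" "h \<in> ?N'" "x \<in> ?N'" for g h x
      unfolding hom[OF that(1) mult_closedD[OF N'_closed that(2,3)]] hom[OF that(1,3)] by simp
    then show ?thesis unfolding numeral_2_eq_2 pol.simps by blast
  qed
  obtain e where e: "\<And>g. g \<in> N \<Longrightarrow> (\<And>f. pol N e f \<Longrightarrow> f g = f \<one>) \<Longrightarrow> g = \<one>"
    using sepN unfolding sep_def by auto
  have one: "\<one> = \<one> \<otimes> b [^] (0::int)" by simp
  have oneN: "\<one> \<in> N" using N by (rule subgroup.one_closed)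
  \<comment> \<open>The bound 2 admits the exponent, \<open>e * c\<close> the extensions of
    functions on \<open>N\<close>.\<close>
  have "g = \<one>" if g: "g \<in> ?N'" and all: "\<forall>f. pol ?N' (max 2 (e * c)) f \<longrightarrow> f g = f \<one>" for g
  proof -
    obtain n k where gn: "g = n \<otimes> b [^] (k::int)" and n: "n \<in> N" using g by blast
    have "(of_int (ex g) :: rat) = of_int (ex \<one>)"
      by (rule all[rule_format, OF pol_mono[OF pol_ex N'_closed]]) simp
    then have "k = 0" using ex[OF n, of k] ex[OF oneN, of 0] gn by simp
    then have gn: "g = n" using gn n NG by auto
    show ?thesis
    proof (rule e)
      show "g \<in> N" using gn n by simp
      fix f assume "pol N e f"
      then have "pol ?N' (max 2 (e * c)) (lift f)"
        by (rule pol_mono[OF pol_lift[OF pol_imp_wpol[OF N nil]] N'_closed]) simp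
      then have "lift f g = lift f \<one>" using all by blast
      then show "f g = f \<one>" using lift[OF n, of f 0] lift[OF oneN, of f 0] gn n NG by auto
    qed
  qed
  then show ?thesis unfolding sep_def by blast
qed

end

section \<open>Finite-index subgroups separated by polynomial functions\<close>

declare lower_central_series.simps(2) [simp del]

context group
begin

definition fin_index :: "'a set \<Rightarrow> 'a set \<Rightarrow> bool"
  where "fin_index M H \<longleftrightarrow> (\<exists>R. finite R \<and> R \<subseteq> H \<and> (\<forall>h\<in>H. \<exists>r\<in>R. h \<otimes> inv r \<in> M))"

text \<open>A finitely generated group has only finitely many subgroups of a given finite index, since
  such a subgroup is determined by the action of the generators on its cosets. The conjugates of
  \<open>M\<close> by the powers of \<open>a\<close> therefore repeat.\<close>

lemma power_normalizes_fin_index: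
  assumes S: "finite S" "S \<subseteq> carrier G" and H: "H = generate G S"
    and M: "subgroup M G" "M \<subseteq> H" "fin_index M H" and a: "a \<in> normalizing H"
  shows "\<exists>k::nat. k > 0 \<and> a [^] k \<in> normalizing M"
proof -
  have HG: "subgroup H G" using generate_is_subgroup S H by simp
  have HC: "H \<subseteq> carrier G" using HG by (rule subgroup.subset)
  note closed = subgroup.m_closed[OF HG] subgroup.m_inv_closed[OF HG] subgroup.one_closed[OF HG]
    subsetD[OF HC]
  have aG [simp]: "a \<in> carrier G" using a by (simp add: normalizing_def)
  have an: "a [^] j \<in> normalizing H" for j :: nat
    using subgroup_int_pow_closed[OF normalizing_subgroup[OF HC] a, of "int j"] by (simp add: int_pow_int)
  obtain R where R: "finite R" "R \<subseteq> H" "\<And>h. h \<in> H \<Longrightarrow> \<exists>r\<in>R. h \<otimes> inv r \<in> M"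
    using M(3) unfolding fin_index_def by blast
  \<comment> \<open>The chosen representative depends only on the coset, so right multiplication
    acts on representatives.\<close>
  define rep where "rep h = (SOME r. r \<in> R \<and> h \<otimes> inv r \<in> M)" for h
  have rep: "rep h \<in> R" "h \<otimes> inv rep h \<in> M" if "h \<in> H" for h
    unfolding rep_def using someI_ex[OF R(3)[OF that, unfolded Bex_def]] by auto
  have repH: "rep h \<in> H" if "h \<in> H" for h using rep(1)[OF that] R(2) by auto
  have Mdiv: "x \<otimes> inv y \<in> M" if "x \<in> M" "y \<in> M" for x y
    using that by (intro subgroup.m_closed[OF M(1)] subgroup.m_inv_closed[OF M(1)])
  have rep_eq: "rep h = rep h' \<longleftrightarrow> h \<otimes> inv h' \<in> M" if "h \<in> H" "h' \<in> H" for h h'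
  proof
    assume eq: "rep h = rep h'"
    have "(h \<otimes> inv rep h) \<otimes> inv (h' \<otimes> inv rep h') \<in> M"
      using rep(2)[OF that(1)] rep(2)[OF that(2)] by (rule Mdiv)
    moreover have "(h \<otimes> inv rep h) \<otimes> inv (h' \<otimes> inv rep h') = h \<otimes> inv h'"
      using that repH by (simp add: closed eq group_word_simps)
    ultimately show "h \<otimes> inv h' \<in> M" by simp
  next
    assume hh: "h \<otimes> inv h' \<in> M"
    have "h \<otimes> inv r \<in> M \<longleftrightarrow> h' \<otimes> inv r \<in> M" if "r \<in> R" for r
    proof
      have [simp]: "h \<in> carrier G" "h' \<in> carrier G" "r \<in> carrier G"
        using \<open>h \<in> H\<close> \<open>h' \<in> H\<close> \<open>r \<in> R\<close> R(2) HC by auto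
      have e: "h' \<otimes> inv r = inv (h \<otimes> inv h') \<otimes> (h \<otimes> inv r)"
        "h \<otimes> inv r = (h \<otimes> inv h') \<otimes> (h' \<otimes> inv r)" by (simp_all add: group_word_simps)
      show "h' \<otimes> inv r \<in> M" if "h \<otimes> inv r \<in> M"
        unfolding e(1) by (rule subgroup.m_closed[OF M(1) subgroup.m_inv_closed[OF M(1) hh] that])
      show "h \<otimes> inv r \<in> M" if "h' \<otimes> inv r \<in> M"
        unfolding e(2) by (rule subgroup.m_closed[OF M(1) hh that])
    qed
    then have "(\<lambda>r. r \<in> R \<and> h \<otimes> inv r \<in> M) = (\<lambda>r. r \<in> R \<and> h' \<otimes> inv r \<in> M)" by auto
    then show "rep h = rep h'" by (simp add: rep_def)
  qed
  have rep_mult: "rep (y \<otimes> z) = rep (rep y \<otimes> z)" if "y \<in> H" "z \<in> H" for y z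
  proof -
    have "y \<otimes> z \<otimes> inv (rep y \<otimes> z) = y \<otimes> inv rep y"
      using that repH[OF that(1)] by (simp add: closed group_word_simps)
    then show ?thesis using that repH[OF that(1)] rep(2)[OF that(1)] by (simp add: rep_eq closed)
  qed
  define T where "T j h = inv (a [^] j) \<otimes> h \<otimes> a [^] j" for j :: nat and h
  have TH: "T j h \<in> H" if "h \<in> H" for j h
    unfolding T_def using normalizing_conj(2)[OF an that] .
  have T_mult: "T j (x \<otimes> y) = T j x \<otimes> T j y" if "x \<in> H" "y \<in> H" for x y j
    unfolding T_def using that by (simp add: closed(4) group_word_simps)
  have T_inv: "T j (inv x) = inv T j x" if "x \<in> H" for x j
    unfolding T_def using that by (simp add: closed(4) group_word_simps)
  have T_one: "T j \<one> = \<one>" for j unfolding T_def by simp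
  \<comment> \<open>The table of how the generators, conjugated by a power of \<open>a\<close>,
    permute the cosets. There are only finitely many tables, so two exponents share one.\<close>
  define \<delta> where "\<delta> j = (\<lambda>(r, s)\<in>R \<times> S. rep (r \<otimes> T j s))" for j
  have SH: "S \<subseteq> H" using H by (auto intro: generate.incl)
  have "\<delta> l \<in> PiE (R \<times> S) (\<lambda>_. R)" for l
  proof (rule PiE_I)
    fix x assume "x \<in> R \<times> S"
    then obtain r s where x: "x = (r, s)" "r \<in> R" "s \<in> S" by blast
    then have "r \<otimes> T l s \<in> H" using R(2) SH by (intro closed(1) TH) auto
    then show "\<delta> l x \<in> R" using x rep(1) by (simp add: \<delta>_def)
  next
    fix x assume "x \<notin> R \<times> S"
    then show "\<delta> l x = undefined" by (simp only: \<delta>_def restrict_def if_False)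
  qed
  then have "range \<delta> \<subseteq> PiE (R \<times> S) (\<lambda>_. R)" by blast
  then have "finite (range \<delta>)"
    using R(1) S(1) by (meson finite_PiE finite_SigmaI finite_subset)
  then have "\<not> inj \<delta>" using finite_imageD infinite_UNIV_nat by blast
  then obtain i j where "\<delta> i = \<delta> j" "i < j" unfolding inj_def by (metis nat_neq_iff)
  have same: "\<forall>r\<in>R. rep (r \<otimes> T i h) = rep (r \<otimes> T j h)" if "h \<in> H" for h
    using that unfolding H
  proof (induction h rule: generate.induct)
    case one
    then show ?case by (simp add: T_one)
  next
    case (incl s)
    have "rep (r \<otimes> T i s) = rep (r \<otimes> T j s)" if "r \<in> R" for r
      using fun_cong[OF \<open>\<delta> i = \<delta> j\<close>, of "(r, s)"] that incl by (simp add: \<delta>_def)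
    then show ?case by simp
  next
    case (inv s)
    have s: "s \<in> H" using inv SH by auto
    show ?case
    proof
      fix r assume r: "r \<in> R"
      then have rH: "r \<in> H" using R(2) by auto
      \<comment> \<open>\<open>T i s\<close> moves the coset of \<open>x\<close> to that of
        \<open>r\<close>, and \<open>T j s\<close> acts in the same way; hence the inverses agree on
        the coset of \<open>r\<close>.\<close>
      define x where "x = r \<otimes> inv T i s"
      have xH: "x \<in> H" using rH TH[OF s] by (simp add: x_def closed)
      have rx: "rep x \<in> R" "rep x \<in> H" using rep(1) repH xH by auto
      have "rep r = rep (x \<otimes> T i s)"
        using rH TH[OF s, of i] by (simp add: x_def closed group_word_simps)
      also have "\<dots> = rep (rep x \<otimes> T i s)" by (rule rep_mult[OF xH TH[OF s]])
      also have "\<dots> = rep (rep x \<otimes> T j s)"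
        using fun_cong[OF \<open>\<delta> i = \<delta> j\<close>, of "(rep x, s)"] rx inv by (simp add: \<delta>_def)
      finally have "rep (r \<otimes> inv T j s) = rep (rep (rep x \<otimes> T j s) \<otimes> inv T j s)"
        using rep_mult[of r "inv T j s"] rH TH[OF s] by (simp add: closed)
      also have "\<dots> = rep (rep x \<otimes> T j s \<otimes> inv T j s)"
        using rep_mult[of "rep x \<otimes> T j s" "inv T j s"] rx TH[OF s] by (simp add: closed)
      also have "\<dots> = rep (rep x)"
        using rx TH[OF s, of j] by (simp add: closed m_assoc)
      also have "\<dots> = rep x"
        using rep_mult[OF xH closed(3)] xH rx by (simp add: closed)
      finally show "rep (r \<otimes> T i (inv s)) = rep (r \<otimes> T j (inv s))"
        by (simp add: T_inv[OF s] x_def)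
    qed
  next
    case (eng x y)
    have xy: "x \<in> H" "y \<in> H" using eng H by auto
    show ?case
    proof
      fix r assume r: "r \<in> R"
      then have rH: "r \<in> H" using R(2) by auto
      have *: "rep (r \<otimes> T l (x \<otimes> y)) = rep (rep (r \<otimes> T l x) \<otimes> T l y)" for l
      proof -
        have "r \<otimes> T l (x \<otimes> y) = r \<otimes> T l x \<otimes> T l y"
          using rH TH[OF xy(1)] TH[OF xy(2)] by (simp add: T_mult[OF xy] closed m_assoc)
        then show ?thesis using rep_mult[of "r \<otimes> T l x" "T l y"] rH TH xy by (simp add: closed)
      qed
      have "rep (r \<otimes> T j x) \<in> R" using rH TH xy by (intro rep closed)
      then show "rep (r \<otimes> T i (x \<otimes> y)) = rep (r \<otimes> T j (x \<otimes> y))"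
        unfolding * using eng.IH r by simp
    qed
  qed
  \<comment> \<open>An element of \<open>H\<close> lies in \<open>M\<close> iff it fixes the coset
    of 1, so equal actions give \<open>a^i M a^-i = a^j M a^-j\<close>.\<close>
  have iff: "T i h \<in> M \<longleftrightarrow> T j h \<in> M" if h: "h \<in> H" for h
  proof -
    have "T l h \<in> M \<longleftrightarrow> rep (rep \<one> \<otimes> T l h) = rep \<one>" for l
      using rep_mult[OF closed(3) TH[OF h, of l]] rep_eq[OF TH[OF h, of l] closed(3)] TH[OF h, of l]
      by (simp add: closed)
    then show ?thesis using same[OF h] rep(1)[OF closed(3)] by simp
  qed
  define k where "k = j - i"
  have aj: "a [^] j = a [^] i \<otimes> a [^] k" "a [^] j = a [^] k \<otimes> a [^] i"
    using \<open>i < j\<close> by (simp_all add: nat_pow_mult k_def)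
  have "a [^] k \<otimes> m \<otimes> inv (a [^] k) \<in> M \<and> inv (a [^] k) \<otimes> m \<otimes> a [^] k \<in> M" if m: "m \<in> M" for m
  proof
    have mH: "m \<in> H" and [simp]: "m \<in> carrier G" using m M(2) HC by auto
    have "T j (a [^] j \<otimes> m \<otimes> inv (a [^] j)) = m"
      by (simp add: T_def group_word_simps)
    moreover have "T i (a [^] j \<otimes> m \<otimes> inv (a [^] j)) = a [^] k \<otimes> m \<otimes> inv (a [^] k)"
      by (simp add: T_def aj(1) group_word_simps)
    ultimately show "a [^] k \<otimes> m \<otimes> inv (a [^] k) \<in> M"
      using iff[OF normalizing_conj(1)[OF an mH, of j]] m by simp
    have "T i (a [^] i \<otimes> m \<otimes> inv (a [^] i)) = m"
      by (simp add: T_def group_word_simps)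
    moreover have "T j (a [^] i \<otimes> m \<otimes> inv (a [^] i)) = inv (a [^] k) \<otimes> m \<otimes> a [^] k"
      by (simp add: T_def aj(1) group_word_simps)
    ultimately show "inv (a [^] k) \<otimes> m \<otimes> a [^] k \<in> M"
      using iff[OF normalizing_conj(1)[OF an mH, of i]] m by simp
  qed
  then have "a [^] k \<in> normalizing M" by (simp add: normalizing_def)
  moreover have "k > 0" using \<open>i < j\<close> by (simp add: k_def)
  ultimately show ?thesis by blast
qed

section \<open>Adjoining one element to a virtually separated group\<close>

definition cyclic_ext :: "'a set \<Rightarrow> 'a \<Rightarrow> 'a set"
  where "cyclic_ext H a = {h \<otimes> a [^] (k::int) | h k. h \<in> H}"

lemma cyclic_ext_subgroup:
  assumes H: "subgroup H G" and a: "a \<in> normalizing H"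
  shows "subgroup (cyclic_ext H a) G"
proof
  have HC: "H \<subseteq> carrier G" using H by (rule subgroup.subset)
  have aG [simp]: "a \<in> carrier G" using a by (simp add: normalizing_def)
  have ak: "a [^] k \<in> normalizing H" for k :: int
    by (rule subgroup_int_pow_closed[OF normalizing_subgroup[OF HC] a])
  show "cyclic_ext H a \<subseteq> carrier G" using HC by (auto simp: cyclic_ext_def)
  have "\<one> = \<one> \<otimes> a [^] (0::int)" by simp
  then show "\<one> \<in> cyclic_ext H a"
    using subgroup.one_closed[OF H] unfolding cyclic_ext_def by blast
  fix x assume "x \<in> cyclic_ext H a"
  then obtain h k where x: "x = h \<otimes> a [^] (k::int)" and h: "h \<in> H" by (auto simp: cyclic_ext_def)
  have hG [simp]: "h \<in> carrier G" using h HC by auto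
  have "inv x = (inv (a [^] k) \<otimes> inv h \<otimes> a [^] k) \<otimes> a [^] (- k)"
    by (simp add: x int_pow_neg group_word_simps)
  moreover have "inv (a [^] k) \<otimes> inv h \<otimes> a [^] k \<in> H"
    using normalizing_conj(2)[OF ak subgroup.m_inv_closed[OF H h]] .
  ultimately show "inv x \<in> cyclic_ext H a" unfolding cyclic_ext_def by blast
  fix y assume "y \<in> cyclic_ext H a"
  then obtain g l where y: "y = g \<otimes> a [^] (l::int)" and g: "g \<in> H" by (auto simp: cyclic_ext_def)
  have gG [simp]: "g \<in> carrier G" using g HC by auto
  have "x \<otimes> y = (h \<otimes> (a [^] k \<otimes> g \<otimes> inv (a [^] k))) \<otimes> a [^] (k + l)"
    by (simp add: x y int_pow_mult group_word_simps)
  moreover have "h \<otimes> (a [^] k \<otimes> g \<otimes> inv (a [^] k)) \<in> H"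
    by (rule subgroup.m_closed[OF H h normalizing_conj(1)[OF ak g]])
  ultimately show "x \<otimes> y \<in> cyclic_ext H a" unfolding cyclic_ext_def by blast
qed

lemma cyclic_ext_generate:
  assumes S: "S \<subseteq> carrier G" and H: "H = generate G S" and a: "a \<in> normalizing H"
  shows "cyclic_ext H a = generate G (insert a S)"
proof
  have HG: "subgroup H G" using generate_is_subgroup S H by simp
  have HC: "H \<subseteq> carrier G" using HG by (rule subgroup.subset)
  have aG: "a \<in> carrier G" using a by (simp add: normalizing_def)
  have gen: "subgroup (generate G (insert a S)) G" using S aG by (intro generate_is_subgroup) auto
  have "H \<subseteq> generate G (insert a S)" unfolding H by (intro mono_generate) auto
  then show "cyclic_ext H a \<subseteq> generate G (insert a S)"
    unfolding cyclic_ext_def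
    using subgroup.m_closed[OF gen] subgroup_int_pow_closed[OF gen generate.incl[of a "insert a S"]] by blast
  have "a = \<one> \<otimes> a [^] (1::int)" using aG by simp
  then have "a \<in> cyclic_ext H a"
    using subgroup.one_closed[OF HG] unfolding cyclic_ext_def by blast
  moreover have "s \<in> cyclic_ext H a" if "s \<in> S" for s
  proof -
    have "s = s \<otimes> a [^] (0::int)" "s \<in> H" using that S H by (auto intro: generate.incl)
    then show ?thesis unfolding cyclic_ext_def by blast
  qed
  ultimately show "generate G (insert a S) \<subseteq> cyclic_ext H a"
    by (intro generate_subgroup_incl cyclic_ext_subgroup[OF HG a]) auto
qed

definition virtually_sep :: "'a set \<Rightarrow> bool"
  where "virtually_sep H \<longleftrightarrow> (\<exists>M. subgroup M G \<and> M \<subseteq> H \<and> fin_index M H \<and> sep M)"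

text \<open>If a positive power of \<open>a\<close> lies in \<open>H\<close>, then \<open>H\<close>
  has finite index in the extension and \<open>M\<close> still serves. Otherwise some positive power
  \<open>b\<close> of \<open>a\<close> normalizes \<open>M\<close>, its nonzero powers avoid
  \<open>M\<close>, and \<open>sep_extend\<close> applies to \<open>M\<close> and
  \<open>b\<close>.\<close>

lemma virtually_sep_cyclic_ext:
  assumes nil: "lcs c = {\<one>}" "c > 0"
    and S: "finite S" "S \<subseteq> carrier G" and H: "H = generate G S"
    and vs: "virtually_sep H" and a: "a \<in> normalizing H"
  shows "virtually_sep (cyclic_ext H a)"
proof -
  obtain M where M: "subgroup M G" "M \<subseteq> H" "fin_index M H" "sep M"
    using vs unfolding virtually_sep_def by blast
  obtain R where R: "finite R" "R \<subseteq> H" "\<And>h. h \<in> H \<Longrightarrow> \<exists>r\<in>R. h \<otimes> inv r \<in> M"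
    using M(3) unfolding fin_index_def by blast
  have HG: "subgroup H G" using generate_is_subgroup S H by simp
  have HC: "H \<subseteq> carrier G" using HG by (rule subgroup.subset)
  have aG [simp]: "a \<in> carrier G" using a by (simp add: normalizing_def)
  have an: "a [^] k \<in> normalizing H" for k :: int
    by (rule subgroup_int_pow_closed[OF normalizing_subgroup[OF HC] a])
  \<comment> \<open>Representatives are \<open>r a^j\<close> with \<open>j\<close> a remainder
    modulo \<open>k\<close>; the multiple of \<open>k\<close> left in the exponent is absorbed by
    the hypothesis on \<open>M'\<close>, which is verified separately in both cases.\<close>
  have index: "fin_index M' (cyclic_ext H a)"
    if k: "k > 0" and M': "\<And>h q. h \<in> H \<Longrightarrow> \<exists>r\<in>R. h \<otimes> a [^] (int k * q) \<otimes> inv r \<in> M'" for k M'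
  proof -
    let ?R = "(\<lambda>(r, j). r \<otimes> a [^] (j::int)) ` (R \<times> {0..<int k})"
    have 1: "finite ?R" using R(1) by auto
    have 2: "?R \<subseteq> cyclic_ext H a" using R(2) by (auto simp: cyclic_ext_def)
    have 3: "\<exists>r\<in>?R. x \<otimes> inv r \<in> M'" if "x \<in> cyclic_ext H a" for x
    proof -
      obtain h i where x: "x = h \<otimes> a [^] (i::int)" and h: "h \<in> H" using \<open>x \<in> _\<close> by (auto simp: cyclic_ext_def)
      obtain r where r: "r \<in> R" "h \<otimes> a [^] (int k * (i div int k)) \<otimes> inv r \<in> M'" using M'[OF h] by blast
      have [simp]: "h \<in> carrier G" "r \<in> carrier G" using h r R(2) HC by auto
      have "a [^] i = a [^] (int k * (i div int k)) \<otimes> a [^] (i mod int k)"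
        by (simp add: int_pow_mult[symmetric])
      then have "x \<otimes> inv (r \<otimes> a [^] (i mod int k)) = h \<otimes> a [^] (int k * (i div int k)) \<otimes> inv r"
        by (simp add: x group_word_simps)
      then have "x \<otimes> inv (r \<otimes> a [^] (i mod int k)) \<in> M'" using r(2) by simp
      moreover have "r \<otimes> a [^] (i mod int k) \<in> ?R" using r k by auto
      ultimately show ?thesis by (rule bexI)
    qed
    show ?thesis unfolding fin_index_def by (intro exI[of _ ?R] conjI ballI 1 2 3)
  qed
  have sub: "H \<subseteq> cyclic_ext H a"
  proof
    fix h assume h: "h \<in> H"
    then have "h = h \<otimes> a [^] (0::int)" using HC by auto
    then show "h \<in> cyclic_ext H a" using h unfolding cyclic_ext_def by blast
  qed
  show ?thesis
  proof (cases "\<exists>k::nat. k > 0 \<and> a [^] k \<in> H")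
    case True
    then obtain k :: nat where k: "k > 0" "a [^] k \<in> H" by blast
    have ak: "a [^] (int k * q) \<in> H" for q :: int
      using subgroup_int_pow_closed[OF HG k(2), of q] by (simp add: int_pow_pow[symmetric] int_pow_int)
    have "\<exists>r\<in>R. h \<otimes> a [^] (int k * q) \<otimes> inv r \<in> M" if "h \<in> H" for h q
      by (rule R(3)[OF subgroup.m_closed[OF HG that ak]])
    then have "fin_index M (cyclic_ext H a)" by (rule index[OF k(1)])
    then show ?thesis using M sub unfolding virtually_sep_def by blast
  next
    case False
    obtain k :: nat where k: "k > 0" "a [^] k \<in> normalizing M"
      using power_normalizes_fin_index[OF S H M(1-3) a] by blast
    define b where "b = a [^] k"
    have bG [simp]: "b \<in> carrier G" by (simp add: b_def)
    have bq: "b [^] q = a [^] (int k * q)" for q :: int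
      by (simp add: b_def int_pow_pow[symmetric] int_pow_int)
    have bn: "b \<in> normalizing M" using k(2) by (simp add: b_def)
    have bqn: "b [^] q \<in> normalizing M" for q :: int
      by (rule subgroup_int_pow_closed[OF normalizing_subgroup[OF subgroup.subset[OF M(1)]] bn])
    have free: "b [^] q \<notin> M" if "q \<noteq> 0" for q :: int
    proof
      assume "b [^] q \<in> M"
      then have 1: "a [^] (int k * q) \<in> H" using M(2) bq by auto
      then have "inv (a [^] (int k * q)) \<in> H" by (rule subgroup.m_inv_closed[OF HG])
      then have 2: "a [^] (- (int k * q)) \<in> H" by (simp add: int_pow_neg)
      have "a [^] \<bar>int k * q\<bar> \<in> H"
        using 1 2 by (cases "int k * q \<ge> 0") (simp_all only: abs_of_nonneg abs_of_neg not_le)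
      then have "a [^] nat \<bar>int k * q\<bar> \<in> H"
        using int_pow_int[of G a "nat \<bar>int k * q\<bar>"] by simp
      moreover have "nat \<bar>int k * q\<bar> > 0" using k that by simp
      ultimately show False using False by blast
    qed
    have "sep (cyclic_ext M b)"
      unfolding cyclic_ext_def by (rule sep_extend[OF nil M(1) bn free M(4)])
    moreover have "cyclic_ext M b \<subseteq> cyclic_ext H a"
      using M(2) unfolding cyclic_ext_def bq by blast
    moreover have "\<exists>r\<in>R. h \<otimes> a [^] (int k * q) \<otimes> inv r \<in> cyclic_ext M b" if h: "h \<in> H" for h q
    proof -
      \<comment> \<open>With \<open>h'\<close> this conjugate,
        \<open>h a^(k q) = a^(k q) h'\<close>. The representative is chosen for \<open>h'\<close>,
        so that \<open>h' r^-1\<close> lies in \<open>M\<close> and the power of \<open>b\<close>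
        can be moved back to its right.\<close>
      let ?h = "inv (a [^] (int k * q)) \<otimes> h \<otimes> a [^] (int k * q)"
      obtain r where r: "r \<in> R" "?h \<otimes> inv r \<in> M" using R(3) normalizing_conj(2)[OF an h] by blast
      have [simp]: "h \<in> carrier G" "r \<in> carrier G" using h r R(2) HC by auto
      have "h \<otimes> a [^] (int k * q) \<otimes> inv r = (b [^] q \<otimes> (?h \<otimes> inv r) \<otimes> inv (b [^] q)) \<otimes> b [^] q"
        by (simp add: bq group_word_simps)
      moreover have "b [^] q \<otimes> (?h \<otimes> inv r) \<otimes> inv (b [^] q) \<in> M"
        using normalizing_conj(1)[OF bqn r(2)] .
      ultimately have "h \<otimes> a [^] (int k * q) \<otimes> inv r \<in> cyclic_ext M b"
        unfolding cyclic_ext_def by blast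
      then show ?thesis using r(1) by blast
    qed
    then have "fin_index (cyclic_ext M b) (cyclic_ext H a)" by (rule index[OF k(1)])
    ultimately show ?thesis
      using cyclic_ext_subgroup[OF M(1) bn] unfolding virtually_sep_def by blast
  qed
qed

text \<open>\<open>k h k^-1 = [k, h] h\<close>, and the commutator already lies in \<open>H\<close>.
  Generators of one term over the next can therefore be adjoined one at a time.\<close>

lemma lcs_between_normalizing:
  assumes H: "subgroup H G" "lcs (Suc i) \<subseteq> H" "H \<subseteq> lcs i"
  shows "carrier G \<subseteq> normalizing H"
proof
  fix g assume g: "g \<in> carrier G"
  have conj: "k \<otimes> h \<otimes> inv k \<in> H" if k: "k \<in> carrier G" and h: "h \<in> H" for k h
  proof -
    have [simp]: "h \<in> carrier G" using h subgroup.subset[OF H(1)] by auto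
    have "k \<otimes> h \<otimes> inv k \<otimes> inv h \<in> H" using lcs_commutator'[of h i k] k h H by auto
    then have "(k \<otimes> h \<otimes> inv k \<otimes> inv h) \<otimes> h \<in> H" using h by (rule subgroup.m_closed[OF H(1)])
    then show ?thesis using k by (simp add: group_word_simps)
  qed
  show "g \<in> normalizing H"
    using conj[OF g] conj[of "inv g"] g by (simp add: normalizing_def)
qed

text \<open>The identities \<open>[a, x y] = [a, x] (x [a, y] x^-1)\<close> and
  \<open>[x y, k] = (x [y, k] x^-1) [x, k]\<close> reduce all commutators to those of generators.
  The conjugations do no harm, because \<open>H\<close> lies between consecutive terms and so is
  normal.\<close>

lemma lcs_finitely_generated_mod:
  assumes X: "finite X" "X \<subseteq> carrier G" "generate G X = carrier G"
  shows "\<exists>A. finite A \<and> A \<subseteq> lcs i \<and> lcs i = generate G (A \<union> lcs (Suc i))"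
proof (induction i)
  case 0
  have "generate G X \<subseteq> generate G (X \<union> lcs (Suc 0))" by (intro mono_generate) auto
  moreover have "generate G (X \<union> lcs (Suc 0)) \<subseteq> carrier G"
    using X lcs_subset[of "Suc 0"] by (intro generate_incl) auto
  ultimately show ?case using X by (intro exI[of _ X]) auto
next
  case (Suc i)
  then obtain A where A: "finite A" "A \<subseteq> lcs i" "lcs i = generate G (A \<union> lcs (Suc i))" by blast
  let ?comm = "\<lambda>h k. h \<otimes> k \<otimes> inv h \<otimes> inv k"
  define B where "B = (\<lambda>(a, x). ?comm a x) ` (A \<times> X)"
  define H where "H = generate G (B \<union> lcs (Suc (Suc i)))"
  have B_mem: "?comm a x \<in> B" if "a \<in> A" "x \<in> X" for a x
    unfolding B_def by (rule image_eqI[of _ _ "(a, x)"]) (use that in auto)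
  have fB: "finite B" using A(1) X(1) by (simp add: B_def)
  have BS: "B \<subseteq> lcs (Suc i)"
    using A(2) X(2) by (auto simp: B_def intro!: lcs_commutator)
  have HG: "subgroup H G"
    unfolding H_def using BS lcs_subset by (intro generate_is_subgroup) blast
  have HS: "H \<subseteq> lcs (Suc i)"
    unfolding H_def using BS lcs_decreasing by (intro generate_subgroup_incl lcs_subgroup) blast
  have HL: "lcs (Suc (Suc i)) \<subseteq> H" unfolding H_def by (auto intro: generate.incl)
  note closed = subgroup.m_closed[OF HG] subgroup.m_inv_closed[OF HG] subgroup.one_closed[OF HG]
  have Hn: "g \<in> normalizing H" if "g \<in> carrier G" for g
    using lcs_between_normalizing[OF HG HL HS] that by auto
  note conj = normalizing_conj[OF Hn]
  have liG: "h \<in> carrier G" if "h \<in> lcs i" for h using that lcs_subset by auto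
  have twist: "g \<otimes> h \<otimes> inv g \<in> H" "inv g \<otimes> inv h \<otimes> g \<in> H" if "g \<in> carrier G" "h \<in> H" for g h
    using that conj[of g] closed(2)[of h] by auto
  have A_in: "?comm a k \<in> H" if a: "a \<in> A" and k: "k \<in> carrier G" for a k
  proof -
    have aG [simp]: "a \<in> carrier G" using a A(2) liG by auto
    have "k \<in> generate G X" using k X by simp
    then show ?thesis
    proof (induction k rule: generate.induct)
      case one
      then show ?case using closed by simp
    next
      case (incl x)
      then have "?comm a x \<in> B" using a by (intro B_mem)
      then show ?case unfolding H_def by (auto intro: generate.incl)
    next
      case (inv x)
      then have "?comm a x \<in> B" using a by (intro B_mem)
      then have "?comm a x \<in> H" unfolding H_def by (auto intro: generate.incl)
      moreover have x: "x \<in> carrier G" using inv X by auto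
      ultimately have "inv x \<otimes> inv (?comm a x) \<otimes> x \<in> H" by (intro twist)
      then show ?case using x by (simp add: group_word_simps)
    next
      case (eng x y)
      have x: "x \<in> carrier G" "y \<in> carrier G" using eng generate_in_carrier[OF X(2)] by auto
      have "?comm a x \<otimes> (x \<otimes> ?comm a y \<otimes> inv x) \<in> H"
        by (rule closed(1)[OF eng.IH(1) twist(1)[OF x(1) eng.IH(2)]])
      then show ?case using x by (simp add: group_word_simps)
    qed
  qed
  have all: "?comm h k \<in> H" if h: "h \<in> lcs i" and k: "k \<in> carrier G" for h k
  proof -
    have G: "A \<union> lcs (Suc i) \<subseteq> carrier G" using A(2) lcs_subset by blast
    have base: "?comm x k \<in> H" if "x \<in> A \<union> lcs (Suc i)" for x
      using that A_in[OF _ k] lcs_commutator[OF _ k] HL by blast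
    show ?thesis
      using h unfolding A(3)
    proof (induction h rule: generate.induct)
      case one
      then show ?case using closed k by simp
    next
      case (incl x)
      then show ?case by (rule base)
    next
      case (inv x)
      have x: "x \<in> carrier G" using inv G by auto
      then have "inv x \<otimes> inv (?comm x k) \<otimes> x \<in> H" using base[OF inv] by (intro twist)
      then show ?case using x k by (simp add: group_word_simps)
    next
      case (eng x y)
      have x: "x \<in> carrier G" "y \<in> carrier G" using eng generate_in_carrier[OF G] by auto
      have "(x \<otimes> ?comm y k \<otimes> inv x) \<otimes> ?comm x k \<in> H"
        by (rule closed(1)[OF twist(1)[OF x(1) eng.IH(2)] eng.IH(1)])
      then show ?case using x k by (simp add: group_word_simps)
    qed
  qed
  have "lcs (Suc i) \<subseteq> H"
    unfolding lcs_Suc[of i] using all by (intro generate_subgroup_incl[OF _ HG]) auto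
  then show ?case using HS fB BS unfolding H_def by blast
qed

text \<open>Downward from the trivial term \<open>lcs c\<close>, adjoining a finite set one element
  at a time. Finite generation is carried along because normalizing a subgroup of finite index by a
  power depends on it.\<close>

lemma virtually_sep_lcs:
  assumes nil: "lcs c = {\<one>}" "c > 0"
    and X: "finite X" "X \<subseteq> carrier G" "generate G X = carrier G"
  shows "i \<le> c \<Longrightarrow> \<exists>S. finite S \<and> S \<subseteq> carrier G \<and> lcs i = generate G S \<and> virtually_sep (lcs i)"
proof (induction i rule: inc_induct)
  case base
  have "fin_index {\<one>} {\<one>}" unfolding fin_index_def by (intro exI[of _ "{\<one>}"]) auto
  then have "virtually_sep {\<one>}" using sep_trivial triv_subgroup unfolding virtually_sep_def by blast
  moreover have "generate G {} = {\<one>}" by (rule generate_empty)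
  ultimately show ?case using nil by (intro exI[of _ "{}"]) auto
next
  case (step i)
  obtain S where S: "finite S" "S \<subseteq> carrier G" "lcs (Suc i) = generate G S" "virtually_sep (lcs (Suc i))"
    using step by blast
  obtain A where A: "finite A" "A \<subseteq> lcs i" "lcs i = generate G (A \<union> lcs (Suc i))"
    using lcs_finitely_generated_mod[OF X] by blast
  have AG: "A \<subseteq> carrier G" using A(2) lcs_subset by blast
  have SL: "S \<subseteq> lcs (Suc i)" using S(3) by (auto intro: generate.incl)
  have sub: "subgroup (generate G (A' \<union> S)) G" "lcs (Suc i) \<subseteq> generate G (A' \<union> S)"
    "generate G (A' \<union> S) \<subseteq> lcs i" if "A' \<subseteq> A" for A'
  proof -
    have "A' \<union> S \<subseteq> carrier G" using that AG S(2) by auto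
    then show "subgroup (generate G (A' \<union> S)) G" by (rule generate_is_subgroup)
    show "lcs (Suc i) \<subseteq> generate G (A' \<union> S)" unfolding S(3) by (intro mono_generate) auto
    show "generate G (A' \<union> S) \<subseteq> lcs i"
      using that A(2) SL lcs_decreasing by (intro generate_subgroup_incl lcs_subgroup) blast
  qed
  have "virtually_sep (generate G (A' \<union> S))" if "A' \<subseteq> A" for A'
    using finite_subset[OF that A(1)] that
  proof (induction A' rule: finite_induct)
    case empty
    then show ?case using S by simp
  next
    case (insert a A')
    have a: "a \<in> normalizing (generate G (A' \<union> S))"
      using lcs_between_normalizing[OF sub[of A']] insert AG by auto
    have AS: "A' \<union> S \<subseteq> carrier G" "finite (A' \<union> S)" using insert AG S by auto
    show ?case
      using virtually_sep_cyclic_ext[OF nil AS(2,1) refl _ a] cyclic_ext_generate[OF AS(1) refl a] insert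
      by simp
  qed
  from this[of A] have "virtually_sep (generate G (A \<union> S))" by simp
  moreover have "generate G (A \<union> S) = lcs i"
  proof
    show "generate G (A \<union> S) \<subseteq> lcs i" using sub by simp
    have "A \<union> lcs (Suc i) \<subseteq> generate G (A \<union> S)" using sub(2)[of A] by (auto intro: generate.incl)
    then show "lcs i \<subseteq> generate G (A \<union> S)"
      unfolding A(3) by (rule generate_subgroup_incl) (use sub in simp)
  qed
  ultimately show ?case using A(1) AG S by (intro exI[of _ "A \<union> S"]) auto
qed

lemma nilpotent_virtually_sep:
  assumes "nilpotent_group G" and X: "finite X" "X \<subseteq> carrier G" "generate G X = carrier G"
  shows "virtually_sep (carrier G)"
proof -
  obtain c where c: "lcs c = {\<one>}" using assms(1) unfolding nilpotent_group_def by blast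
  \<comment> \<open>Passing from \<open>c\<close> to \<open>Suc c\<close> provides the positive
    index that the weighted bounds require.\<close>
  have "\<one> \<in> lcs (Suc c)" using subgroup.one_closed[OF lcs_subgroup] .
  then have "lcs (Suc c) = {\<one>}" using lcs_decreasing[of c] c by auto
  from virtually_sep_lcs[OF this _ X, of 0] show ?thesis by auto
qed

end

section \<open>Faithful integer unitriangular representations\<close>

lemma common_denominator:
  "finite (A :: rat set) \<Longrightarrow> \<exists>d::int. d > 0 \<and> (\<forall>q\<in>A. of_int d * q \<in> \<int>)"
proof (induction A rule: finite_induct)
  case (insert q A)
  obtain d :: int where d: "d > 0" "\<forall>q\<in>A. of_int d * q \<in> \<int>" using insert by blast
  obtain a b where ab: "quotient_of q = (a, b)" by fastforce
  have b: "b > 0" using quotient_of_denom_pos[OF ab] .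
  have q: "q = of_int a / of_int b" using quotient_of_div[OF ab] .
  have "of_int (b * d) * q = of_int (d * a)" using b by (simp add: q)
  then have "of_int (b * d) * q \<in> \<int>" by (simp only: Ints_of_int)
  moreover have "of_int (b * d) * p \<in> \<int>" if "p \<in> A" for p
  proof -
    have "of_int b * (of_int d * p) \<in> \<int>" by (rule Ints_mult[OF Ints_of_int bspec[OF d(2) that]])
    then show ?thesis by (simp only: of_int_mult mult.assoc)
  qed
  ultimately show ?case using b d(1) by (intro exI[of _ "b * d"]) auto
qed (auto intro: exI[of _ 1])

context group
begin

section \<open>Products of words and polynomial functions on submonoids\<close>

definition mprod :: "'a list \<Rightarrow> 'a" where "mprod ws = foldr (\<otimes>) ws \<one>"

lemma mprod_simps [simp]: "mprod [] = \<one>" "mprod (w # ws) = w \<otimes> mprod ws"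
  by (simp_all add: mprod_def)

lemma mprod_closed [simp]: "set ws \<subseteq> carrier G \<Longrightarrow> mprod ws \<in> carrier G"
  by (induction ws) auto

lemma mprod_append:
  "set us \<subseteq> carrier G \<Longrightarrow> set ws \<subseteq> carrier G \<Longrightarrow> mprod (us @ ws) = mprod us \<otimes> mprod ws"
  by (induction us) (auto simp: m_assoc)

lemma mprod_in_subgroup: "subgroup H G \<Longrightarrow> set ws \<subseteq> H \<Longrightarrow> mprod ws \<in> H"
  by (induction ws) (auto simp: subgroup.one_closed subgroup.m_closed)

text \<open>No inverses occur: the first pass emits products of elements of one finite set, and only
  these have to be represented.\<close>

definition submonoid_gen :: "'a set \<Rightarrow> 'a set" where "submonoid_gen S = mprod ` lists S"

lemma submonoid_gen_subset: "S \<subseteq> carrier G \<Longrightarrow> submonoid_gen S \<subseteq> carrier G"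
  by (auto simp: submonoid_gen_def in_lists_conv_set intro!: mprod_closed)

lemma submonoid_gen_mult_closed:
  assumes "S \<subseteq> carrier G" shows "mult_closed (submonoid_gen S)"
proof -
  have "mprod us \<otimes> mprod ws \<in> submonoid_gen S" if "us \<in> lists S" "ws \<in> lists S" for us ws
  proof -
    have "mprod us \<otimes> mprod ws = mprod (us @ ws)" using that assms by (subst mprod_append) auto
    moreover have "us @ ws \<in> lists S" using that by simp
    ultimately show ?thesis unfolding submonoid_gen_def by blast
  qed
  moreover have "\<one> \<in> submonoid_gen S"
    unfolding submonoid_gen_def by (rule image_eqI[of _ _ "[]"]) auto
  ultimately show ?thesis unfolding mult_closed_def submonoid_gen_def by blast
qed

text \<open>The difference along a generator has lower degree and vanishes on words shorter by one,
  hence everywhere by induction. So \<open>f\<close> does not change when a letter is prepended, and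
  its value at 1 is 0. This makes the space of such functions finite-dimensional when
  \<open>S\<close> is finite.\<close>

lemma pol_determined:
  assumes S: "S \<subseteq> carrier G"
  shows "pol (submonoid_gen S) e f \<Longrightarrow> (\<And>ws. ws \<in> lists S \<Longrightarrow> length ws < e \<Longrightarrow> f (mprod ws) = 0) \<Longrightarrow>
    ws \<in> lists S \<Longrightarrow> f (mprod ws) = 0"
proof (induction e arbitrary: f ws)
  case 0
  then show ?case by (auto simp: submonoid_gen_def)
next
  case (Suc e)
  have shift: "f (s \<otimes> mprod us) = f (mprod us)" if s: "s \<in> S" and us: "us \<in> lists S" for s us
  proof -
    have "s = mprod [s]" "[s] \<in> lists S" using s S by auto
    then have "s \<in> submonoid_gen S" unfolding submonoid_gen_def by (rule image_eqI)
    then have "pol (submonoid_gen S) e (\<lambda>x. f (s \<otimes> x) - f x)" using Suc.prems(1) by simp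
    moreover have "f (s \<otimes> mprod vs) - f (mprod vs) = 0" if "vs \<in> lists S" "length vs < e" for vs
      using Suc.prems(2)[of "s # vs"] Suc.prems(2)[of vs] that s by simp
    ultimately have "f (s \<otimes> mprod us) - f (mprod us) = 0"
      by (rule Suc.IH) (use us in auto)
    then show ?thesis by simp
  qed
  show ?case using Suc.prems(3)
  proof (induction ws)
    case Nil
    then show ?case using Suc.prems(2)[of "[]"] by simp
  next
    case (Cons s us)
    then show ?case using shift[of s us] by simp
  qed
qed

section \<open>Linear spans and flags of functions\<close>

definition lspan :: "'a set \<Rightarrow> nat \<Rightarrow> (nat \<Rightarrow> 'a \<Rightarrow> rat) \<Rightarrow> ('a \<Rightarrow> rat) \<Rightarrow> bool"
  where "lspan N r F f \<longleftrightarrow> (\<exists>c. \<forall>x\<in>N. f x = (\<Sum>j<r. c j * F j x))"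

lemma lspan_cong: "(\<And>x. x \<in> N \<Longrightarrow> f x = g x) \<Longrightarrow> lspan N r F f \<longleftrightarrow> lspan N r F g"
  by (simp add: lspan_def)

lemma lspan_zero: "(\<And>x. x \<in> N \<Longrightarrow> f x = 0) \<Longrightarrow> lspan N r F f"
  unfolding lspan_def by (intro exI[of _ "\<lambda>_. 0"]) simp

lemma lspan_add: "lspan N r F f \<Longrightarrow> lspan N r F g \<Longrightarrow> lspan N r F (\<lambda>x. f x + g x)"
  unfolding lspan_def
proof (elim exE)
  fix c d assume "\<forall>x\<in>N. f x = (\<Sum>j<r. c j * F j x)" "\<forall>x\<in>N. g x = (\<Sum>j<r. d j * F j x)"
  then show "\<exists>c. \<forall>x\<in>N. f x + g x = (\<Sum>j<r. c j * F j x)"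
    by (intro exI[of _ "\<lambda>j. c j + d j"]) (simp add: sum.distrib distrib_right)
qed

lemma lspan_scale: "lspan N r F f \<Longrightarrow> lspan N r F (\<lambda>x. a * f x)"
  unfolding lspan_def
proof (elim exE)
  fix c assume "\<forall>x\<in>N. f x = (\<Sum>j<r. c j * F j x)"
  then show "\<exists>c. \<forall>x\<in>N. a * f x = (\<Sum>j<r. c j * F j x)"
    by (intro exI[of _ "\<lambda>j. a * c j"]) (simp add: sum_distrib_left mult.assoc)
qed

lemma lspan_diff: "lspan N r F f \<Longrightarrow> lspan N r F g \<Longrightarrow> lspan N r F (\<lambda>x. f x - g x)"
  using lspan_add[of N r F f "\<lambda>x. - 1 * g x"] lspan_scale[of N r F g "- 1"] by simp

lemma lspan_sum: "(\<And>i. i \<in> I \<Longrightarrow> lspan N r F (f i)) \<Longrightarrow> lspan N r F (\<lambda>x. \<Sum>i\<in>I. f i x)"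
  by (induction I rule: infinite_finite_induct) (auto intro: lspan_zero lspan_add)

lemma lspan_mono: "lspan N i F f \<Longrightarrow> i \<le> r \<Longrightarrow> lspan N r F f"
  unfolding lspan_def
proof (elim exE)
  fix c assume c: "\<forall>x\<in>N. f x = (\<Sum>j<i. c j * F j x)" and "i \<le> r"
  have "(\<Sum>j<r. (if j < i then c j else 0) * F j x) = (\<Sum>j<i. c j * F j x)" for x
    using \<open>i \<le> r\<close> by (intro sum.mono_neutral_cong_right) auto
  then show "\<exists>c. \<forall>x\<in>N. f x = (\<Sum>j<r. c j * F j x)"
    using c by (intro exI[of _ "\<lambda>j. if j < i then c j else 0"]) simp
qed

lemma lspan_base: "i < r \<Longrightarrow> lspan N r F (F i)"
proof -
  assume "i < r"
  have "F i x = (\<Sum>j<r. (if j = i then 1 else 0) * F j x)" for x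
    using \<open>i < r\<close> by (subst sum.mono_neutral_cong_right[of _ "{i}" _ "\<lambda>j. F j x"]) auto
  then show ?thesis unfolding lspan_def by (intro exI[of _ "\<lambda>j. if j = i then 1 else 0"] ballI)
qed

text \<open>The evaluation points \<open>X i\<close> make the matrix \<open>F i (X j)\<close> triangular; this keeps the functions
  \<open>F i\<close> linearly independent and bounds their number.\<close>

definition flag :: "'a set \<Rightarrow> nat \<Rightarrow> 'a set \<Rightarrow> nat \<Rightarrow> (nat \<Rightarrow> 'a \<Rightarrow> rat) \<Rightarrow> (nat \<Rightarrow> 'a) \<Rightarrow> bool"
  where "flag N e W r F X \<longleftrightarrow> (\<forall>i<r. pol N e (F i) \<and> X i \<in> W \<and> F i (X i) \<noteq> 0 \<and>
    (\<forall>j<i. F i (X j) = 0) \<and> (\<forall>n\<in>N. lspan N i F (\<lambda>x. F i (n \<otimes> x) - F i x)))"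

lemma flag_length: "flag N e W r F X \<Longrightarrow> finite W \<Longrightarrow> r \<le> card W"
proof -
  assume f: "flag N e W r F X" and W: "finite W"
  have "X i \<noteq> X j" if "j < i" "i < r" for i j
    using f that unfolding flag_def by metis
  then have "inj_on X {..<r}" by (intro inj_onI) (metis lessThan_iff nat_neq_iff)
  moreover have "X ` {..<r} \<subseteq> W" using f by (auto simp: flag_def)
  ultimately show ?thesis using card_inj_on_le[of X "{..<r}" W] W by simp
qed

text \<open>Forward substitution in a triangular system: adding \<open>F r\<close> leaves the values
  at the earlier points unchanged.\<close>

lemma flag_reduce:
  "flag N e W r F X \<Longrightarrow> \<exists>c. \<forall>j<r. f (X j) = (\<Sum>i<r. c i * F i (X j))"
proof (induction r)
  case (Suc r)
  have "flag N e W r F X" using Suc.prems by (simp add: flag_def)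
  then obtain c where c: "\<forall>j<r. f (X j) = (\<Sum>i<r. c i * F i (X j))" using Suc.IH by blast
  have r: "F r (X r) \<noteq> 0" "\<And>j. j < r \<Longrightarrow> F r (X j) = 0"
    using Suc.prems by (auto simp: flag_def)
  define c' where "c' = c(r := (f (X r) - (\<Sum>i<r. c i * F i (X r))) / F r (X r))"
  have s: "(\<Sum>i<r. c' i * F i x) = (\<Sum>i<r. c i * F i x)" for x
    by (intro sum.cong) (auto simp: c'_def)
  have "f (X j) = (\<Sum>i<Suc r. c' i * F i (X j))" if "j < Suc r" for j
    using that c r by (cases "j = r") (simp_all add: s c'_def less_Suc_eq)
  then show ?case by blast
qed simp

lemma flag_independent:
  assumes f: "flag N e W r F X" and W: "W \<subseteq> N" and z: "\<And>x. x \<in> N \<Longrightarrow> (\<Sum>i<r. c i * F i x) = 0"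
  shows "j < r \<Longrightarrow> c j = 0"
proof (induction j rule: less_induct)
  case (less j)
  have "(\<Sum>i<r. c i * F i (X j)) = (\<Sum>i\<in>{j}. c i * F i (X j))"
  proof (rule sum.mono_neutral_right)
    show "\<forall>i\<in>{..<r} - {j}. c i * F i (X j) = 0"
    proof
      fix i assume i: "i \<in> {..<r} - {j}"
      show "c i * F i (X j) = 0"
      proof (cases "i < j")
        case True
        then show ?thesis using less by simp
      next
        case False
        then have "F i (X j) = 0" using i f by (auto simp: flag_def)
        then show ?thesis by simp
      qed
    qed
  qed (use less in auto)
  moreover have "X j \<in> N" "F j (X j) \<noteq> 0" using f less W by (auto simp: flag_def)
  ultimately show ?case using z[of "X j"] by simp
qed

text \<open>A flag of maximal length spans. Otherwise take a function outside the span of least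
  degree; its differences have lower degree and lie in the span. After subtracting a combination
  that matches it at the points of the flag, it is still nonzero somewhere on \<open>W\<close> by
  \<open>det\<close> and prolongs the flag.\<close>

lemma flag_exists:
  assumes N: "mult_closed N" and W: "finite W" "W \<subseteq> N"
    and det: "\<And>f. pol N e f \<Longrightarrow> (\<And>x. x \<in> W \<Longrightarrow> f x = 0) \<Longrightarrow> (\<And>x. x \<in> N \<Longrightarrow> f x = 0)"
  shows "\<exists>r F X. flag N e W r F X \<and> (\<forall>f. pol N e f \<longrightarrow> lspan N r F f)"
proof -
  let ?A = "{r. \<exists>F X. flag N e W r F X}"
  have fin: "finite ?A" by (rule finite_subset[of _ "{..card W}"]) (auto dest: flag_length[OF _ W(1)])
  have "0 \<in> ?A" by (simp add: flag_def)
  then have "Max ?A \<in> ?A" using Max_in[OF fin] by auto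
  then obtain r F X where r: "r = Max ?A" and fl: "flag N e W r F X" by blast
  have maximal: "\<not> flag N e W (Suc r) F' X'" for F' X'
    using Max_ge[OF fin, of "Suc r"] r by auto
  have "lspan N r F f" if f: "pol N e f" for f
  proof (rule ccontr)
    assume ns: "\<not> lspan N r F f"
    let ?P = "\<lambda>k. \<exists>f. pol N k f \<and> \<not> lspan N r F f"
    define k where "k = (LEAST k. ?P k)"
    have Pe: "?P e" using f ns by blast
    have Pk: "?P k" unfolding k_def by (rule LeastI[of ?P, OF Pe])
    have "k \<le> e" unfolding k_def by (rule Least_le[of ?P, OF Pe])
    obtain g where g: "pol N k g" "\<not> lspan N r F g" using Pk by blast
    obtain k' where k': "k = Suc k'" using g by (cases k) (auto simp: lspan_zero)
    have below: "lspan N r F h" if "pol N k' h" for h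
      using not_less_Least[of k' ?P] that unfolding k_def[symmetric] k' by blast
    obtain c where c: "\<forall>j<r. g (X j) = (\<Sum>i<r. c i * F i (X j))" using flag_reduce[OF fl] by blast
    define h where "h x = g x - (\<Sum>i<r. c i * F i x)" for x
    have hX: "h (X j) = 0" if "j < r" for j using c that by (simp add: h_def)
    have polF: "pol N e (F i)" if "i < r" for i using fl that by (simp add: flag_def)
    have hp: "pol N e h"
      unfolding h_def using polF
      by (intro pol_diff pol_sum[OF N] pol_scale pol_mono[OF g(1) N \<open>k \<le> e\<close>]) auto
    have spF: "lspan N r F (\<lambda>x. \<Sum>i<r. c i * F i x)"
      by (intro lspan_sum lspan_scale lspan_base) auto
    have "\<not> (\<forall>x\<in>N. h x = 0)"
    proof
      assume "\<forall>x\<in>N. h x = 0"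
      then have "lspan N r F g \<longleftrightarrow> lspan N r F (\<lambda>x. \<Sum>i<r. c i * F i x)"
        by (intro lspan_cong) (simp add: h_def)
      then show False using spF g by simp
    qed
    then obtain x where x: "x \<in> W" "h x \<noteq> 0" using det[OF hp] by blast
    have hn: "lspan N r F (\<lambda>x. h (n \<otimes> x) - h x)" if n: "n \<in> N" for n
    proof -
      have "pol N k' (\<lambda>x. g (n \<otimes> x) - g x)" using g(1) n by (simp add: k')
      then have 1: "lspan N r F (\<lambda>x. g (n \<otimes> x) - g x)" by (rule below)
      have "lspan N r F (\<lambda>x. F i (n \<otimes> x) - F i x)" if "i < r" for i
        using fl that n lspan_mono[of N i F _ r] by (simp add: flag_def)
      then have 2: "lspan N r F (\<lambda>x. \<Sum>i<r. c i * (F i (n \<otimes> x) - F i x))"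
        by (intro lspan_sum lspan_scale) auto
      have "(\<lambda>x. h (n \<otimes> x) - h x) =
        (\<lambda>x. (g (n \<otimes> x) - g x) - (\<Sum>i<r. c i * (F i (n \<otimes> x) - F i x)))"
        by (simp add: h_def fun_eq_iff right_diff_distrib sum_subtractf)
      then show ?thesis using lspan_diff[OF 1 2] by simp
    qed
    have same: "lspan N i (F(r := h)) f = lspan N i F f" if "i \<le> r" for i f
    proof -
      have "(\<Sum>j<i. c j * (F(r := h)) j x) = (\<Sum>j<i. c j * F j x)" for c x
        using that by (intro sum.cong) auto
      then show ?thesis unfolding lspan_def by simp
    qed
    have "flag N e W (Suc r) (F(r := h)) (X(r := x))"
      unfolding flag_def
    proof (intro allI impI)
      fix i assume "i < Suc r"
      then consider "i < r" | "i = r" by linarith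
      then show "pol N e ((F(r := h)) i) \<and> (X(r := x)) i \<in> W \<and> (F(r := h)) i ((X(r := x)) i) \<noteq> 0 \<and>
        (\<forall>j<i. (F(r := h)) i ((X(r := x)) j) = 0) \<and>
        (\<forall>n\<in>N. lspan N i (F(r := h)) (\<lambda>x. (F(r := h)) i (n \<otimes> x) - (F(r := h)) i x))"
      proof cases
        case 1
        then show ?thesis using fl same[of i] by (simp add: flag_def)
      next
        case 2
        then show ?thesis using hp x hX hn same[of r] by simp
      qed
    qed
    then show False using maximal by blast
  qed
  then show ?thesis using fl by blast
qed

text \<open>The submonoid acts on its polynomial functions of bounded degree by translating the
  argument. In the basis given by a flag the matrices are unitriangular; linear independence makes
  them multiplicative, and separation makes the action faithful.\<close>

lemma unitriangular_representation:
  assumes S: "finite S" "S \<subseteq> carrier G" and sep: "sep (submonoid_gen S)"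
  obtains r \<mu> where "\<mu> ` S \<subseteq> UT r"
    and "\<And>ws. ws \<in> lists S \<Longrightarrow> mprod ws = \<one> \<longleftrightarrow> ut_prod (map \<mu> ws) = ut_one"
proof -
  define N where "N = submonoid_gen S"
  have N: "mult_closed N" "N \<subseteq> carrier G"
    using submonoid_gen_mult_closed submonoid_gen_subset S by (auto simp: N_def)
  have one: "\<one> \<in> N" using N by (simp add: mult_closed_def)
  obtain e where e: "\<And>g. g \<in> N \<Longrightarrow> (\<And>f. pol N e f \<Longrightarrow> f g = f \<one>) \<Longrightarrow> g = \<one>"
    using sep unfolding sep_def N_def by auto
  define W where "W = mprod ` {ws. set ws \<subseteq> S \<and> length ws \<le> e}"
  have W: "finite W" "W \<subseteq> N"
    using finite_lists_length_le[OF S(1)] by (auto simp: W_def N_def submonoid_gen_def)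
  have "f x = 0" if f: "pol N e f" and fW: "\<And>x. x \<in> W \<Longrightarrow> f x = 0" and x: "x \<in> N" for f x
  proof -
    obtain ws where ws: "ws \<in> lists S" "x = mprod ws" using x by (auto simp: N_def submonoid_gen_def)
    have "f (mprod us) = 0" if "us \<in> lists S" "length us < e" for us
      using that by (intro fW) (auto simp: W_def in_lists_conv_set)
    then show ?thesis
      using pol_determined[OF S(2) f[unfolded N_def] _ ws(1)] ws(2) by blast
  qed
  then obtain r F X where fl: "flag N e W r F X" and span: "\<And>f. pol N e f \<Longrightarrow> lspan N r F f"
    using flag_exists[OF N(1) W, of e] by blast
  note indep = flag_independent[OF fl W(2)]
  have ex: "\<exists>c. (\<forall>x\<in>N. F i (n \<otimes> x) = (\<Sum>j<r. c j * F j x)) \<and> c i = 1 \<and> (\<forall>j>i. c j = 0)"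
    if i: "i < r" and n: "n \<in> N" for i n
  proof -
    have "lspan N i F (\<lambda>x. F i (n \<otimes> x) - F i x)" using fl i n by (simp add: flag_def)
    then obtain c where c: "\<forall>x\<in>N. F i (n \<otimes> x) - F i x = (\<Sum>j<i. c j * F j x)"
      unfolding lspan_def by blast
    let ?c = "\<lambda>j. if j < i then c j else if j = i then 1 else 0"
    have "(\<Sum>j<r. ?c j * F j x) = (\<Sum>j<i. c j * F j x) + F i x" for x
    proof -
      have "(\<Sum>j<r. ?c j * F j x) = (\<Sum>j<Suc i. ?c j * F j x)"
        using i by (intro sum.mono_neutral_right) auto
      also have "\<dots> = (\<Sum>j<i. ?c j * F j x) + F i x" by simp
      also have "(\<Sum>j<i. ?c j * F j x) = (\<Sum>j<i. c j * F j x)" by (intro sum.cong) auto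
      finally show ?thesis .
    qed
    then show ?thesis using c by (intro exI[of _ ?c]) (auto simp: algebra_simps)
  qed
  define a where "a n i = (SOME c. (\<forall>x\<in>N. F i (n \<otimes> x) = (\<Sum>j<r. c j * F j x)) \<and> c i = 1 \<and> (\<forall>j>i. c j = 0))"
    for n i
  have a: "\<And>x. x \<in> N \<Longrightarrow> F i (n \<otimes> x) = (\<Sum>j<r. a n i j * F j x)" "a n i i = 1" "\<And>j. i < j \<Longrightarrow> a n i j = 0"
    if "i < r" "n \<in> N" for i n
    using someI_ex[OF ex[OF that]] unfolding a_def[symmetric] by auto
  have a_one: "a \<one> i j = (if i = j then 1 else 0)" if "i < r" "j < r" for i j
  proof -
    have "(\<Sum>j<r. (a \<one> i j - (if i = j then 1 else 0)) * F j x) = 0" if x: "x \<in> N" for x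
    proof -
      have "(\<Sum>j<r. (if i = j then 1 else 0) * F j x) = (\<Sum>j\<in>{i}. F j x)"
        using \<open>i < r\<close> by (intro sum.mono_neutral_cong_right) auto
      moreover have "x \<in> carrier G" using x N by auto
      ultimately show ?thesis
        using a(1)[OF \<open>i < r\<close> one x] by (simp add: left_diff_distrib sum_subtractf)
    qed
    from indep[OF this \<open>j < r\<close>] show ?thesis by simp
  qed
  have a_mult: "a (n \<otimes> m) i k = (\<Sum>j<r. a n i j * a m j k)"
    if nm: "n \<in> N" "m \<in> N" and ik: "i < r" "k < r" for n m i k
  proof -
    have "(\<Sum>k<r. (a (n \<otimes> m) i k - (\<Sum>j<r. a n i j * a m j k)) * F k x) = 0" if x: "x \<in> N" for x
    proof -
      have G: "n \<in> carrier G" "m \<in> carrier G" "x \<in> carrier G" using nm x N by auto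
      have "(\<Sum>k<r. a (n \<otimes> m) i k * F k x) = F i (n \<otimes> (m \<otimes> x))"
        using a(1)[OF ik(1) mult_closedD[OF N(1) nm] x] G by (simp add: m_assoc)
      also have "\<dots> = (\<Sum>j<r. a n i j * F j (m \<otimes> x))"
        by (rule a(1)[OF ik(1) nm(1) mult_closedD[OF N(1) nm(2) x]])
      also have "\<dots> = (\<Sum>j<r. a n i j * (\<Sum>k<r. a m j k * F k x))"
        by (intro sum.cong) (simp_all add: a(1)[OF _ nm(2) x])
      also have "\<dots> = (\<Sum>j<r. \<Sum>k<r. a n i j * a m j k * F k x)"
        by (simp add: sum_distrib_left mult.assoc)
      also have "\<dots> = (\<Sum>k<r. \<Sum>j<r. a n i j * a m j k * F k x)" by (rule sum.swap)
      also have "\<dots> = (\<Sum>k<r. (\<Sum>j<r. a n i j * a m j k) * F k x)"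
        by (simp add: sum_distrib_right)
      finally show ?thesis by (simp add: left_diff_distrib sum_subtractf)
    qed
    from indep[OF this ik(2)] show ?thesis by simp
  qed
  have a_inj: "n = \<one>" if n: "n \<in> N" and id: "\<And>i j. i < r \<Longrightarrow> j < i \<Longrightarrow> a n i j = 0" for n
  proof (rule e[OF n])
    fix f assume "pol N e f"
    then obtain c where c: "\<forall>x\<in>N. f x = (\<Sum>j<r. c j * F j x)" using span unfolding lspan_def by blast
    have "F i n = F i \<one>" if i: "i < r" for i
    proof -
      have "n \<in> carrier G" using n N by auto
      then have "F i n = (\<Sum>j<r. a n i j * F j \<one>)" using a(1)[OF i n one] by simp
      also have "\<dots> = (\<Sum>j\<in>{i}. F j \<one>)"
      proof (rule sum.mono_neutral_cong_right)
        show "\<forall>j\<in>{..<r} - {i}. a n i j * F j \<one> = 0"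
        proof
          fix j assume "j \<in> {..<r} - {i}"
          then have "j < i \<or> i < j" by auto
          then show "a n i j * F j \<one> = 0" using id[OF i] a(3)[OF i n] by auto
        qed
      qed (use i a(2)[OF i n] in auto)
      finally show ?thesis by simp
    qed
    then have "(\<Sum>j<r. c j * F j n) = (\<Sum>j<r. c j * F j \<one>)" by (intro sum.cong) auto
    then show "f n = f \<one>" using c n one by simp
  qed
  have sN: "s \<in> N" if "s \<in> S" for s
    unfolding N_def submonoid_gen_def using that S by (intro image_eqI[of _ _ "[s]"]) auto
  obtain d :: int where d: "d > 0" "\<And>s i j. s \<in> S \<Longrightarrow> i < r \<Longrightarrow> j < r \<Longrightarrow> of_int d * a s i j \<in> \<int>"
  proof -
    let ?A = "(\<lambda>(s, i, j). a s i j) ` (S \<times> {..<r} \<times> {..<r})"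
    obtain d :: int where d: "d > 0" "\<forall>q\<in>?A. of_int d * q \<in> \<int>"
      using common_denominator[of ?A] S(1) by auto
    have "of_int d * a s i j \<in> \<int>" if "s \<in> S" "i < r" "j < r" for s i j
      using that by (intro bspec[OF d(2)] image_eqI[of _ _ "(s, i, j)"]) auto
    with d(1) show ?thesis by (rule that)
  qed
  text \<open>Conjugation by the diagonal matrix with entries \<open>d ^ i\<close> clears the denominators.\<close>
  define \<mu> where "\<mu> s i j = (if j < i \<and> i < r then \<lfloor>of_int d ^ (i - j) * a s i j\<rfloor> else ut_one i j)" for s i j
  have \<mu>_UT: "\<mu> s \<in> UT r" for s by (auto simp: UT_def \<mu>_def ut_one_def)
  have \<mu>: "of_int (\<mu> s i j) = of_int d ^ (i - j) * a s i j" if s: "s \<in> S" and ij: "j \<le> i" "i < r" for s i j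
  proof (cases "j = i")
    case True
    then show ?thesis using a(2)[OF ij(2) sN[OF s]] by (simp add: \<mu>_def ut_one_def)
  next
    case False
    then have "j < i" using ij by simp
    then obtain k where k: "i - j = Suc k" by (metis Suc_diff_Suc)
    \<comment> \<open>One factor \<open>d\<close> clears the denominator, so the floor in the
      definition of \<open>\<mu>\<close> is exact.\<close>
    have "of_int d ^ k * (of_int d * a s i j) \<in> \<int>"
      using d(2)[OF s ij(2), of j] ij by (intro Ints_mult[OF Ints_power[OF Ints_of_int]]) auto
    then have "of_int d ^ (i - j) * a s i j \<in> \<int>" by (simp add: k mult.commute mult.left_commute)
    then show ?thesis using \<open>j < i\<close> ij by (simp add: \<mu>_def of_int_floor)
  qed
  have wN: "mprod ws \<in> N" if "ws \<in> lists S" for ws using that by (auto simp: N_def submonoid_gen_def)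
  have prod: "of_int (ut_prod (map \<mu> ws) i j) = of_int d ^ (i - j) * a (mprod ws) i j"
    if "ws \<in> lists S" "j \<le> i" "i < r" for ws i j
    using that
  proof (induction ws arbitrary: i j)
    case Nil
    then show ?case by (simp add: ut_one_def a_one)
  next
    case (Cons s ws)
    have s: "s \<in> S" and ws: "ws \<in> lists S" using Cons.hyps by auto
    have "(of_int (ut_prod (map \<mu> (s # ws)) i j) :: rat) =
      (\<Sum>k\<in>{j..i}. of_int (\<mu> s i k) * of_int (ut_prod (map \<mu> ws) k j))"
      by (simp add: ut_mul_def)
    also have "\<dots> = (\<Sum>k\<in>{j..i}. of_int d ^ (i - j) * (a s i k * a (mprod ws) k j))"
    proof (intro sum.cong refl)
      fix k assume k: "k \<in> {j..i}"
      then have "i - j = (i - k) + (k - j)" by auto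
      moreover have "of_int (\<mu> s i k) = of_int d ^ (i - k) * a s i k" using k Cons.prems by (intro \<mu> s) auto
      moreover have "of_int (ut_prod (map \<mu> ws) k j) = of_int d ^ (k - j) * a (mprod ws) k j"
        using k Cons.prems by (intro Cons.IH ws) auto
      ultimately show "of_int (\<mu> s i k) * of_int (ut_prod (map \<mu> ws) k j) =
          of_int d ^ (i - j) * (a s i k * a (mprod ws) k j)"
        by (simp add: power_add)
    qed
    also have "\<dots> = of_int d ^ (i - j) * (\<Sum>k\<in>{j..i}. a s i k * a (mprod ws) k j)"
      by (simp add: sum_distrib_left)
    also have "(\<Sum>k\<in>{j..i}. a s i k * a (mprod ws) k j) = (\<Sum>k<r. a s i k * a (mprod ws) k j)"
    proof (rule sum.mono_neutral_left)
      show "\<forall>k\<in>{..<r} - {j..i}. a s i k * a (mprod ws) k j = 0"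
      proof
        fix k assume k: "k \<in> {..<r} - {j..i}"
        then have "k < j \<or> i < k" by auto
        then show "a s i k * a (mprod ws) k j = 0"
          using a(3)[of k "mprod ws" j] a(3)[of i s k] k Cons.prems wN[OF ws] sN[OF s] by auto
      qed
    qed (use Cons.prems in auto)
    also have "\<dots> = a (mprod (s # ws)) i j"
      using a_mult[OF sN[OF s] wN[OF ws], of i j] Cons.prems by simp
    finally show ?case .
  qed
  have "mprod ws = \<one> \<longleftrightarrow> ut_prod (map \<mu> ws) = ut_one" if ws: "ws \<in> lists S" for ws
  proof
    assume eq: "mprod ws = \<one>"
    have UTw: "ut_prod (map \<mu> ws) \<in> UT r" using \<mu>_UT by (intro ut_prod_in_UT) auto
    show "ut_prod (map \<mu> ws) = ut_one"
    proof (intro ext)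
      fix i j
      show "ut_prod (map \<mu> ws) i j = ut_one i j"
      proof (cases "j < i \<and> i < r")
        case True
        then have "(of_int (ut_prod (map \<mu> ws) i j) :: rat) = 0"
          using prod[OF ws, of j i] by (simp add: eq a_one)
        then show ?thesis using True by (simp add: ut_one_def)
      next
        case False
        then show ?thesis using UTw by (simp add: UT_def ut_one_def)
      qed
    qed
  next
    assume eq: "ut_prod (map \<mu> ws) = ut_one"
    show "mprod ws = \<one>"
    proof (rule a_inj[OF wN[OF ws]])
      fix i j assume "i < r" "j < i"
      then show "a (mprod ws) i j = 0" using prod[OF ws, of j i] d(1) by (simp add: eq ut_one_def)
    qed
  qed
  moreover have "\<mu> ` S \<subseteq> UT r" using \<mu>_UT by blast
  ultimately show ?thesis by (rule that[rotated])
qed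

end

section \<open>The machine for a nilpotent group\<close>

text \<open>For \<open>k \<ge> 1\<close> the index \<open>k\<close> is itself among those tested, so
  a final value below 1 is replaced by 1.\<close>

lemma iterated_log_ge_1: "k \<ge> 1 \<Longrightarrow> iterated_log k x \<ge> 1"
  unfolding iterated_log_def by (auto simp: not_less)

lemma linear_imp_worst_case_time:
  assumes "\<And>w. w \<in> lists \<Sigma> \<Longrightarrow> running_time M w \<le> c * length w + c" "k \<ge> 1"
  shows "worst_case_time \<Sigma> M (\<lambda>n. real n * iterated_log k (real n))"
  unfolding worst_case_time_def
proof (intro exI ballI impI)
  fix w :: "'a list" assume w: "w \<in> lists \<Sigma>" "w \<noteq> []"
  have "running_time M w \<le> c * length w + c" using assms(1)[OF w(1)] .
  \<comment> \<open>The word has length at least 1, which absorbs the constant term.\<close>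
  also have "\<dots> \<le> 2 * c * length w" using w(2) by (cases w) auto
  finally have "real (running_time M w) \<le> real (2 * c * length w)" by (simp only: of_nat_le_iff)
  also have "\<dots> = real (2 * c) * (real (length w) * 1)" by simp
  also have "\<dots> \<le> real (2 * c) * (real (length w) * iterated_log k (real (length w)))"
    using iterated_log_ge_1[OF assms(2)] by (intro mult_left_mono) auto
  finally show "real (running_time M w) \<le> real (2 * c) * (real (length w) * iterated_log k (real (length w)))" .
qed

lemma (in group) sep_subset: "sep M \<Longrightarrow> N \<subseteq> M \<Longrightarrow> sep N"
  unfolding sep_def
proof (elim exE)
  fix e assume e: "\<forall>g\<in>M. (\<forall>f. pol M e f \<longrightarrow> f g = f \<one>) \<longrightarrow> g = \<one>" and NM: "N \<subseteq> M"
  have "g = \<one>" if g: "g \<in> N" and all: "\<forall>f. pol N e f \<longrightarrow> f g = f \<one>" for g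
  proof -
    have "\<forall>f. pol M e f \<longrightarrow> f g = f \<one>" using all pol_subset[OF _ NM] by simp
    then show ?thesis using e g NM by blast
  qed
  then show "\<exists>e. \<forall>g\<in>N. (\<forall>f. pol N e f \<longrightarrow> f g = f \<one>) \<longrightarrow> g = \<one>" by blast
qed

text \<open>The first pass reads generators with a coset representative as state and emits codes of
  matrices, in the manner of Reidemeister and Schreier. All later passes read such codes with a
  digit matrix as state.\<close>

lemma (in group) virtually_sep_linear_time:
  assumes vs: "virtually_sep (carrier G)" and X: "finite X" "X \<subseteq> carrier G"
  shows "\<exists>M. is_turing_machine (group_letters X) M \<and>
    tm_decides (group_letters X) M (word_problem G X) \<and>
    (\<forall>w\<in>lists (group_letters X). running_time M w \<le> 8 * length w + 1)"
proof -
  define \<Sigma> where "\<Sigma> = group_letters X"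
  have fin_\<Sigma>: "finite \<Sigma>" using X by (simp add: \<Sigma>_def group_letters_def)
  define lv where "lv = letter_value G"
  have lv: "lv l \<in> carrier G" if "l \<in> \<Sigma>" for l
    using that X by (cases l) (auto simp: lv_def \<Sigma>_def group_letters_def)
  obtain M where M: "subgroup M G" "fin_index M (carrier G)" "sep M"
    using vs unfolding virtually_sep_def by blast
  obtain R where R: "finite R" "R \<subseteq> carrier G" "\<And>h. h \<in> carrier G \<Longrightarrow> \<exists>r\<in>R. h \<otimes> inv r \<in> M"
    using M(2) unfolding fin_index_def by blast
  \<comment> \<open>Elements of \<open>M\<close> get the representative 1, and \<open>R'\<close>
    drops all others that lie in \<open>M\<close>; so the state is 1 exactly when the coset is
    trivial.\<close>
  define rep where "rep g = (if g \<in> M then \<one> else SOME r. r \<in> R \<and> g \<otimes> inv r \<in> M)" for g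
  define R' where "R' = {r \<in> insert \<one> R. r \<in> M \<longrightarrow> r = \<one>}"
  have R'_fin: "finite R'" and R'_carrier: "\<And>r. r \<in> R' \<Longrightarrow> r \<in> carrier G"
    and R'_M: "\<And>r. r \<in> R' \<Longrightarrow> r \<in> M \<Longrightarrow> r = \<one>" and one_R': "\<one> \<in> R'"
    using R by (auto simp: R'_def)
  have rep: "rep g \<in> R'" "g \<otimes> inv rep g \<in> M" if g: "g \<in> carrier G" for g
  proof -
    have "rep g \<in> R' \<and> g \<otimes> inv rep g \<in> M"
    proof (cases "g \<in> M")
      case True
      then show ?thesis using g one_R' by (simp add: rep_def)
    next
      case False
      then have r: "rep g \<in> R" "g \<otimes> inv rep g \<in> M"
        using someI_ex[OF R(3)[OF g, unfolded Bex_def]] by (auto simp: rep_def)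
      have "rep g \<notin> M"
      proof
        assume "rep g \<in> M"
        then have "g \<otimes> inv rep g \<otimes> rep g \<in> M" by (rule subgroup.m_closed[OF M(1) r(2)])
        then show False using False g r(1) R(2) by (auto simp: m_assoc)
      qed
      then show ?thesis using r by (simp add: R'_def)
    qed
    then show "rep g \<in> R'" "g \<otimes> inv rep g \<in> M" by auto
  qed
  define V where "V = insert \<one> (lv ` \<Sigma>)"
  have V: "finite V" "\<And>v. v \<in> V \<Longrightarrow> v \<in> carrier G" using fin_\<Sigma> lv by (auto simp: V_def)
  \<comment> \<open>Schreier-type elements, one for each state and pair of letters; the 1 in
    \<open>V\<close> accounts for a blank second letter.\<close>
  define S where "S = (\<lambda>(r, u, v). r \<otimes> u \<otimes> v \<otimes> inv rep (r \<otimes> u \<otimes> v)) ` (R' \<times> V \<times> V)"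
  have S_fin: "finite S" using R'_fin V(1) by (simp add: S_def)
  have S_mem: "r \<otimes> u \<otimes> v \<otimes> inv rep (r \<otimes> u \<otimes> v) \<in> S" if "r \<in> R'" "u \<in> V" "v \<in> V" for r u v
    unfolding S_def by (rule image_eqI[of _ _ "(r, u, v)"]) (use that in auto)
  have SM: "S \<subseteq> M"
    using rep(2) R'_carrier V(2) by (auto simp: S_def)
  have MG: "M \<subseteq> carrier G" using M(1) by (rule subgroup.subset)
  have SG: "S \<subseteq> carrier G" using SM MG by blast
  have "submonoid_gen S \<subseteq> M"
    using SM mprod_in_subgroup[OF M(1)] by (auto simp: submonoid_gen_def in_lists_conv_set subset_eq)
  then have sepS: "sep (submonoid_gen S)" by (rule sep_subset[OF M(3)])
  obtain d \<mu> where \<mu>: "\<mu> ` S \<subseteq> UT d"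
    and \<mu>_iff: "\<And>ws. ws \<in> lists S \<Longrightarrow> mprod ws = \<one> \<longleftrightarrow> ut_prod (map \<mu> ws) = ut_one"
    by (rule unitriangular_representation[OF S_fin SG sepS]) (rule that)
  obtain c where c: "\<mu> ` S \<subseteq> ut_ball d c" using subset_ut_ball[OF _ \<mu>] S_fin by blast
  define B where "B = ut_ball d c"
  have BU: "B \<subseteq> UT d" by (auto simp: B_def ut_ball_def)
  have B_fin: "finite B" by (simp add: B_def finite_ut_ball)
  \<comment> \<open>\<open>Work\<close> symbols carry natural numbers, so the matrices of the finite
    set \<open>B\<close> are numbered.\<close>
  define encode where "encode = to_nat_on B"
  define decode where "decode = from_nat_into B"
  have decode_encode: "decode (encode b) = b" if "b \<in> B" for b
    using that by (simp add: decode_def encode_def countable_finite[OF B_fin])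
  define K where "K = encode ` B"
  have decK: "decode k \<in> B" if "k \<in> K" for k using that decode_encode by (auto simp: K_def)
  \<comment> \<open>Symbols and states have two readings, in \<open>G\<close> and in matrices, and
    each reads material of the other kind as the identity. This lets one test \<open>final\<close>
    and one predicate \<open>P\<close> treat both kinds of pass.\<close>
  define gval where "gval s = (case s of Input l \<Rightarrow> lv l | _ \<Rightarrow> \<one>)" for s
  define uval where "uval s = (case s of Work k \<Rightarrow> decode k | _ \<Rightarrow> ut_one)" for s :: "('a \<times> bool) tape_symbol"
  define gst where "gst q = (case q of Some (Inl r) \<Rightarrow> r | _ \<Rightarrow> \<one>)" for q :: "('a + (nat \<Rightarrow> nat \<Rightarrow> int)) option"
  define ust where "ust q = (case q of Some (Inr D) \<Rightarrow> D | _ \<Rightarrow> ut_one)" for q :: "('a + (nat \<Rightarrow> nat \<Rightarrow> int)) option"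
  \<comment> \<open>Every pass restarts in the same state, so \<open>None\<close> belongs to both
    sets; the kind of pass is recognised from the letters.\<close>
  define Qg :: "('a + (nat \<Rightarrow> nat \<Rightarrow> int)) option set" where "Qg = insert None (Some ` Inl ` R')"
  define Qu :: "('a + (nat \<Rightarrow> nat \<Rightarrow> int)) option set" where "Qu = insert None (Some ` Inr ` digits d)"
  define \<tau> where "\<tau> q s s' = (case s of
      Input l \<Rightarrow> let x = gst q \<otimes> lv l \<otimes> gval s' in (encode (\<mu> (x \<otimes> inv rep x)), Some (Inl (rep x)))
    | _ \<Rightarrow> let x = ut_mul (ust q) (ut_mul (uval s) (uval s')) in (encode (quot d x), Some (Inr (digit d x))))"
    for q s s'
  define final where "final q \<longleftrightarrow> gst q = \<one> \<and> ust q = ut_one" for q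
  define triv where "triv k \<longleftrightarrow> decode k = ut_one" for k
  have gst: "gst q \<in> R'" if "q \<in> Qg \<union> Qu" for q using that one_R' by (auto simp: Qg_def Qu_def gst_def)
  have ust: "ust q \<in> digits d" if "q \<in> Qg \<union> Qu" for q
    using that ut_one_in_digits by (auto simp: Qg_def Qu_def ust_def)
  have gval: "gval s \<in> V" if "s \<in> insert Blank (Input ` \<Sigma> \<union> Work ` K)" for s
    using that by (auto simp: gval_def V_def)
  have uval: "uval s \<in> B" if "s \<in> insert Blank (Input ` \<Sigma> \<union> Work ` K)" for s
    using that decK ut_one_in_ut_ball by (auto simp: uval_def B_def)
  have \<tau>_Input: "\<exists>m\<in>S. \<tau> q (Input l) s' = (encode (\<mu> m), Some (Inl r')) \<and> r' \<in> R' \<and> gst q \<otimes> lv l \<otimes> gval s' = m \<otimes> r'"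
    if "q \<in> Qg \<union> Qu" "l \<in> \<Sigma>" "s' \<in> insert Blank (Input ` \<Sigma> \<union> Work ` K)" "r' = rep (gst q \<otimes> lv l \<otimes> gval s')" for q l s' r'
  proof -
    let ?x = "gst q \<otimes> lv l \<otimes> gval s'"
    have x: "?x \<in> carrier G" using R'_carrier[OF gst[OF that(1)]] lv[OF that(2)] V(2)[OF gval[OF that(3)]] by simp
    have m: "?x \<otimes> inv rep ?x \<in> S"
      using gst[OF that(1)] gval[OF that(3)] that(2) by (intro S_mem) (auto simp: V_def)
    have e: "?x = ?x \<otimes> inv rep ?x \<otimes> r'"
      using x R'_carrier[OF rep(1)[OF x]] that(4) by (simp add: m_assoc)
    have t: "\<tau> q (Input l) s' = (encode (\<mu> (?x \<otimes> inv rep ?x)), Some (Inl r'))"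
      by (simp add: \<tau>_def Let_def that(4))
    have r: "r' \<in> R'" using rep(1)[OF x] that(4) by simp
    show ?thesis by (intro bexI[OF _ m] conjI t r e)
  qed
  have \<tau>_Work: "\<exists>b D. \<tau> q (Work k) s' = (encode b, Some (Inr D)) \<and> b \<in> B \<and> D \<in> digits d \<and>
      ut_mul (ust q) (ut_mul (decode k) (uval s')) = ut_mul (dilate b) D"
    if q: "q \<in> Qg \<union> Qu" and k: "k \<in> K" and s': "s' \<in> insert Blank (Input ` \<Sigma> \<union> Work ` K)" for q k s'
  proof -
    let ?x = "ut_mul (ust q) (ut_mul (decode k) (uval s'))"
    have "?x \<in> UT d" using ust[OF q] decK[OF k] uval[OF s'] BU digits_subset by (intro ut_mul_in_UT) auto
    then have "ut_mul (dilate (quot d ?x)) (digit d ?x) = ?x" by (rule quot_digit)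
    moreover have "quot d ?x \<in> B"
      unfolding B_def using ust[OF q] decK[OF k] uval[OF s'] by (intro quot_in_ut_ball) (auto simp: B_def)
    moreover have "\<tau> q (Work k) s' = (encode (quot d ?x), Some (Inr (digit d ?x)))"
      by (simp add: \<tau>_def Let_def uval_def[of "Work k"])
    ultimately show ?thesis using digit_in_digits by metis
  qed
  have \<mu>B: "\<mu> m \<in> B" if "m \<in> S" for m using that c by (auto simp: B_def)
  interpret halving \<Sigma> "Qg \<union> Qu" None K \<tau> final triv
  proof
    show "finite \<Sigma>" by (rule fin_\<Sigma>)
    show "finite (Qg \<union> Qu)" using R'_fin finite_digits by (simp add: Qg_def Qu_def)
    show "finite K" using B_fin by (simp add: K_def)
    show "None \<in> Qg \<union> Qu" by (simp add: Qg_def)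
    fix q s s' assume q: "q \<in> Qg \<union> Qu" and s: "s \<in> Input ` \<Sigma> \<union> Work ` K"
      and s': "s' \<in> insert Blank (Input ` \<Sigma> \<union> Work ` K)"
    show "\<tau> q s s' \<in> K \<times> (Qg \<union> Qu)"
    proof (cases "s \<in> Input ` \<Sigma>")
      case True
      then obtain l where l: "s = Input l" "l \<in> \<Sigma>" by blast
      show ?thesis using \<tau>_Input[OF q l(2) s' refl] \<mu>B by (auto simp: l K_def Qg_def)
    next
      case False
      then obtain k where k: "s = Work k" "k \<in> K" using s by blast
      show ?thesis using \<tau>_Work[OF q k(2) s'] by (auto simp: k K_def Qu_def)
    qed
  qed
  have gval_lists: "mprod (map gval w) \<in> carrier G" if "w \<in> lists (Input ` \<Sigma>)" for w
    using that lv by (intro mprod_closed) (auto simp: gval_def)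
  have uval_lists: "ut_prod (map uval w) \<in> UT d" if "w \<in> lists (Work ` K)" for w
  proof (rule ut_prod_in_UT)
    show "set (map uval w) \<subseteq> UT d" using that uval BU by fastforce
  qed
  have pass_Input: "\<exists>ms\<in>lists S. ks = map (\<lambda>m. encode (\<mu> m)) ms \<and> q' \<in> Qg \<and>
      gst q \<otimes> mprod (map gval w) = mprod ms \<otimes> gst q'"
    if "q \<in> Qg" "w \<in> lists (Input ` \<Sigma>)" "pass q w = (ks, q')" for q w ks q'
    using that
  proof (induction q w arbitrary: ks rule: pass.induct)
    case (1 q)
    then show ?case using R'_carrier[OF gst[of q]] by (intro bexI[of _ "[]"]) auto
  next
    case (2 q s)
    then obtain l where l: "s = Input l" "l \<in> \<Sigma>" by auto
    have q: "q \<in> Qg \<union> Qu" using 2 by simp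
    obtain m r' where m: "m \<in> S" "\<tau> q s Blank = (encode (\<mu> m), Some (Inl r'))" "r' \<in> R'"
      "gst q \<otimes> lv l \<otimes> gval Blank = m \<otimes> r'"
      using \<tau>_Input[OF q l(2) _ refl, of Blank] l(1) by blast
    have "gst q \<otimes> lv l = m \<otimes> r'"
      using m(4) R'_carrier[OF gst[OF q]] lv[OF l(2)] by (simp add: gval_def)
    then show ?case
      using 2 m l lv[OF l(2)] SG by (intro bexI[of _ "[m]"]) (auto simp: gval_def gst_def Qg_def)
  next
    case (3 q s s' w)
    then obtain l l' where l: "s = Input l" "l \<in> \<Sigma>" "s' = Input l'" "l' \<in> \<Sigma>" by auto
    have q: "q \<in> Qg \<union> Qu" and w: "w \<in> lists (Input ` \<Sigma>)" using 3 by simp_all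
    obtain m r' where m: "m \<in> S" "\<tau> q s s' = (encode (\<mu> m), Some (Inl r'))" "r' \<in> R'"
      "gst q \<otimes> lv l \<otimes> gval s' = m \<otimes> r'"
      using \<tau>_Input[OF q l(2) _ refl, of s'] l by blast
    obtain ls q'' where ls: "pass (Some (Inl r')) w = (ls, q'')" by fastforce
    have ks: "ks = encode (\<mu> m) # ls" "q'' = q'" using 3(4) m(2) ls by auto
    have "Some (Inl r') \<in> Qg" using m(3) by (simp add: Qg_def)
    from 3(1)[OF m(2)[symmetric] this w ls[unfolded ks(2)]] obtain ms where ms:
      "ms \<in> lists S" "ls = map (\<lambda>m. encode (\<mu> m)) ms" "q' \<in> Qg"
      "r' \<otimes> mprod (map gval w) = mprod ms \<otimes> gst q'" by (auto simp: gst_def)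
    have G: "gst q \<in> carrier G" "lv l \<in> carrier G" "lv l' \<in> carrier G" "mprod (map gval w) \<in> carrier G"
      "m \<in> carrier G" "r' \<in> carrier G" "mprod ms \<in> carrier G" "gst q' \<in> carrier G"
      using R'_carrier gst[OF q] gst[of q'] ms(1,3) m(1,3) lv l gval_lists[OF w] SG
      by (auto intro!: mprod_closed)
    have "gst q \<otimes> mprod (map gval (s # s' # w)) = (gst q \<otimes> lv l \<otimes> gval s') \<otimes> mprod (map gval w)"
      using G by (simp add: l gval_def m_assoc)
    also have "\<dots> = m \<otimes> (r' \<otimes> mprod (map gval w))" unfolding m(4) using G by (simp add: m_assoc)
    also have "\<dots> = mprod (m # ms) \<otimes> gst q'" unfolding ms(4) using G by (simp add: m_assoc)
    finally show ?case using ms ks m by (intro bexI[of _ "m # ms"]) auto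
  qed
  have pass_Work: "ks \<in> lists K \<and> q' \<in> Qu \<and>
      ut_mul (ust q) (ut_prod (map uval w)) = ut_mul (dilate (ut_prod (map decode ks))) (ust q')"
    if "q \<in> Qu" "w \<in> lists (Work ` K)" "pass q w = (ks, q')" for q w ks q'
    using that
  proof (induction q w arbitrary: ks rule: pass.induct)
    case (1 q)
    have "ust q \<in> UT d" using ust[of q] 1 digits_subset by auto
    then show ?case using 1 by (auto simp: ut_mul_one_left ut_mul_one_right dilate_ut_one)
  next
    case (2 q s)
    then obtain k where k: "s = Work k" "k \<in> K" by auto
    have q: "q \<in> Qg \<union> Qu" using 2 by simp
    obtain b D where b: "\<tau> q s Blank = (encode b, Some (Inr D))" "b \<in> B" "D \<in> digits d"
      "ut_mul (ust q) (ut_mul (decode k) (uval Blank)) = ut_mul (dilate b) D"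
      using \<tau>_Work[OF q k(2), of Blank] k(1) by blast
    have "ut_mul (decode (encode b)) ut_one = b"
      unfolding decode_encode[OF b(2)] by (rule ut_mul_one_right[OF subsetD[OF BU b(2)]])
    moreover have "ks = [encode b]" "q' = Some (Inr D)" using 2 b(1) by auto
    ultimately show ?case
      using b by (simp add: k(1) uval_def ust_def[of "Some (Inr D)"] Qu_def K_def)
  next
    case (3 q s s' w)
    then obtain k k' where k: "s = Work k" "k \<in> K" "s' = Work k'" "k' \<in> K" by auto
    have q: "q \<in> Qg \<union> Qu" and w: "w \<in> lists (Work ` K)" using 3 by simp_all
    obtain b D where b: "\<tau> q s s' = (encode b, Some (Inr D))" "b \<in> B" "D \<in> digits d"
      "ut_mul (ust q) (ut_mul (decode k) (uval s')) = ut_mul (dilate b) D"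
      using \<tau>_Work[OF q k(2), of s'] k by blast
    obtain ls q'' where ls: "pass (Some (Inr D)) w = (ls, q'')" by fastforce
    have ks: "ks = encode b # ls" "q'' = q'" using 3(4) b(1) ls by auto
    have "Some (Inr D) \<in> Qu" using b(3) by (simp add: Qu_def)
    from 3(1)[OF b(1)[symmetric] this w ls[unfolded ks(2)]] have IH:
      "ls \<in> lists K" "q' \<in> Qu"
      "ut_mul D (ut_prod (map uval w)) = ut_mul (dilate (ut_prod (map decode ls))) (ust q')" by (auto simp: ust_def)
    have "ut_mul (ust q) (ut_prod (map uval (s # s' # w))) =
      ut_mul (ut_mul (ust q) (ut_mul (decode k) (uval s'))) (ut_prod (map uval w))"
      by (simp add: k(1) uval_def[of "Work k"] ut_mul_assoc)
    also have "\<dots> = ut_mul (dilate b) (ut_mul D (ut_prod (map uval w)))" unfolding b(4) by (rule ut_mul_assoc)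
    also have "\<dots> = ut_mul (dilate (ut_prod (map decode ks))) (ust q')"
      unfolding IH(3) by (simp add: ks decode_encode[OF b(2)] dilate_ut_mul ut_mul_assoc)
    finally show ?case using IH b ks by (auto simp: K_def)
  qed
  \<comment> \<open>On words of generators the second conjunct is automatic, on words of codes the
    first.\<close>
  define P where "P w \<longleftrightarrow> mprod (map gval w) = \<one> \<and> ut_prod (map uval w) = ut_one" for w
  define \<D> where "\<D> = lists (Input ` \<Sigma>) \<union> lists (Work ` K)"
  have uval_Input: "ut_prod (map uval w) = ut_one" if "w \<in> lists (Input ` \<Sigma>)" for w
    using that by (induction w) (auto simp: uval_def ut_mul_one_left[OF ut_one_in_UT])
  have gval_Work: "mprod (map gval w) = \<one>" if "w \<in> lists (Work ` K)" for w
    using that by (induction w) (auto simp: gval_def)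
  have P_Work: "P (map Work ks) \<longleftrightarrow> ut_prod (map decode ks) = ut_one" if "ks \<in> lists K" for ks
  proof -
    have "(map Work ks :: ('a \<times> bool) tape_symbol list) \<in> lists (Work ` K)" using that by auto
    moreover have "map uval (map Work ks) = map decode ks" by (simp add: uval_def)
    ultimately show ?thesis unfolding P_def by (simp only: gval_Work simp_thms)
  qed
  have case_ks: "(case ks of [] \<Rightarrow> True | [k] \<Rightarrow> triv k | _ \<Rightarrow> P (map Work ks)) \<longleftrightarrow> ut_prod (map decode ks) = ut_one"
    if ks: "ks \<in> lists K" for ks
  proof -
    have "ut_mul (decode k) ut_one = decode k" if "k \<in> K" for k
      using decK[OF that] BU ut_mul_one_right by blast
    then show ?thesis
      using P_Work[OF ks] ks ut_mul_one_left[OF ut_one_in_UT] by (auto simp: triv_def split: list.splits)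
  qed
  have pass_P: "ks \<in> lists K \<and> (P w \<longleftrightarrow> final q \<and> ut_prod (map decode ks) = ut_one)"
    if w: "w \<in> \<D>" and p: "pass None w = (ks, q)" for w ks q
  proof (cases "w \<in> lists (Input ` \<Sigma>)")
    case True
    have "None \<in> Qg" by (simp add: Qg_def)
    from pass_Input[OF this True p] obtain ms where ms: "ms \<in> lists S" "ks = map (\<lambda>m. encode (\<mu> m)) ms"
      "q \<in> Qg" "mprod (map gval w) = mprod ms \<otimes> gst q"
      using gval_lists[OF True] by (auto simp: gst_def)
    have mM: "mprod ms \<in> M" using ms(1) SM by (intro mprod_in_subgroup[OF M(1)]) auto
    have G: "mprod ms \<in> carrier G" "gst q \<in> carrier G" using mM MG R'_carrier gst[of q] ms(3) by auto
    have dk: "map decode ks = map \<mu> ms"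
      using ms(1) \<mu>B by (auto simp: ms(2) decode_encode)
    have "ust q = ut_one" using ms(3) by (auto simp: Qg_def ust_def)
    then have fin: "final q \<longleftrightarrow> gst q = \<one>" by (simp add: final_def)
    have "P w \<longleftrightarrow> mprod ms \<otimes> gst q = \<one>" using ms(4) uval_Input[OF True] by (simp add: P_def)
    \<comment> \<open>\<open>mprod ms\<close> lies in \<open>M\<close>, and \<open>R'\<close> meets
      \<open>M\<close> only in 1, so a trivial product forces both factors to be trivial.\<close>
    also have "\<dots> \<longleftrightarrow> gst q = \<one> \<and> mprod ms = \<one>"
    proof
      assume eq: "mprod ms \<otimes> gst q = \<one>"
      then have "gst q = inv mprod ms" using G by (metis inv_equality inv_inv)
      then have "gst q \<in> M" using subgroup.m_inv_closed[OF M(1) mM] by simp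
      then have "gst q = \<one>" using R'_M gst[of q] ms(3) by auto
      then show "gst q = \<one> \<and> mprod ms = \<one>" using eq G by simp
    qed auto
    finally have "P w \<longleftrightarrow> final q \<and> ut_prod (map decode ks) = ut_one"
      unfolding dk fin \<mu>_iff[OF ms(1)] .
    moreover have "ks \<in> lists K" using ms(1) \<mu>B by (auto simp: ms(2) K_def)
    ultimately show ?thesis by blast
  next
    case False
    then have wW: "w \<in> lists (Work ` K)" using w by (simp add: \<D>_def)
    have "None \<in> Qu" by (simp add: Qu_def)
    from pass_Work[OF this wW p] have ks: "ks \<in> lists K" "q \<in> Qu"
      "ut_prod (map uval w) = ut_mul (dilate (ut_prod (map decode ks))) (ust q)"
      using uval_lists[OF wW] by (auto simp: ust_def ut_mul_one_left)
    have U: "ut_prod (map decode ks) \<in> UT d" using ks(1) decK BU by (intro ut_prod_in_UT) auto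
    have D: "ust q \<in> digits d" using ust[of q] ks(2) by simp
    have "gst q = \<one>" using ks(2) by (auto simp: Qu_def gst_def)
    then have fin: "final q \<longleftrightarrow> ust q = ut_one" by (simp add: final_def)
    have "P w \<longleftrightarrow> ut_mul (dilate (ut_prod (map decode ks))) (ust q) = ut_one"
      using ks(3) gval_Work[OF wW] by (simp add: P_def)
    also have "\<dots> \<longleftrightarrow> ut_prod (map decode ks) = ut_one \<and> ust q = ut_one"
      using dilate_digit_eq_one[OF U D] dilate_ut_one ut_mul_one_left[OF ut_one_in_UT] by auto
    finally show ?thesis using fin ks(1) by auto
  qed
  have \<D>_syms: "\<D> \<subseteq> lists syms" by (auto simp: \<D>_def syms_def)
  have in_\<D>: "map Input v \<in> \<D>" if "v \<in> lists \<Sigma>" for v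
    using that by (auto simp: \<D>_def)
  have P_step: "P w \<longleftrightarrow> final r \<and> (case ks of [] \<Rightarrow> True | [k] \<Rightarrow> triv k | _ \<Rightarrow> P (map Work ks))"
    if "w \<in> \<D>" "pass None w = (ks, r)" for w ks r
    using pass_P[OF that] case_ks by blast
  have \<D>_step: "map Work ks \<in> \<D>"
    if "w \<in> \<D>" "pass None w = (ks, r)" "final r" "2 \<le> length ks" for w ks r
    using pass_P[OF that(1,2)] by (auto simp: \<D>_def)
  note decides = machine_decides[OF \<D>_syms in_\<D> P_step \<D>_step]
  have "P (map Input v) \<longleftrightarrow> word_value G v = \<one>" if "v \<in> lists \<Sigma>" for v
  proof -
    have "map Input v \<in> lists (Input ` \<Sigma>)" using that by auto
    note uval_Input[OF this]
    moreover have "mprod (map gval (map Input v)) = word_value G v"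
      by (induction v) (simp_all add: word_value_def gval_def lv_def)
    ultimately show ?thesis unfolding P_def by (simp only: simp_thms)
  qed
  then have L: "{v \<in> lists \<Sigma>. P (map Input v)} = word_problem G X"
    unfolding word_problem_def \<Sigma>_def by blast
  show ?thesis
    unfolding \<Sigma>_def[symmetric]
  proof (intro exI[of _ machine] conjI ballI)
    show "is_turing_machine \<Sigma> machine" by (rule machine_is_tm)
    show "tm_decides \<Sigma> machine (word_problem G X)" using decides(1) unfolding L .
    fix w assume w: "w \<in> lists \<Sigma>"
    show "running_time machine w \<le> 8 * length w + 1"
      using machine_decides(2)[where P = P, OF \<D>_syms in_\<D> P_step \<D>_step w] .
  qed
qed

theorem theorem2:
  fixes G :: "('a, 'b) monoid_scheme" and X :: "'a set"
  assumes "group G"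
    and "nilpotent_group G"
    and "finite X"
    and "X \<subseteq> carrier G"
    and "generate G X = carrier G"
  shows "\<exists>M. is_turing_machine (group_letters X) M \<and>
             tm_decides (group_letters X) M (word_problem G X) \<and>
             (\<forall>k\<ge>1. worst_case_time (group_letters X) M
                       (\<lambda>n. real n * iterated_log k (real n)))"
proof -
  interpret group G by fact
  obtain M where M: "is_turing_machine (group_letters X) M"
    "tm_decides (group_letters X) M (word_problem G X)"
    "\<forall>w\<in>lists (group_letters X). running_time M w \<le> 8 * length w + 1"
    using virtually_sep_linear_time[OF nilpotent_virtually_sep[OF assms(2-5)] assms(3,4)] by blast
  \<comment> \<open>The shape \<open>c * n + c\<close> of the general bound asks for equal
    coefficients.\<close>
  have time: "running_time M w \<le> 8 * length w + 8" if "w \<in> lists (group_letters X)" for w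
    using bspec[OF M(3) that] by simp
  show ?thesis
    by (intro exI[of _ M] conjI allI impI M(1,2) linear_imp_worst_case_time[OF time])
qed

end
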